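(* Let $N\in\mathbb{Z}_{>0}$, $\varepsilon>0$, $A_k\in\mathbb{R}^{n\times n}$, $B_k\in\mathbb{R}^{n\times m}$ for $k=0,\dots,N-1$, and let $\bar\Sigma_0,\bar\Sigma_N\in\mathbb{R}^{n\times n}$ be symmetric positive definite. Assume: (a) $A_k$ is invertible for every $k\in\{0,\dots,N-1\}$; (b) there exists $k_{\rm r}\in\{1,\dots,N\}$ such that $G_{\rm r}(k,0)$ is invertible for every $k\in\{k_{\rm r},\dots,N\}$ and $G_{\rm r}(N,k)$ is invertible for every $k\in\{0,\dots,k_{\rm r}-1\}$; (c) with $$S_0:=\tfrac1\varepsilon G_{\rm c}(N,0)^{-1/2}\bar\Sigma_0G_{\rm c}(N,0)^{-1/2},\qquad S_N:=\tfrac1\varepsilon G_{\rm c}(N,0)^{-1/2}\Phi(0,N)\bar\Sigma_N\Phi(0,N)^\top G_{\rm c}(N,0)^{-1/2},$$ the two matrices $$\mathcal F(S_0,S_N):=S_0+\tfrac12I-\bigl(S_0^{1/2}S_NS_0^{1/2}+\tfrac14I\bigr)^{1/2},\qquad \mathcal B(S_0,S_N):=-S_0+\tfrac12I+\bigl(S_0^{1/2}S_NS_0^{1/2}+\tfrac14I\bigr)^{1/2}$$ are invertible. Let $\{Q_{-,k}\}_{k=0}^{N}$ be the solution of $$Q_{-,k+1}=A_kQ_{-,k}A_k^\top-B_kB_k^\top,\quad k\in\{0,\dots,N-1\},\qquad Q_{-,0}=G_{\rm c}(N,0)^{1/2}S_0^{1/2}\,\mathcal F(S_0,S_N)^{-1}S_0^{1/2}G_{\rm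 c}(N,0)^{1/2}.$$ Then the unique optimal policy of the MaxEnt optimal density control problem (defined in the context) is $$\pi_k^*(u|x)=\mathcal N\Bigl(u\,\Big|\,-(I+B_k^\top Q_{-,k+1}^{-1}B_k)^{-1}B_k^\top Q_{-,k+1}^{-1}A_kx,\ \varepsilon(I+B_k^\top Q_{-,k+1}^{-1}B_k)^{-1}\Bigr)$$ for $k\in\{0,\dots,N-1\}$, $x\in\mathbb{R}^n$, $u\in\mathbb{R}^m$.
   Context: Notation. For invertible $A_k$, the state-transition matrix is $\Phi(k,l)=A_{k-1}A_{k-2}\cdots A_l$ if $k>l$, $\Phi(k,k)=I$, and $\Phi(k,l)=A_k^{-1}A_{k+1}^{-1}\cdots A_{l-1}^{-1}$ if $k<l$. For $k_0<k_1$, the reachability and controllability Gramians are $$G_{\rm r}(k_1,k_0)=\sum_{k=k_0}^{k_1-1}\Phi(k_1,k+1)B_kB_k^\top\Phi(k_1,k+1)^\top,\qquad G_{\rm c}(k_1,k_0)=\sum_{k=k_0}^{k_1-1}\Phi(k_0,k+1)B_kB_k^\top\Phi(k_0,k+1)^\top .$$ They satisfy $G_{\rm c}(k_1,k_0)=\Phi(k_0,k_1)G_{\rm r}(k_1,k_0)\Phi(k_0,k_1)^\top$. For a symmetric positive (semi)definite matrix $M$, $M^{1/2}$ is its unique positive (semi)definite square root. $\mathcal N(\mu,\Sigma)$ is the Gaussian distribution with mean $\mu$ and covariance $\Sigma$, and $\mathcal N(\cdot|\mu,\Sigma)$ is its density when $\Sigma\succ0$. MaxEnt optimal density control problem. A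 policy is a sequence $\pi=\{\pi_k\}_{k=0}^{N-1}$, where $\pi_k(\cdot|x)$ is a probability density on $\mathbb{R}^m$, the conditional density of the input $u_k$ given $x_k=x$ (the input $u_k$ is drawn from $\pi_k(\cdot|x_k)$). The entropy is ${\rm H}(\pi_k(\cdot|x))=-\int_{\mathbb{R}^m}\pi_k(u|x)\log\pi_k(u|x)\,du$. The problem is to find a policy $\pi$ minimizing $$\mathbb E\Bigl[\sum_{k=0}^{N-1}\bigl(\tfrac12\|u_k\|^2-\varepsilon\,{\rm H}(\pi_k(\cdot|x_k))\bigr)\Bigr]$$ subject to $x_{k+1}=A_kx_k+B_ku_k$, $u_k\sim\pi_k(\cdot|x)$ given $x_k=x$, and $x_0\sim\mathcal N(0,\bar\Sigma_0)$, $x_N\sim\mathcal N(0,\bar\Sigma_N)$.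
   Formalization: "Unique" is read up to Lebesgue-null sets of x and u, since changing the conditional densities there alters neither process nor cost; a policy whose expected energy is infinite is assigned cost +∞, because its energy minus entropy may be ∞−∞ (or −∞ when H=+∞). *)

theory Defs
  imports "HOL-Probability.Probability"
begin

definition pos_semidef :: "real^'n^'n \<Rightarrow> bool" where
  "pos_semidef M \<longleftrightarrow> transpose M = M \<and> (\<forall>x. 0 \<le> x \<bullet> (M *v x))"

definition pos_def :: "real^'n^'n \<Rightarrow> bool" where
  "pos_def M \<longleftrightarrow> transpose M = M \<and> (\<forall>x. x \<noteq> 0 \<longrightarrow> 0 < x \<bullet> (M *v x))"

definition msqrt :: "real^'n^'n \<Rightarrow> real^'n^'n" where
  "msqrt M = (THE R. pos_semidef R \<and> R ** R = M)"

text \<open>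
  \<open>Phi A k l\<close> is \<open>A (k-1) ** \<dots> ** A l\<close> if \<open>l < k\<close>, the identity if \<open>l = k\<close>, and the product of
  the inverses of \<open>A k, \<dots>, A (l-1)\<close>, in this order, if \<open>k < l\<close>.
\<close>

definition Phi :: "(nat \<Rightarrow> real^'n^'n) \<Rightarrow> nat \<Rightarrow> nat \<Rightarrow> real^'n^'n" where
  "Phi A k l =
    (if l \<le> k then foldr (\<lambda>i P. A i ** P) (rev [l..<k]) (mat 1)
     else foldr (\<lambda>i P. matrix_inv (A i) ** P) [k..<l] (mat 1))"

definition gram_r :: "(nat \<Rightarrow> real^'n^'n) \<Rightarrow> (nat \<Rightarrow> real^'m^'n) \<Rightarrow> nat \<Rightarrow> nat \<Rightarrow> real^'n^'n" where
  "gram_r A B k1 k0 =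
    (\<Sum>k = k0..<k1. Phi A k1 (k+1) ** B k ** transpose (B k) ** transpose (Phi A k1 (k+1)))"

definition gram_c :: "(nat \<Rightarrow> real^'n^'n) \<Rightarrow> (nat \<Rightarrow> real^'m^'n) \<Rightarrow> nat \<Rightarrow> nat \<Rightarrow> real^'n^'n" where
  "gram_c A B k1 k0 =
    (\<Sum>k = k0..<k1. Phi A k0 (k+1) ** B k ** transpose (B k) ** transpose (Phi A k0 (k+1)))"

definition F_map :: "real^'n^'n \<Rightarrow> real^'n^'n \<Rightarrow> real^'n^'n" where
  "F_map S T =
    S + (1/2) *\<^sub>R mat 1 - msqrt (msqrt S ** T ** msqrt S + (1/4) *\<^sub>R mat 1)"

definition B_map :: "real^'n^'n \<Rightarrow> real^'n^'n \<Rightarrow> real^'n^'n" where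
  "B_map S T =
    - S + (1/2) *\<^sub>R mat 1 + msqrt (msqrt S ** T ** msqrt S + (1/4) *\<^sub>R mat 1)"

text \<open>To be used with positive definite \<open>S\<close> only.\<close>

definition gaussian_density :: "real^'n \<Rightarrow> real^'n^'n \<Rightarrow> real^'n \<Rightarrow> real" where
  "gaussian_density \<mu> S x =
    exp (- ((x - \<mu>) \<bullet> (matrix_inv S *v (x - \<mu>))) / 2) / sqrt ((2 * pi) ^ CARD('n) * det S)"

text \<open>
  Lebesgue integral of an extended-real function, as the integral of the positive part minus that
  of the negative part. If both are infinite then the value is \<open>\<infinity>\<close>, because
  \<open>\<infinity> - \<infinity> = \<infinity>\<close> in the type of extended reals.
\<close>

definition ext_integral :: "'a measure \<Rightarrow> ('a \<Rightarrow> ereal) \<Rightarrow> ereal" where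
  "ext_integral M f =
    enn2ereal (\<integral>\<^sup>+ x. e2ennreal (f x) \<partial>M) - enn2ereal (\<integral>\<^sup>+ x. e2ennreal (- f x) \<partial>M)"

text \<open>The convention \<open>0 log 0 = 0\<close> is automatic.\<close>

definition diff_entropy :: "(real^'m \<Rightarrow> real) \<Rightarrow> ereal" where
  "diff_entropy p = - ext_integral lborel (\<lambda>u. ereal (p u * ln (p u)))"

text \<open>\<open>\<pi> k x u\<close> is the density at \<open>u\<close> of the input \<open>u\<^sub>k\<close> given the state \<open>x\<^sub>k = x\<close>.\<close>

type_synonym ('n, 'm) policy = "nat \<Rightarrow> real^'n \<Rightarrow> real^'m \<Rightarrow> real"

definition is_policy :: "nat \<Rightarrow> ('n::finite, 'm::finite) policy \<Rightarrow> bool" where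
  "is_policy N \<pi> \<longleftrightarrow>
    (\<forall>k<N. (\<lambda>(x, u). \<pi> k x u) \<in> borel_measurable (borel \<Otimes>\<^sub>M borel) \<and>
      (\<forall>x u. 0 \<le> \<pi> k x u) \<and> (\<forall>x. (\<integral>\<^sup>+ u. ennreal (\<pi> k x u) \<partial>lborel) = 1))"

primrec state :: "(nat \<Rightarrow> real^'n^'n) \<Rightarrow> (nat \<Rightarrow> real^'m^'n) \<Rightarrow>
    (real^'n) \<times> (nat \<Rightarrow> real^'m) \<Rightarrow> nat \<Rightarrow> real^'n" where
  "state A B \<omega> 0 = fst \<omega>"
| "state A B \<omega> (Suc k) = A k *v state A B \<omega> k + B k *v snd \<omega> k"

text \<open>
  The joint law of \<open>(x\<^sub>0, (u\<^sub>k)\<^sub>k)\<close> in closed loop: \<open>x\<^sub>0\<close> has the centred Gaussian law with covariance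
  \<open>\<Sigma>0\<close>, and given \<open>x\<^sub>0\<close> and the inputs before time \<open>k\<close>, the input \<open>u\<^sub>k\<close> is drawn with density
  \<open>\<pi> k x\<^sub>k\<close>. By the chain rule the joint density is the product of the conditional ones.
  All states are functions of \<open>x\<^sub>0\<close> and the inputs, see \<open>state\<close>.
\<close>

definition closed_loop :: "nat \<Rightarrow> (nat \<Rightarrow> real^'n^'n) \<Rightarrow> (nat \<Rightarrow> real^'m^'n) \<Rightarrow> real^'n^'n \<Rightarrow>
    ('n, 'm) policy \<Rightarrow> ((real^'n) \<times> (nat \<Rightarrow> real^'m)) measure" where
  "closed_loop N A B \<Sigma>0 \<pi> =
    density (lborel \<Otimes>\<^sub>M (\<Pi>\<^sub>M k\<in>{..<N}. lborel))
      (\<lambda>\<omega>. ennreal (gaussian_density 0 \<Sigma>0 (fst \<omega>) *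
        (\<Prod>k<N. \<pi> k (state A B \<omega> k) (snd \<omega> k))))"

text \<open>
  If the expected control energy is finite then almost surely all the entropies are below \<open>\<infinity>\<close>, and
  the expected cost is well defined in \<open>(-\<infinity>, \<infinity>]\<close>. A policy of infinite expected
  energy may have entropies equal to \<open>\<infinity>\<close>, so that energy minus entropy is of the form
  \<open>\<infinity> - \<infinity>\<close>; its cost is \<open>\<infinity>\<close> by convention.
\<close>

definition cost :: "nat \<Rightarrow> real \<Rightarrow> (nat \<Rightarrow> real^'n^'n) \<Rightarrow> (nat \<Rightarrow> real^'m^'n) \<Rightarrow> real^'n^'n \<Rightarrow>
    ('n, 'm) policy \<Rightarrow> ereal" where
  "cost N \<epsilon> A B \<Sigma>0 \<pi> =
    (if (\<integral>\<^sup>+ \<omega>. ennreal (\<Sum>k<N. (norm (snd \<omega> k))\<^sup>2 / 2) \<partial>closed_loop N A B \<Sigma>0 \<pi>) = \<infinity> then \<infinity>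
     else ext_integral (closed_loop N A B \<Sigma>0 \<pi>)
       (\<lambda>\<omega>. \<Sum>k<N. ereal ((norm (snd \<omega> k))\<^sup>2 / 2)
                    - ereal \<epsilon> * diff_entropy (\<pi> k (state A B \<omega> k))))"

definition feasible :: "nat \<Rightarrow> (nat \<Rightarrow> real^'n^'n) \<Rightarrow> (nat \<Rightarrow> real^'m^'n) \<Rightarrow> real^'n^'n \<Rightarrow>
    real^'n^'n \<Rightarrow> ('n::finite, 'm::finite) policy \<Rightarrow> bool" where
  "feasible N A B \<Sigma>0 \<Sigma>N \<pi> \<longleftrightarrow> is_policy N \<pi> \<and>
    distributed (closed_loop N A B \<Sigma>0 \<pi>) lborel (\<lambda>\<omega>. state A B \<omega> N)
      (\<lambda>x. ennreal (gaussian_density 0 \<Sigma>N x))"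

definition optimal_policy :: "nat \<Rightarrow> real \<Rightarrow> (nat \<Rightarrow> real^'n^'n) \<Rightarrow> (nat \<Rightarrow> real^'m^'n) \<Rightarrow>
    real^'n^'n \<Rightarrow> real^'n^'n \<Rightarrow> ('n::finite, 'm::finite) policy \<Rightarrow> bool" where
  "optimal_policy N \<epsilon> A B \<Sigma>0 \<Sigma>N \<pi> \<longleftrightarrow> feasible N A B \<Sigma>0 \<Sigma>N \<pi> \<and>
    (\<forall>\<rho>. feasible N A B \<Sigma>0 \<Sigma>N \<rho> \<longrightarrow> cost N \<epsilon> A B \<Sigma>0 \<pi> \<le> cost N \<epsilon> A B \<Sigma>0 \<rho>)"

text \<open>
  The time index of \<open>Q\<close> is shifted by one: the input at time \<open>k\<close>
  involves \<open>Q (k+1)\<close>.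
\<close>

definition input_cov :: "(nat \<Rightarrow> real^'m^'n) \<Rightarrow> (nat \<Rightarrow> real^'n^'n) \<Rightarrow> nat \<Rightarrow> real^'m^'m" where
  "input_cov B Q k = matrix_inv (mat 1 + transpose (B k) ** matrix_inv (Q (k+1)) ** B k)"

definition gaussian_policy :: "real \<Rightarrow> (nat \<Rightarrow> real^'n^'n) \<Rightarrow> (nat \<Rightarrow> real^'m^'n) \<Rightarrow>
    (nat \<Rightarrow> real^'n^'n) \<Rightarrow> ('n, 'm) policy" where
  "gaussian_policy \<epsilon> A B Q k x u =
    gaussian_density
      (- ((input_cov B Q k ** transpose (B k) ** matrix_inv (Q (k+1)) ** A k) *v x))
      (\<epsilon> *\<^sub>R input_cov B Q k) u"

end

(*
  Let P k = Phi(0,k) Q k Phi(0,k)^T, so that P k = Q 0 - G_c(k,0) by the Lyapunov recursion. Writing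
  K = (S0^(1/2) SN S0^(1/2) + I/4)^(1/2) - I/2, which is positive definite, one finds that
  Y = G^-1 - (Q 0)^-1 is congruent to K, hence positive definite (G = G_c(N,0)). Since
  G_c(k,0) <= G for all k <= N, an arithmetic-geometric mean estimate then shows that no P k is singular
  and that I - C^T (P k)^-1 C is positive definite for C = Phi(0,k+1) B k; its inverse is
  I + B^T (Q (k+1))^-1 B.

  The quadratic forms x^T (Q k)^-1 x / 2 solve the soft Bellman equation, so by completing the square
  the cost of every feasible policy of finite energy equals a constant, which depends on the two
  prescribed marginals only, plus eps times the expected relative entropies of pi_k(.|x_k) with
  respect to pi*_k(.|x_k). Hence pi* is optimal as soon as it is feasible, and an optimal policy agrees
  with pi* almost everywhere with respect to the law of x_k, which is a nondegenerate Gaussian.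

  Feasibility: if Sigma_k is the covariance of x_k under pi*, then the matrices
  W k = (Q k)^-1 Sigma_k (Q k)^-1 / eps - (Q k)^-1 satisfy W (k+1) = A^-T (W k) A^-1, and at k = N the
  condition on the terminal covariance becomes K^2 + K = S0^(1/2) SN S0^(1/2).
*)

theory Submission
  imports Defs
begin

section \<open>Symmetric matrices\<close>

text \<open>The obstacle is the sign of \<open>Q k\<close>. As \<open>F_map S0 SN\<close> is only
  known to be invertible, \<open>Q 0\<close> may be indefinite, and monotonicity of inversion says
  nothing about later \<open>Q k\<close> or about the input covariances. The usable information is
  one-sided: F = S0 - K, and in the congruence that gives (Q 0)^-1 the term S0 turns into G^-1, so
  (Q 0)^-1 is G^-1 minus a copy of K. The bound (Q 0)^-1 < G^-1 thus holds whatever the signature of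
  F.

  The shifts 1/4 and 1/2 complete a square: the terminal condition is quadratic, and K is its
  positive root.

  W k stems from a pair of Lyapunov solutions: if an invertible R k satisfies eps Sigma_k^-1 = (Q
  k)^-1 + (R k)^-1, then W k = - (Q k + R k)^-1, and R k obeys the recursion with + B B^T, so that
  the noise cancels in the sum. Written through Sigma_k, W k needs no second solution.

  Entropies may be -infinity, so the cost cannot be split into finite expectations: each stage is
  written as an integrable real function plus a nonnegative extended one.\<close>

declare transpose_matrix_vector [simp del]

lemma matrix_diff_ldistrib: "(A :: real^'n^'m) ** (B - C) = A ** B - A ** C"
  by (simp add: matrix_matrix_mult_def vec_eq_iff right_diff_distrib sum_subtractf)

lemma matrix_diff_rdistrib: "((B - C) :: real^'n^'m) ** A = B ** A - C ** A"
  by (simp add: matrix_matrix_mult_def vec_eq_iff left_diff_distrib sum_subtractf)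

lemma matrix_add_rdistrib: "((B + C) :: real^'n^'m) ** A = B ** A + C ** A"
  by (simp add: matrix_matrix_mult_def vec_eq_iff distrib_right sum.distrib)

lemma transpose_add: "transpose (A + B) = transpose A + transpose (B :: real^'n^'m)"
  by (simp add: transpose_def vec_eq_iff)

lemma transpose_diff: "transpose (A - B) = transpose A - transpose (B :: real^'n^'m)"
  by (simp add: transpose_def vec_eq_iff)

lemmas matrix_distribs = matrix_add_ldistrib matrix_add_rdistrib
  matrix_diff_ldistrib matrix_diff_rdistrib scalar_matrix_assoc[symmetric] matrix_scalar_ac

lemmas transpose_distribs = transpose_add transpose_diff transpose_scalar matrix_transpose_mul

lemma dot_matrix_left: "(A *v x) \<bullet> y = x \<bullet> (transpose A *v y)" for A :: "real^'n^'m"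
  by (metis dot_lmul_matrix inner_commute transpose_matrix_vector)

lemma dot_matrix_right: "x \<bullet> (A *v y) = (transpose A *v x) \<bullet> y" for A :: "real^'n^'m"
  by (simp add: dot_matrix_left)

lemma matrix_inv_mult:
  assumes "invertible A"
  shows matrix_inv_right: "A ** matrix_inv A = mat 1"
    and matrix_inv_left: "matrix_inv A ** A = mat 1"
  using someI_ex[OF assms[unfolded invertible_def]] unfolding matrix_inv_def by auto

lemma matrix_inv_unique:
  fixes A :: "real^'n^'n"
  assumes "A ** B = mat 1"
  shows "invertible A" and "matrix_inv A = B"
proof -
  show *: "invertible A"
    using assms invertible_right_inverse by blast
  show "matrix_inv A = B"
    by (metis * assms matrix_inv_left matrix_mul_assoc matrix_mul_lid matrix_mul_rid)
qed

lemma invertible_matrix_inv: "invertible A \<Longrightarrow> invertible (matrix_inv A)" for A :: "real^'n^'n"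
  using matrix_inv_left matrix_inv_unique(1) by blast

lemma invertible_iff_ker: "invertible A \<longleftrightarrow> (\<forall>x. A *v x = 0 \<longrightarrow> x = 0)" for A :: "real^'n^'n"
  by (simp add: invertible_left_inverse matrix_left_invertible_ker)

lemma matrix_inv_vec [simp]:
  assumes "invertible A"
  shows "A *v (matrix_inv A *v x) = x" "matrix_inv A *v (A *v x) = x"
  using assms by (simp_all add: matrix_vector_mul_assoc matrix_inv_mult)

lemma transpose_matrix_inv:
  fixes A :: "real^'n^'n"
  assumes "invertible A"
  shows "matrix_inv (transpose A) = transpose (matrix_inv A)"
  by (metis assms matrix_inv_left matrix_inv_unique(2) matrix_transpose_mul transpose_mat)

lemma sym_matrix_inv:
  fixes A :: "real^'n^'n"
  assumes "transpose A = A" "invertible A"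
  shows "transpose (matrix_inv A) = matrix_inv A"
  by (metis assms transpose_matrix_inv)

lemma pos_def_sym: "pos_def M \<Longrightarrow> transpose M = M"
  by (simp add: pos_def_def)

lemma pos_def_pos: "pos_def M \<Longrightarrow> x \<noteq> 0 \<Longrightarrow> 0 < x \<bullet> (M *v x)"
  by (simp add: pos_def_def)

lemma pos_def_nonneg: "pos_def M \<Longrightarrow> 0 \<le> x \<bullet> (M *v x)"
  by (cases "x = 0") (auto simp: pos_def_def intro: less_imp_le)

lemma pos_def_imp_semidef: "pos_def M \<Longrightarrow> pos_semidef M"
  by (simp add: pos_semidef_def pos_def_sym pos_def_nonneg)

lemma pos_def_invertible: "pos_def M \<Longrightarrow> invertible M"
  unfolding invertible_iff_ker using pos_def_pos by fastforce

lemma pos_def_matrix_inv: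
  assumes "pos_def M"
  shows "pos_def (matrix_inv M)"
  unfolding pos_def_def
proof (intro conjI allI impI)
  have inv: "invertible M"
    using assms by (rule pos_def_invertible)
  then show sym: "transpose (matrix_inv M) = matrix_inv M"
    using assms by (simp add: pos_def_sym sym_matrix_inv)
  fix x :: "real^'a" assume "x \<noteq> 0"
  then have "matrix_inv M *v x \<noteq> 0"
    by (metis inv matrix_inv_vec(1) matrix_vector_mult_0_right)
  from pos_def_pos[OF assms this] show "0 < x \<bullet> (matrix_inv M *v x)"
    using inv by (simp add: inner_commute)
qed

lemma pos_def_congruence:
  fixes T :: "real^'n^'n"
  assumes "pos_def M" "invertible T"
  shows "pos_def (transpose T ** M ** T)"
proof -
  have "x \<bullet> ((transpose T ** M ** T) *v x) = (T *v x) \<bullet> (M *v (T *v x))" for x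
    by (simp add: matrix_vector_mul_assoc[symmetric] dot_matrix_left)
  moreover have "T *v x \<noteq> 0" if "x \<noteq> 0" for x
    using assms(2) that invertible_iff_ker by blast
  ultimately show ?thesis
    using assms(1) by (simp add: pos_def_def matrix_transpose_mul matrix_mul_assoc)
qed

lemma pos_def_scaleR:
  assumes "pos_def M" "0 < c"
  shows "pos_def (c *\<^sub>R M)"
  using assms by (simp add: pos_def_def transpose_scalar flip: scaleR_matrix_vector_assoc)

lemma pos_def_add_semidef:
  assumes "pos_def M" "pos_semidef L"
  shows "pos_def (M + L)"
  using assms unfolding pos_def_def pos_semidef_def
  by (auto simp: transpose_add matrix_vector_mult_add_rdistrib inner_add_right
      intro: add_pos_nonneg)

lemma pos_def_mat_1: "pos_def (mat 1 :: real^'n^'n)"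
  by (simp add: pos_def_def)

lemma matrix_inv_scaleR:
  fixes M :: "real^'n^'n"
  assumes "invertible M" "c \<noteq> 0"
  shows "matrix_inv (c *\<^sub>R M) = (1/c) *\<^sub>R matrix_inv M"
  using assms by (intro matrix_inv_unique) (simp add: matrix_distribs matrix_inv_right)

lemma min_eigenvector:
  fixes M :: "real^'n^'n"
  assumes sym: "transpose M = M" and V: "subspace V" "V \<noteq> {0}"
    and inv: "\<And>x. x \<in> V \<Longrightarrow> M *v x \<in> V"
  obtains v c where "v \<in> V" "norm v = 1" "M *v v = c *\<^sub>R v"
    "\<forall>x\<in>V. c * (x \<bullet> x) \<le> x \<bullet> (M *v x)"
proof -
  let ?S = "V \<inter> sphere 0 1"
  have "compact ?S"
    by (simp add: closed_Int_compact closed_subspace V)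
  moreover have "?S \<noteq> {}"
  proof -
    obtain x where x: "x \<in> V" "x \<noteq> 0"
      using V subspace_0 by blast
    then have "x /\<^sub>R norm x \<in> ?S"
      using V by (simp add: subspace_scale)
    then show ?thesis by blast
  qed
  moreover have "continuous_on ?S (\<lambda>x. x \<bullet> (M *v x))"
    by (intro continuous_intros linear_continuous_on) auto
  ultimately obtain v where v: "v \<in> ?S" and min: "\<And>x. x \<in> ?S \<Longrightarrow> v \<bullet> (M *v v) \<le> x \<bullet> (M *v x)"
    using continuous_attains_inf[of ?S] by blast
  define c where "c = v \<bullet> (M *v v)"
  have le: "c * (x \<bullet> x) \<le> x \<bullet> (M *v x)" if x: "x \<in> V" for x
  proof (cases "x = 0")
    case False
    then have "x /\<^sub>R norm x \<in> ?S"
      using x V by (simp add: subspace_scale)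
    from min[OF this] have "c \<le> (x \<bullet> (M *v x)) / (norm x)\<^sup>2"
      by (simp add: c_def matrix_vector_mult_scaleR power2_eq_square divide_inverse mult_ac)
    then show ?thesis
      using False by (simp add: dot_square_norm pos_le_divide_eq)
  qed simp
  \<comment> \<open>The residual is the direction in which the quotient could be lowered: it lies in
    \<open>V\<close>, is orthogonal to \<open>v\<close>, and the variation along it has linear term
    \<open>2 * t * (w \<bullet> w)\<close>.\<close>
  define w where "w = M *v v - c *\<^sub>R v"
  have vv: "v \<bullet> v = 1"
    using v by (simp add: dot_square_norm)
  have wV: "w \<in> V"
    unfolding w_def using v V inv by (simp add: subspace_diff subspace_scale)
  have vw: "v \<bullet> w = 0"
    by (simp add: w_def inner_diff_right c_def vv)
  define b where "b = w \<bullet> (M *v w) - c * (w \<bullet> w)"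
  have quad: "0 \<le> 2 * t * (w \<bullet> w) + t\<^sup>2 * b" for t
  proof -
    have "v + t *\<^sub>R w \<in> V"
      using v V wV by (simp add: subspace_add subspace_scale)
    from le[OF this] have 1: "0 \<le> (v + t *\<^sub>R w) \<bullet> (M *v (v + t *\<^sub>R w))
        - c * ((v + t *\<^sub>R w) \<bullet> (v + t *\<^sub>R w))"
      by simp
    have 2: "v \<bullet> (M *v w) = w \<bullet> (M *v v)"
      by (metis dot_matrix_right sym inner_commute)
    have 3: "w \<bullet> (M *v v) = w \<bullet> w"
      using vw by (simp add: w_def inner_diff_right inner_diff_left inner_commute)
    have 4: "(v + t *\<^sub>R w) \<bullet> (M *v (v + t *\<^sub>R w))
        = v \<bullet> (M *v v) + t * (v \<bullet> (M *v w)) + t * (w \<bullet> (M *v v)) + t\<^sup>2 * (w \<bullet> (M *v w))"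
      by (simp add: matrix_vector_right_distrib matrix_vector_mult_scaleR inner_add_left
          inner_add_right power2_eq_square distrib_left)
    have 5: "(v + t *\<^sub>R w) \<bullet> (v + t *\<^sub>R w) = 1 + t\<^sup>2 * (w \<bullet> w)"
      using vw by (simp add: inner_add_left inner_add_right vv inner_commute[of w v] power2_eq_square)
    show ?thesis
      using 1 unfolding 4 5 2 3 c_def[symmetric] b_def by (simp add: algebra_simps)
  qed
  have "w \<bullet> w = 0"
  proof (rule ccontr)
    define a where "a = w \<bullet> w"
    assume "w \<bullet> w \<noteq> 0"
    then have a: "a > 0"
      by (simp add: a_def)
    \<comment> \<open>Any positive d > b works: at t = -a/d the linear term outweighs t^2 b,
      whatever the sign of b.\<close>
    define d where "d = \<bar>b\<bar> + 1"
    have d: "d > 0" "b < d"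
      by (auto simp: d_def)
    have "0 \<le> 2 * (- a / d) * a + (- a / d)\<^sup>2 * b"
      using quad[of "- a / d"] by (simp add: a_def)
    also have "\<dots> = (a / d)\<^sup>2 * (b - 2 * d)"
      using d(1) by (simp add: power2_eq_square divide_simps) (simp add: algebra_simps)
    also have "\<dots> < 0"
      using a d by (intro mult_pos_neg) auto
    finally show False by simp
  qed
  then have "M *v v = c *\<^sub>R v"
    by (simp add: w_def)
  then show thesis
    using that v le by auto
qed

lemma min_eigenvector_UNIV:
  fixes M :: "real^'n^'n"
  assumes "transpose M = M"
  obtains v c where "norm v = 1" "M *v v = c *\<^sub>R v" "\<forall>x. c * (x \<bullet> x) \<le> x \<bullet> (M *v x)"
proof -
  have "axis undefined 1 \<noteq> (0 :: real^'n)"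
    by (simp add: axis_eq_0_iff)
  then have ne: "(UNIV :: (real^'n) set) \<noteq> {0}"
    by blast
  show thesis
    by (rule min_eigenvector[OF assms subspace_UNIV ne]) (auto intro: that)
qed

text \<open>Induction on the dimension of an invariant subspace: by symmetry, the orthogonal
  complement of an eigenvector inside it is again invariant.\<close>

lemma spectral_theorem:
  fixes M :: "real^'n^'n"
  assumes sym: "transpose M = M"
  obtains E where "finite E" "pairwise orthogonal E" "\<And>e. e \<in> E \<Longrightarrow> norm e = 1"
    "\<And>e. e \<in> E \<Longrightarrow> \<exists>c. M *v e = c *\<^sub>R e" "span E = UNIV"
proof -
  have "\<exists>E \<subseteq> V. finite E \<and> pairwise orthogonal E \<and> (\<forall>e\<in>E. norm e = 1 \<and> (\<exists>c. M *v e = c *\<^sub>R e))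
     \<and> V \<subseteq> span E" if "subspace V" "\<And>x. x \<in> V \<Longrightarrow> M *v x \<in> V" for V
    using that
  proof (induction "dim V" arbitrary: V rule: less_induct)
    case less
    show ?case
    proof (cases "V = {0}")
      case True
      then show ?thesis
        by (intro exI[of _ "{}"]) auto
    next
      case False
      obtain v c where v: "v \<in> V" "norm v = 1" "M *v v = c *\<^sub>R v"
        by (rule min_eigenvector[OF sym less.prems(1) False less.prems(2)])
      define W where "W = {x \<in> V. v \<bullet> x = 0}"
      have W: "subspace W"
        using less.prems(1) unfolding W_def subspace_def by (auto simp: inner_add_right)
      have "M *v x \<in> W" if "x \<in> W" for x
        using that less.prems(2) v(3) by (simp add: W_def dot_matrix_right sym)
      moreover have "dim W < dim V"
      proof (rule dim_psubset)
        have "v \<notin> W"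
          using v by (auto simp: W_def)
        then show "span W \<subset> span V"
          using v(1) W less.prems(1) unfolding W_def
          by (metis (no_types, lifting) mem_Collect_eq psubsetI span_eq_iff subsetI)
      qed
      ultimately obtain E where E: "E \<subseteq> W" "finite E" "pairwise orthogonal E"
        "\<forall>e\<in>E. norm e = 1 \<and> (\<exists>c. M *v e = c *\<^sub>R e)" "W \<subseteq> span E"
        using less.hyps[OF _ W] by meson
      have "x \<in> span (insert v E)" if "x \<in> V" for x
      proof -
        have "x - (v \<bullet> x) *\<^sub>R v \<in> W"
          using that v less.prems(1)
          by (auto simp: W_def inner_diff_right dot_square_norm intro: subspace_diff subspace_scale)
        then show ?thesis
          using E(5) span_breakdown_eq by blast
      qed
      moreover have "pairwise orthogonal (insert v E)"
        using E(1,3) by (auto simp: pairwise_insert W_def orthogonal_def inner_commute)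
      ultimately show ?thesis
        using v E by (intro exI[of _ "insert v E"]) (auto simp: W_def)
    qed
  qed
  from this[of UNIV] show ?thesis
    using that by auto
qed

text \<open>The least eigenvalue bounds the Rayleigh quotient from below. This serves matrices whose
  quadratic form is out of reach but whose eigenvalues satisfy a scalar equation.\<close>

lemma pos_def_if_eigenvalues_pos:
  assumes "transpose M = M" and "\<And>v c. v \<noteq> 0 \<Longrightarrow> M *v v = c *\<^sub>R v \<Longrightarrow> 0 < c"
  shows "pos_def M"
proof -
  obtain v c where v: "norm v = 1" "M *v v = c *\<^sub>R v"
    "\<forall>x. c * (x \<bullet> x) \<le> x \<bullet> (M *v x)"
    using min_eigenvector_UNIV[OF assms(1)] by blast
  have "0 < c"
    using v(1,2) by (intro assms(2)[of v]) auto
  have "0 < x \<bullet> (M *v x)" if "x \<noteq> 0" for x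
  proof -
    have "0 < c * (x \<bullet> x)"
      using \<open>0 < c\<close> that by simp
    then show ?thesis
      using v(3) by (meson less_le_trans)
  qed
  then show ?thesis
    using assms(1) by (simp add: pos_def_def)
qed

lemma pos_def_if_semidef_invertible:
  assumes "pos_semidef M" "invertible M"
  shows "pos_def M"
proof (rule pos_def_if_eigenvalues_pos)
  show "transpose M = M"
    using assms(1) by (simp add: pos_semidef_def)
  fix v :: "real^'a" and c assume v: "v \<noteq> 0" "M *v v = c *\<^sub>R v"
  have "0 \<le> v \<bullet> (c *\<^sub>R v)"
    using assms(1) v(2) unfolding pos_semidef_def by metis
  then have "0 \<le> c"
    using v(1) by (smt (verit) inner_gt_zero_iff inner_scaleR_right mult_neg_pos)
  moreover have "c \<noteq> 0"
    using assms(2) v by (auto simp: invertible_iff_ker)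
  ultimately show "0 < c"
    by simp
qed

lemma pos_def_coercive:
  fixes M :: "real^'n^'n"
  assumes "pos_def M"
  obtains c where "0 < c" "\<And>x. c * (norm x)\<^sup>2 \<le> x \<bullet> (M *v x)"
proof -
  obtain v c where v: "norm v = 1" "M *v v = c *\<^sub>R v"
    "\<forall>x. c * (x \<bullet> x) \<le> x \<bullet> (M *v x)"
    using min_eigenvector_UNIV[OF pos_def_sym[OF assms]] by blast
  have "0 < c"
    using pos_def_pos[OF assms, of v] v(1,2) by (cases "v = 0") (auto simp: dot_square_norm)
  then show thesis
    using that v(3) by (simp add: dot_square_norm)
qed

subsection \<open>Square roots\<close>

lemma semidef_sqrt_exists:
  fixes M :: "real^'n^'n"
  assumes "pos_semidef M"
  obtains R where "pos_semidef R" "R ** R = M"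
proof -
  obtain E where E: "finite E" "pairwise orthogonal E" "\<And>e. e \<in> E \<Longrightarrow> norm e = 1"
    "\<And>e. e \<in> E \<Longrightarrow> \<exists>c. M *v e = c *\<^sub>R e" "span E = UNIV"
    using spectral_theorem assms unfolding pos_semidef_def by metis
  \<comment> \<open>At a unit eigenvector \<open>e \<bullet> (M *v e)\<close> is the eigenvalue
    itself, so \<open>f\<close> multiplies each \<open>e\<close> by its square root and no choice of
    eigenvalues is made.\<close>
  define r where "r e = sqrt (e \<bullet> (M *v e))" for e
  define f where "f x = (\<Sum>e\<in>E. (r e * (e \<bullet> x)) *\<^sub>R e)" for x
  have f: "linear f"
    unfolding f_def
    by (rule linearI)
      (auto simp: inner_add_right algebra_simps scaleR_sum_right sum.distrib intro!: sum.cong)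
  define R where "R = matrix f"
  have R: "R *v x = f x" for x
    unfolding R_def using f by (simp add: matrix_works)
  have "x \<bullet> f y = f x \<bullet> y" for x y
    by (auto simp: f_def inner_sum_left inner_sum_right inner_commute intro!: sum.cong)
  then have "transpose R = R"
    by (metis R matrix_eq vector_eq_ldot dot_matrix_left)
  moreover have "0 \<le> x \<bullet> f x" for x
    unfolding f_def inner_sum_right using assms
    by (intro sum_nonneg) (simp add: inner_commute[of x] mult.assoc r_def pos_semidef_def)
  ultimately have 1: "pos_semidef R"
    by (simp add: pos_semidef_def R)
  have fe: "f e = r e *\<^sub>R e" if "e \<in> E" for e
  proof -
    have "(r d * (d \<bullet> e)) *\<^sub>R d = (if d = e then r e *\<^sub>R e else 0)" if "d \<in> E" for d
      using E(2,3) \<open>e \<in> E\<close> that by (auto simp: pairwise_def orthogonal_def dot_square_norm)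
    then show ?thesis
      unfolding f_def using E(1) that by simp
  qed
  have "(R ** R) *v e = M *v e" if e: "e \<in> E" for e
  proof -
    obtain c where c: "M *v e = c *\<^sub>R e"
      using E(4) e by blast
    then have "c = e \<bullet> (M *v e)"
      using E(3)[OF e] by (simp add: dot_square_norm)
    moreover have "0 \<le> e \<bullet> (M *v e)"
      using assms by (simp add: pos_semidef_def)
    ultimately have "r e * r e = c"
      by (simp add: r_def)
    then show ?thesis
      using e fe f c by (simp add: R matrix_vector_mul_assoc[symmetric] linear_cmul)
  qed
  then have "R ** R = M"
    unfolding matrix_eq using linear_eq_on_span[of "(*v) (R ** R)" "(*v) M" E] E(5) by auto
  with 1 show thesis
    by (rule that)
qed

text \<open>The two roots are compared on an eigenbasis of \<open>R\<close> alone. There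
  \<open>T\<close> applied twice acts as c^2, and (T + c)(T - c) e = 0 leaves no room for a negative
  eigenvalue of \<open>T\<close>; the case c = 0 is settled by the norm of T e.\<close>

lemma semidef_sqrt_unique:
  fixes R T :: "real^'n^'n"
  assumes R: "pos_semidef R" and T: "pos_semidef T" and eq: "R ** R = T ** T"
  shows "R = T"
proof -
  obtain E where E: "\<And>e. e \<in> E \<Longrightarrow> \<exists>c. R *v e = c *\<^sub>R e"
      "\<And>e. e \<in> E \<Longrightarrow> norm e = 1" "span E = UNIV"
    using spectral_theorem R unfolding pos_semidef_def by metis
  have "T *v e = R *v e" if e: "e \<in> E" for e
  proof -
    obtain c where c: "R *v e = c *\<^sub>R e"
      using E e by blast
    have c0: "0 \<le> c"
      using R c E(2)[OF e] unfolding pos_semidef_def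
      by (metis inner_scaleR_right dot_square_norm mult.right_neutral power_one)
    have TT: "T *v (T *v e) = (c * c) *\<^sub>R e"
      using eq c by (metis matrix_vector_mul_assoc matrix_vector_mult_scaleR scaleR_scaleR)
    define w where "w = T *v e - c *\<^sub>R e"
    have Tw: "T *v w = - c *\<^sub>R w"
      by (simp add: w_def matrix_vector_mult_diff_distrib matrix_vector_mult_scaleR TT algebra_simps)
    have "0 \<le> - c * (w \<bullet> w)"
      using T Tw unfolding pos_semidef_def by (metis inner_scaleR_right)
    then consider "w = 0" | "c = 0"
      using c0 by (smt (verit) inner_gt_zero_iff mult_pos_pos mult_minus_left)
    then show ?thesis
    proof cases
      case 2
      have "(T *v e) \<bullet> (T *v e) = e \<bullet> (T *v (T *v e))"
        using T by (simp add: pos_semidef_def dot_matrix_left)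
      then show ?thesis
        using TT 2 c by simp
    qed (simp add: w_def c)
  qed
  then show ?thesis
    unfolding matrix_eq using linear_eq_on_span[of "(*v) R" "(*v) T" E] E(3) by auto
qed

lemma msqrt:
  assumes "pos_semidef M"
  shows pos_semidef_msqrt: "pos_semidef (msqrt M)" and msqrt_square: "msqrt M ** msqrt M = M"
proof -
  have "\<exists>!R. pos_semidef R \<and> R ** R = M"
    using semidef_sqrt_exists[OF assms] semidef_sqrt_unique by metis
  from theI'[OF this] show "pos_semidef (msqrt M)" "msqrt M ** msqrt M = M"
    by (auto simp: msqrt_def)
qed

lemma pos_def_msqrt:
  assumes "pos_def M"
  shows "pos_def (msqrt M)"
proof (rule pos_def_if_semidef_invertible)
  have M: "pos_semidef M"
    using assms by (rule pos_def_imp_semidef)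
  then show "pos_semidef (msqrt M)"
    by (rule pos_semidef_msqrt)
  show "invertible (msqrt M)"
    unfolding invertible_iff_ker
  proof (intro allI impI)
    fix x assume "msqrt M *v x = 0"
    then have "M *v x = 0"
      by (metis M msqrt_square matrix_vector_mul_assoc matrix_vector_mult_0_right)
    then show "x = 0"
      using pos_def_invertible[OF assms] invertible_iff_ker by blast
  qed
qed

text \<open>(K + 1/2)^2 = X + 1/4 is K^2 + K = X. An eigenvalue c of \<open>K\<close> satisfies c >=
  -1/2, because the root is semidefinite, and c (c + 1) > 0, because \<open>X\<close> is definite;
  together these give c > 0.\<close>

lemma pos_def_msqrt_shift:
  fixes X :: "real^'n^'n"
  assumes "pos_def X"
  defines "K \<equiv> msqrt (X + (1/4) *\<^sub>R mat 1) - (1/2) *\<^sub>R mat 1"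
  shows "pos_def K" and "K ** K + K = X"
proof -
  have "pos_def (X + (1/4) *\<^sub>R mat 1)"
    using assms(1) pos_def_mat_1
    by (intro pos_def_add_semidef pos_def_imp_semidef pos_def_scaleR) auto
  then have R: "pos_semidef (X + (1/4) *\<^sub>R mat 1)"
    by (rule pos_def_imp_semidef)
  let ?R = "msqrt (X + (1/4) *\<^sub>R mat 1)"
  have "K ** K + K = ?R ** ?R - (1/4) *\<^sub>R mat 1"
    unfolding K_def by (simp add: matrix_distribs vec_eq_iff algebra_simps)
  then show KK: "K ** K + K = X"
    by (simp add: msqrt_square[OF R])
  show "pos_def K"
  proof (rule pos_def_if_eigenvalues_pos)
    show "transpose K = K"
      using pos_semidef_msqrt[OF R] by (simp add: K_def transpose_distribs pos_semidef_def)
    fix v :: "real^'n" and c assume v: "v \<noteq> 0" "K *v v = c *\<^sub>R v"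
    have "?R *v v = (c + 1/2) *\<^sub>R v"
      using v(2) unfolding K_def
      by (simp add: matrix_vector_mult_diff_rdistrib scaleR_add_left algebra_simps
          flip: scaleR_matrix_vector_assoc)
    then have "0 \<le> v \<bullet> ((c + 1/2) *\<^sub>R v)"
      using pos_semidef_msqrt[OF R] unfolding pos_semidef_def by metis
    then have "0 \<le> (c + 1/2) * (v \<bullet> v)"
      by (metis inner_scaleR_right)
    moreover have "0 < v \<bullet> v"
      using v(1) by simp
    ultimately have c: "-1/2 \<le> c"
      using mult_neg_pos[of "c + 1/2" "v \<bullet> v"] by linarith
    have "X *v v = (c * (c + 1)) *\<^sub>R v"
      unfolding KK[symmetric]
      by (simp add: matrix_vector_mult_add_rdistrib v(2) matrix_vector_mul_assoc[symmetric]
          matrix_vector_mult_scaleR distrib_left scaleR_add_left)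
    then have "0 < (c * (c + 1)) * (v \<bullet> v)"
      using pos_def_pos[OF assms(1) v(1)] by simp
    then have "0 < c * (c + 1)"
      by (rule zero_less_mult_pos2) (use v(1) in simp)
    then show "0 < c"
      using c by (simp add: zero_less_mult_iff)
  qed
qed

section \<open>Gaussian integrals\<close>

lemma borel_measurable_vec_lambda [measurable (raw)]:
  fixes f :: "'a \<Rightarrow> 'n::finite \<Rightarrow> real"
  assumes "\<And>i. (\<lambda>x. f x i) \<in> borel_measurable M"
  shows "(\<lambda>x. \<chi> i. f x i) \<in> borel_measurable M"
  using assms by (subst borel_measurable_euclidean_space) (auto simp: Basis_vec_def inner_axis)

lemma borel_measurable_matrix_vector_mult [measurable (raw)]:
  fixes T :: "real^'n^'m"
  assumes "f \<in> borel_measurable M"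
  shows "(\<lambda>x. T *v f x) \<in> borel_measurable M"
  by (rule measurable_compose[OF assms borel_measurable_continuous_onI])
    (intro linear_continuous_on matrix_vector_mul_bounded_linear)

lemma prod_Basis_vec: "(\<Prod>b\<in>Basis. g (x \<bullet> b)) = (\<Prod>i\<in>UNIV. g (x $ i))"
  for x :: "real^'n" and g :: "real \<Rightarrow> 'b::comm_monoid_mult"
proof -
  have B: "Basis = (\<lambda>i. axis i 1 :: real^'n) ` UNIV"
    by (auto simp: Basis_vec_def)
  have "inj (\<lambda>i. axis i 1 :: real^'n)"
    by (auto simp: inj_on_def axis_eq_axis)
  then show ?thesis
    unfolding B by (simp add: prod.reindex inner_axis)
qed

text \<open>Presents Lebesgue measure as a product over the index type, so that a single coordinate
  can be split off by Fubini. Agreement on boxes suffices.\<close>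

lemma lborel_vec_eq:
  "(lborel :: (real^'n) measure) = distr (\<Pi>\<^sub>M i\<in>UNIV. lborel) borel (\<lambda>f. \<chi> i. f i)"
proof (rule lborel_eqI)
  interpret product_sigma_finite "\<lambda>_::'n. lborel :: real measure" ..
  fix l u :: "real^'n" assume le: "\<And>b. b \<in> Basis \<Longrightarrow> l \<bullet> b \<le> u \<bullet> b"
  have le': "l $ i \<le> u $ i" for i
    using le[of "axis i 1"] by (simp add: inner_axis)
  have "(\<lambda>f. \<chi> i. f i) -` box l u \<inter> space (\<Pi>\<^sub>M i\<in>UNIV. lborel)
      = (\<Pi>\<^sub>E i\<in>UNIV. {l $ i <..< u $ i})"
    by (auto simp: mem_box_cart space_PiM PiE_iff extensional_def)
  then have "emeasure (distr (\<Pi>\<^sub>M i\<in>UNIV. lborel) borel (\<lambda>f. \<chi> i. f i)) (box l u)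
      = (\<Prod>i\<in>UNIV. emeasure lborel {l $ i <..< u $ i})"
    by (simp add: emeasure_distr emeasure_PiM)
  also have "\<dots> = ennreal (\<Prod>i\<in>UNIV. (u - l) $ i)"
    using le' by (simp add: prod_ennreal)
  also have "\<dots> = ennreal (\<Prod>b\<in>Basis. (u - l) \<bullet> b)"
    by (simp add: prod_Basis_vec[of "\<lambda>t. t"])
  finally show "emeasure (distr (\<Pi>\<^sub>M i\<in>UNIV. lborel) borel (\<lambda>f. \<chi> i. f i)) (box l u)
    = ennreal (\<Prod>b\<in>Basis. (u - l) \<bullet> b)" .
qed simp

text \<open>With all coordinates but \<open>m\<close> frozen, the shear is a translation of
  coordinate \<open>m\<close> by \<open>c * x $ n\<close>, which is constant because
  \<open>m \<noteq> n\<close>.\<close>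

lemma nn_integral_shear:
  fixes f :: "real^'n \<Rightarrow> ennreal"
  assumes [measurable]: "f \<in> borel_measurable borel" and mn: "m \<noteq> n"
  shows "(\<integral>\<^sup>+ x. f (\<chi> i. if i = m then x $ m + c * x $ n else x $ i) \<partial>lborel) = (\<integral>\<^sup>+ x. f x \<partial>lborel)"
proof -
  interpret product_sigma_finite "\<lambda>_::'n. lborel :: real measure" ..
  let ?P = "\<lambda>I. \<Pi>\<^sub>M i\<in>I. (lborel :: real measure)"
  have split: "(\<integral>\<^sup>+ x. g x \<partial>lborel)
      = (\<integral>\<^sup>+ h. \<integral>\<^sup>+ y. g (\<chi> i. (h(m := y)) i) \<partial>lborel \<partial>?P (UNIV - {m}))"
    if [measurable]: "g \<in> borel_measurable borel" for g :: "real^'n \<Rightarrow> ennreal"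
  proof -
    have "(\<integral>\<^sup>+ x. g x \<partial>lborel) = (\<integral>\<^sup>+ h. g (\<chi> i. h i) \<partial>?P (insert m (UNIV - {m})))"
      by (subst lborel_vec_eq) (simp add: nn_integral_distr insert_absorb)
    also have "\<dots> = (\<integral>\<^sup>+ h. \<integral>\<^sup>+ y. g (\<chi> i. (h(m := y)) i) \<partial>lborel \<partial>?P (UNIV - {m}))"
      by (rule product_nn_integral_insert) (auto simp: insert_absorb)
    finally show ?thesis .
  qed
  define T :: "real^'n \<Rightarrow> real^'n" where "T x = (\<chi> i. if i = m then x $ m + c * x $ n else x $ i)" for x
  have T [measurable]: "T \<in> borel_measurable borel"
    unfolding T_def by measurable
  have shift: "(\<integral>\<^sup>+ y. f (T (\<chi> i. (h(m := y)) i)) \<partial>lborel)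
      = (\<integral>\<^sup>+ y. f (\<chi> i. (h(m := y)) i) \<partial>lborel)" for h
  proof -
    have [measurable]: "(\<lambda>y. f (\<chi> i. (h(m := y)) i)) \<in> borel_measurable borel"
      by (rule measurable_compose[of _ _ borel]) (auto intro!: borel_measurable_vec_lambda)
    have "(\<integral>\<^sup>+ y. f (\<chi> i. (h(m := y)) i) \<partial>lborel)
        = (\<integral>\<^sup>+ y. f (\<chi> i. (h(m := c * h n + 1 * y)) i) \<partial>lborel)"
      by (subst nn_integral_real_affine[where c = 1 and t = "c * h n"]) auto
    also have "\<dots> = (\<integral>\<^sup>+ y. f (T (\<chi> i. (h(m := y)) i)) \<partial>lborel)"
      using mn by (intro nn_integral_cong arg_cong[where f = f]) (auto simp: T_def vec_eq_iff)
    finally show ?thesis ..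
  qed
  have "(\<integral>\<^sup>+ x. f (T x) \<partial>lborel)
      = (\<integral>\<^sup>+ h. \<integral>\<^sup>+ y. f (T (\<chi> i. (h(m := y)) i)) \<partial>lborel \<partial>?P (UNIV - {m}))"
    by (rule split) measurable
  also have "\<dots> = (\<integral>\<^sup>+ x. f x \<partial>lborel)"
    unfolding shift by (rule split[symmetric]) measurable
  finally show ?thesis
    unfolding T_def .
qed

text \<open>Preimages of boxes are boxes with two sides exchanged, and the product of side lengths
  does not see the exchange.\<close>

lemma lborel_distr_swap:
  "distr lborel borel (\<lambda>x::real^'n. \<chi> i. x $ Transposition.transpose m n i) = lborel"
proof (rule lborel_eqI[symmetric])
  let ?h = "\<lambda>x::real^'n. \<chi> i. x $ Transposition.transpose m n i"
  fix l u :: "real^'n" assume le: "\<And>b. b \<in> Basis \<Longrightarrow> l \<bullet> b \<le> u \<bullet> b"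
  have le': "l $ i \<le> u $ i" for i
    using le[of "axis i 1"] by (simp add: inner_axis)
  have "?h -` box l u = box (?h l) (?h u)"
    by (auto simp: mem_box_cart) (metis transpose_involutory)+
  then have "emeasure (distr lborel borel ?h) (box l u) = emeasure lborel (box (?h l) (?h u))"
    by (simp add: emeasure_distr)
  also have "\<dots> = ennreal (\<Prod>b\<in>Basis. (?h u - ?h l) \<bullet> b)"
    using le' by (subst emeasure_lborel_box_eq) (auto simp: Basis_vec_def inner_axis)
  also have "(\<Prod>b\<in>Basis. (?h u - ?h l) \<bullet> b) = (\<Prod>i\<in>UNIV. (u - l) $ Transposition.transpose m n i)"
    by (simp add: prod_Basis_vec[of "\<lambda>t. t"])
  also have "\<dots> = (\<Prod>i\<in>UNIV. (u - l) $ i)"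
    using prod.permute[OF permutes_swap_id, where S = UNIV and g = "\<lambda>i. (u - l) $ i"]
    by (simp add: o_def)
  also have "\<dots> = (\<Prod>b\<in>Basis. (u - l) \<bullet> b)"
    by (simp add: prod_Basis_vec[of "\<lambda>t. t"])
  finally show "emeasure (distr lborel borel ?h) (box l u) = ennreal (\<Prod>b\<in>Basis. (u - l) \<bullet> b)" .
qed simp

text \<open>Induction over elementary matrices: products follow from multiplicativity of the
  determinant, diagonal matrices from coordinatewise scaling, swaps and shears from invariance of
  Lebesgue measure.\<close>

lemma nn_integral_linear_change:
  fixes T :: "real^'n^'n" and f :: "real^'n \<Rightarrow> ennreal"
  assumes "det T \<noteq> 0" and "f \<in> borel_measurable borel"
  shows "(\<integral>\<^sup>+ x. f x \<partial>lborel) = ennreal \<bar>det T\<bar> * (\<integral>\<^sup>+ x. f (T *v x) \<partial>lborel)"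
proof -
  \<comment> \<open>Keeping the premise inside \<open>P\<close> makes it vacuous for singular
    matrices: the case of a zero row becomes trivial, and in the product case both factors inherit
    nonsingularity.\<close>
  define P where "P T \<longleftrightarrow> (det T \<noteq> 0 \<longrightarrow> (\<forall>f \<in> borel_measurable borel.
    (\<integral>\<^sup>+ x. f x \<partial>lborel) = ennreal \<bar>det T\<bar> * (\<integral>\<^sup>+ x. f (T *v x) \<partial>lborel)))" for T :: "real^'n^'n"
  have "P T"
  proof (rule induct_matrix_elementary)
    fix A B :: "real^'n^'n" assume AB: "P A" "P B"
    show "P (A ** B)"
      unfolding P_def
    proof (intro impI ballI)
      fix f :: "real^'n \<Rightarrow> ennreal"
      assume det: "det (A ** B) \<noteq> 0" and [measurable]: "f \<in> borel_measurable borel"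
      then have ne: "det A \<noteq> 0" "det B \<noteq> 0"
        by (auto simp: det_mul)
      have "(\<integral>\<^sup>+ x. f x \<partial>lborel) = ennreal \<bar>det A\<bar> * (\<integral>\<^sup>+ x. f (A *v x) \<partial>lborel)"
        by (rule AB(1)[unfolded P_def, rule_format, OF ne(1)]) measurable
      also have "(\<integral>\<^sup>+ x. f (A *v x) \<partial>lborel) = ennreal \<bar>det B\<bar> * (\<integral>\<^sup>+ x. f (A *v (B *v x)) \<partial>lborel)"
        by (rule AB(2)[unfolded P_def, rule_format, OF ne(2)]) measurable
      finally show "(\<integral>\<^sup>+ x. f x \<partial>lborel)
          = ennreal \<bar>det (A ** B)\<bar> * (\<integral>\<^sup>+ x. f ((A ** B) *v x) \<partial>lborel)"
        by (simp add: det_mul abs_mult ennreal_mult mult.assoc matrix_vector_mul_assoc)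
    qed
  next
    fix A :: "real^'n^'n" and i assume "row i A = 0"
    then show "P A"
      by (simp add: P_def det_zero_row)
  next
    fix A :: "real^'n^'n" assume A: "\<And>i j. i \<noteq> j \<Longrightarrow> A $ i $ j = 0"
    show "P A"
      unfolding P_def
    proof (intro impI ballI)
      fix f :: "real^'n \<Rightarrow> ennreal"
      assume det: "det A \<noteq> 0" and [measurable]: "f \<in> borel_measurable borel"
      \<comment> \<open>The affine substitution rule wants one factor per basis vector;
        \<open>c\<close> returns the i-th diagonal entry at \<open>axis i 1\<close>.\<close>
      define c :: "real^'n \<Rightarrow> real" where "c j = (\<Sum>i\<in>UNIV. A $ i $ i * j $ i)" for j
      have c: "c (axis i 1) = A $ i $ i" for i
        by (simp add: c_def axis_def if_distrib cong: if_cong)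
      have detA: "det A = (\<Prod>i\<in>UNIV. A $ i $ i)"
        using A by (rule det_diagonal)
      have B: "(Basis :: (real^'n) set) = (\<lambda>i. axis i 1) ` UNIV" "inj (\<lambda>i. axis i 1 :: real^'n)"
        by (auto simp: Basis_vec_def inj_on_def axis_eq_axis)
      have prod: "(\<Prod>j\<in>Basis. \<bar>c j\<bar>) = \<bar>det A\<bar>"
        by (simp add: B prod.reindex c detA abs_prod)
      have ne: "c j \<noteq> 0" if "j \<in> Basis" for j
        using that det c unfolding detA by (auto simp: B)
      have "A *v x = 0 + (\<Sum>j\<in>Basis. (c j * (x \<bullet> j)) *\<^sub>R j)" for x
      proof -
        have "(A *v x) $ i = A $ i $ i * x $ i" for i
          unfolding matrix_vector_mult_def using A
          by (simp add: sum.remove[of UNIV i] sum.neutral)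
        moreover have "(\<Sum>j\<in>Basis. (c j * (x \<bullet> j)) *\<^sub>R j)
            = (\<Sum>k\<in>UNIV. (A $ k $ k * x $ k) *\<^sub>R axis k 1)"
          unfolding B(1) by (simp add: B(2) sum.reindex c inner_axis)
        ultimately show ?thesis
          by (simp add: vec_eq_iff axis_def if_distrib cong: if_cong)
      qed
      then have Av: "(*v) A = (\<lambda>x. \<Sum>j\<in>Basis. (c j * (x \<bullet> j)) *\<^sub>R j)"
        by auto
      have "lborel = density (distr lborel borel ((*v) A)) (\<lambda>_. ennreal \<bar>det A\<bar>)"
        unfolding Av using lborel_affine_euclidean[of c 0] ne by (simp add: prod)
      then have "(\<integral>\<^sup>+ x. f x \<partial>lborel)
          = (\<integral>\<^sup>+ x. f x \<partial>density (distr lborel borel ((*v) A)) (\<lambda>_. ennreal \<bar>det A\<bar>))"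
        by simp
      also have "\<dots> = ennreal \<bar>det A\<bar> * (\<integral>\<^sup>+ x. f (A *v x) \<partial>lborel)"
        by (simp add: nn_integral_density nn_integral_distr nn_integral_cmult)
      finally show "(\<integral>\<^sup>+ x. f x \<partial>lborel) = ennreal \<bar>det A\<bar> * (\<integral>\<^sup>+ x. f (A *v x) \<partial>lborel)" .
    qed
  next
    fix m n :: 'n assume "m \<noteq> n"
    let ?S = "(\<chi> i j. mat 1 $ i $ Transposition.transpose m n j) :: real^'n^'n"
    have det: "\<bar>det ?S\<bar> = 1"
      by (simp add: det_permute_columns permutes_swap_id sign_swap_id abs_mult)
    have S: "?S *v x = (\<chi> i. x $ Transposition.transpose m n i)" for x :: "real^'n"
    proof -
      have "mat 1 $ i $ Transposition.transpose m n j = (if j = Transposition.transpose m n i then 1 else (0::real))"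
        for i j
        by (auto simp: mat_def)
      then show ?thesis
        by (simp add: matrix_vector_mult_def vec_eq_iff if_distrib[of "\<lambda>a. a * _"] cong: if_cong)
    qed
    have swap: "(\<integral>\<^sup>+ x. f x \<partial>lborel) = (\<integral>\<^sup>+ x. f (?S *v x) \<partial>lborel)"
      if [measurable]: "f \<in> borel_measurable borel" for f :: "real^'n \<Rightarrow> ennreal"
    proof -
      have "(\<integral>\<^sup>+ x. f x \<partial>lborel)
          = (\<integral>\<^sup>+ x. f x \<partial>distr lborel borel (\<lambda>x. \<chi> i. x $ Transposition.transpose m n i))"
        by (simp only: lborel_distr_swap)
      also have "\<dots> = (\<integral>\<^sup>+ x. f (?S *v x) \<partial>lborel)"
        unfolding S by (rule nn_integral_distr) auto
      finally show ?thesis .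
    qed
    show "P ?S"
      unfolding P_def det ennreal_1 mult_1 by (intro impI ballI swap)
  next
    fix m n :: 'n and c :: real assume mn: "m \<noteq> n"
    let ?S = "(\<chi> i j. if i = m \<and> j = n then c else of_bool (i = j)) :: real^'n^'n"
    have "?S = (\<chi> k. if k = m then row m (mat 1) + c *s row n (mat 1) else row k (mat 1))"
      using mn by (auto simp: vec_eq_iff row_def mat_def)
    then have det: "det ?S = 1"
      using det_row_operation[OF mn, of "mat 1 :: real^'n^'n" c] by simp
    have S: "?S *v x = (\<chi> i. if i = m then x $ m + c * x $ n else x $ i)" for x :: "real^'n"
    proof -
      have "(\<Sum>j\<in>UNIV. (if i = m \<and> j = n then c else of_bool (i = j)) * x $ j)
          = (\<Sum>j\<in>UNIV. (if j = i then x $ j else 0) + (if j = n then (if i = m then c * x $ j else 0) else 0))"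
        for i
        using mn by (intro sum.cong) auto
      then show ?thesis
        by (simp add: matrix_vector_mult_def vec_eq_iff sum.distrib)
    qed
    show "P ?S"
      unfolding P_def det S by (auto simp: nn_integral_shear mn)
  qed
  then show ?thesis
    using assms unfolding P_def by blast
qed

lemma nn_integral_translation:
  fixes f :: "'a::euclidean_space \<Rightarrow> ennreal"
  assumes "f \<in> borel_measurable borel"
  shows "(\<integral>\<^sup>+ x. f (x + c) \<partial>lborel) = (\<integral>\<^sup>+ x. f x \<partial>lborel)"
proof -
  have "(\<integral>\<^sup>+ x. f x \<partial>lborel) = (\<integral>\<^sup>+ x. f x \<partial>distr lborel borel ((+) c))"
    by (simp add: lborel_distr_plus)
  also have "\<dots> = (\<integral>\<^sup>+ x. f (c + x) \<partial>lborel)"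
    using assms by (intro nn_integral_distr) auto
  finally show ?thesis
    by (simp add: add.commute)
qed

lemma nn_integral_std_gaussian:
  "(\<integral>\<^sup>+ (x::real^'n). ennreal (exp (- (x \<bullet> x) / 2)) \<partial>lborel) = ennreal (sqrt (2 * pi) ^ CARD('n))"
proof -
  interpret S: prob_space "density lborel (\<lambda>x. ennreal (std_normal_density x))"
    by (rule prob_space_normal_density) simp
  have "1 = (\<integral>\<^sup>+ t. ennreal (std_normal_density t) \<partial>lborel)"
    using S.emeasure_space_1 by (simp add: emeasure_density)
  then have "ennreal (sqrt (2 * pi))
      = (\<integral>\<^sup>+ t. ennreal (sqrt (2 * pi)) * ennreal (std_normal_density t) \<partial>lborel)"
    by (simp add: nn_integral_cmult)
  also have "\<dots> = (\<integral>\<^sup>+ t. ennreal (exp (- t\<^sup>2 / 2)) \<partial>lborel)"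
    by (intro nn_integral_cong) (simp add: std_normal_density_def flip: ennreal_mult)
  finally have 1: "(\<integral>\<^sup>+ t. ennreal (exp (- t\<^sup>2 / 2)) \<partial>lborel) = ennreal (sqrt (2 * pi))" ..
  have "ennreal (exp (- (x \<bullet> x) / 2)) = (\<Prod>b\<in>Basis. ennreal (exp (- (x \<bullet> b)\<^sup>2 / 2)))" for x :: "real^'n"
  proof -
    have "- (x \<bullet> x) / 2 = (\<Sum>b\<in>Basis. - (x \<bullet> b)\<^sup>2 / 2)"
      by (subst euclidean_inner) (simp add: sum_negf sum_divide_distrib power2_eq_square)
    then show ?thesis
      by (simp add: exp_sum prod_ennreal)
  qed
  then have "(\<integral>\<^sup>+ (x::real^'n). ennreal (exp (- (x \<bullet> x) / 2)) \<partial>lborel)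
      = (\<integral>\<^sup>+ (x::real^'n). (\<Prod>b\<in>Basis. ennreal (exp (- (x \<bullet> b)\<^sup>2 / 2))) \<partial>lborel)"
    by simp
  also have "\<dots> = (\<Prod>b\<in>(Basis :: (real^'n) set). \<integral>\<^sup>+ t. ennreal (exp (- t\<^sup>2 / 2)) \<partial>lborel)"
    by (rule nn_integral_lborel_prod) auto
  finally show ?thesis
    unfolding 1 by (simp add: ennreal_power)
qed

section \<open>Gaussian densities: normalisation and second moments\<close>

lemma det_pos_def:
  assumes "pos_def S"
  shows "0 < det S" and "\<bar>det (msqrt S)\<bar> = sqrt (det S)" and "det (msqrt S) \<noteq> 0"
proof -
  have sq: "det S = det (msqrt S) * det (msqrt S)"
    by (metis assms det_mul msqrt_square pos_def_imp_semidef)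
  then show "\<bar>det (msqrt S)\<bar> = sqrt (det S)"
    by simp
  show "det (msqrt S) \<noteq> 0"
    using pos_def_invertible[OF pos_def_msqrt[OF assms]] by (simp add: invertible_det_nz)
  then show "0 < det S"
    unfolding sq by (metis not_real_square_gt_zero)
qed

text \<open>The substitution x = R y with R = \<open>msqrt S\<close> turns the exponent into - y
  \<bullet> y / 2 and contributes |det R|, the square root of det S.\<close>

lemma nn_integral_exp_quadratic:
  fixes S :: "real^'n^'n"
  assumes "pos_def S"
  shows "(\<integral>\<^sup>+ x. ennreal (exp (- (x \<bullet> (matrix_inv S *v x)) / 2)) \<partial>lborel)
    = ennreal (sqrt ((2 * pi) ^ CARD('n) * det S))"
proof -
  let ?R = "msqrt S"
  have R: "invertible ?R" "transpose ?R = ?R" "?R ** ?R = S"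
    using assms pos_def_msqrt pos_def_invertible pos_def_sym msqrt_square pos_def_imp_semidef by blast+
  have "matrix_inv S = matrix_inv ?R ** matrix_inv ?R"
    by (rule matrix_inv_unique) (metis R(1,3) matrix_inv_right matrix_mul_assoc matrix_mul_rid)
  then have "matrix_inv S *v (?R *v x) = matrix_inv ?R *v x" for x
    using R(1) by (simp flip: matrix_vector_mul_assoc)
  then have quad: "(?R *v x) \<bullet> (matrix_inv S *v (?R *v x)) = x \<bullet> x" for x
    using R(1,2) by (simp add: dot_matrix_left)
  have "(\<integral>\<^sup>+ x. ennreal (exp (- (x \<bullet> (matrix_inv S *v x)) / 2)) \<partial>lborel)
      = ennreal \<bar>det ?R\<bar> * (\<integral>\<^sup>+ (x::real^'n). ennreal (exp (- (x \<bullet> x) / 2)) \<partial>lborel)"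
    using det_pos_def(3)[OF assms] by (subst nn_integral_linear_change[of ?R]) (auto simp: quad)
  also have "\<dots> = ennreal (sqrt ((2 * pi) ^ CARD('n) * det S))"
    using det_pos_def[OF assms] unfolding nn_integral_std_gaussian
    by (simp add: real_sqrt_mult real_sqrt_power power_mult_distrib mult.commute flip: ennreal_mult)
  finally show ?thesis .
qed

lemma borel_measurable_gaussian_density [measurable]: "gaussian_density \<mu> S \<in> borel_measurable borel"
  unfolding gaussian_density_def by measurable

lemma gaussian_density_pos: "pos_def S \<Longrightarrow> 0 < gaussian_density \<mu> S x"
  by (simp add: gaussian_density_def det_pos_def(1))

lemma gaussian_density_nonneg [simp]: "pos_def S \<Longrightarrow> 0 \<le> gaussian_density \<mu> S x"
  by (intro less_imp_le gaussian_density_pos)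

lemma gaussian_density_translate: "gaussian_density \<mu> S x = gaussian_density 0 S (x - \<mu>)"
  by (simp add: gaussian_density_def)

lemma nn_integral_gaussian_density:
  fixes S :: "real^'n^'n"
  assumes "pos_def S"
  shows "(\<integral>\<^sup>+ x. ennreal (gaussian_density \<mu> S x) \<partial>lborel) = 1"
proof -
  let ?D = "sqrt ((2 * pi) ^ CARD('n) * det S)"
  have D: "0 < ?D"
    using det_pos_def(1)[OF assms] by simp
  have "(\<integral>\<^sup>+ x. ennreal (gaussian_density \<mu> S x) \<partial>lborel)
      = (\<integral>\<^sup>+ x. ennreal (gaussian_density 0 S (x + - \<mu>)) \<partial>lborel)"
    by (simp add: gaussian_density_translate[of \<mu>])
  also have "\<dots> = (\<integral>\<^sup>+ x. ennreal (gaussian_density 0 S x) \<partial>lborel)"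
    by (rule nn_integral_translation) simp
  also have "\<dots> = (\<integral>\<^sup>+ x. ennreal (exp (- (x \<bullet> (matrix_inv S *v x)) / 2)) * ennreal (1 / ?D) \<partial>lborel)"
    using D by (intro nn_integral_cong) (simp add: gaussian_density_def flip: ennreal_mult)
  also have "\<dots> = ennreal ?D * ennreal (1 / ?D)"
    unfolding nn_integral_exp_quadratic[OF assms, symmetric] by (rule nn_integral_multc) measurable
  also have "\<dots> = 1"
    using det_pos_def(1)[OF assms] by (simp flip: ennreal_mult)
  finally show ?thesis .
qed

text \<open>Half of the exponent pays for the factor |x|^2: coercivity and t <= exp t at t = q/4, q
  the quadratic form, leave exp (-q/4), an unnormalised Gaussian with covariance 2 S.\<close>

lemma gaussian_second_moment_finite:
  fixes S :: "real^'n^'n"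
  assumes "pos_def S"
  shows "(\<integral>\<^sup>+ x. ennreal (gaussian_density 0 S x * (norm x)\<^sup>2) \<partial>lborel) < \<infinity>"
proof -
  let ?D = "sqrt ((2 * pi) ^ CARD('n) * det S)"
  let ?q = "\<lambda>x. x \<bullet> (matrix_inv S *v x)"
  have D: "0 < ?D"
    using det_pos_def(1)[OF assms] by simp
  obtain c where c: "0 < c" "\<And>x. c * (norm x)\<^sup>2 \<le> ?q x"
    using pos_def_coercive[OF pos_def_matrix_inv[OF assms]] by blast
  have S2: "pos_def (2 *\<^sub>R S)" "matrix_inv (2 *\<^sub>R S) = (1/2) *\<^sub>R matrix_inv S"
    using assms by (auto simp: pos_def_scaleR matrix_inv_scaleR pos_def_invertible)
  have le: "gaussian_density 0 S x * (norm x)\<^sup>2 \<le> 4 / (c * ?D) * exp (- (x \<bullet> (matrix_inv (2 *\<^sub>R S) *v x)) / 2)"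
    for x
  proof -
    have "(norm x)\<^sup>2 \<le> 4 / c * (?q x / 4)"
      using c by (simp add: field_simps)
    also have "\<dots> \<le> 4 / c * exp (?q x / 4)"
    proof (rule mult_left_mono)
      show "?q x / 4 \<le> exp (?q x / 4)"
        using exp_ge_add_one_self[of "?q x / 4"] by linarith
    qed (use c in simp)
    finally have "exp (- ?q x / 2) * (norm x)\<^sup>2 \<le> exp (- ?q x / 2) * (4 / c * exp (?q x / 4))"
      by (intro mult_left_mono) auto
    also have "\<dots> = 4 / c * exp (- ?q x / 4)"
      by (simp add: mult.left_commute mult_exp_exp)
    finally have "exp (- ?q x / 2) * (norm x)\<^sup>2 / ?D \<le> 4 / c * exp (- ?q x / 4) / ?D"
      using D by (intro divide_right_mono) auto
    moreover have "gaussian_density 0 S x * (norm x)\<^sup>2 = exp (- ?q x / 2) * (norm x)\<^sup>2 / ?D"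
      by (simp add: gaussian_density_def)
    ultimately show ?thesis
      by (simp add: S2 mult.commute flip: scaleR_matrix_vector_assoc)
  qed
  have "(\<integral>\<^sup>+ x. ennreal (gaussian_density 0 S x * (norm x)\<^sup>2) \<partial>lborel)
      \<le> (\<integral>\<^sup>+ x. ennreal (4 / (c * ?D)) * ennreal (exp (- (x \<bullet> (matrix_inv (2 *\<^sub>R S) *v x)) / 2)) \<partial>lborel)"
    using le D c(1) by (intro nn_integral_mono) (simp flip: ennreal_mult)
  also have "\<dots> < \<infinity>"
    using nn_integral_exp_quadratic[OF S2(1)] by (simp add: nn_integral_cmult ennreal_mult_less_top)
  finally show ?thesis .
qed

section \<open>Propagation of a Gaussian law through one closed-loop step\<close>

text \<open>\<open>q\<close> is the joint exponent of a state x with covariance \<open>S\<close> and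
  an input u = - K x + w, w with covariance \<open>V\<close>; the next state is y = F x + B w. At
  fixed y the form is its minimum plus the same form at the deviation from the minimiser. The
  remainder depends on y only through \<open>u - L *v y\<close>, so integrating out u gives a
  constant.\<close>

lemma gaussian_completion:
  fixes F :: "real^'n^'n" and B :: "real^'m^'n"
  assumes S: "pos_def S" and V: "pos_def V" and inv: "invertible (A :: real^'n^'n)"
    and F: "F = A - B ** K"
  defines "S' \<equiv> F ** S ** transpose F + B ** V ** transpose B"
  defines "q \<equiv> \<lambda>x u. x \<bullet> (matrix_inv S *v x) + (u + K *v x) \<bullet> (matrix_inv V *v (u + K *v x))"
  shows "pos_def S'"
    and "\<exists>L. \<forall>y u. q (matrix_inv A *v (y - B *v u)) u
      = y \<bullet> (matrix_inv S' *v y) + q (matrix_inv A *v (- (B *v (u - L *v y)))) (u - L *v y)"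
proof -
  have iS: "invertible S" and iV: "invertible V"
    using S V by (auto intro: pos_def_invertible)
  show pd: "pos_def S'"
    unfolding pos_def_def
  proof (intro conjI allI impI)
    show "transpose S' = S'"
      using S V by (simp add: S'_def transpose_distribs pos_def_sym matrix_mul_assoc)
    fix x :: "real^'n" assume x: "x \<noteq> 0"
    have eq: "x \<bullet> (S' *v x) = (transpose F *v x) \<bullet> (S *v (transpose F *v x))
        + (transpose B *v x) \<bullet> (V *v (transpose B *v x))"
      by (simp add: S'_def matrix_vector_mult_add_rdistrib inner_add_right dot_matrix_left
          flip: matrix_vector_mul_assoc)
    \<comment> \<open>\<open>F\<close> may be singular. Where the transpose of \<open>B\<close>
      vanishes, the transpose of \<open>F\<close> agrees with that of the invertible
      \<open>A\<close>; elsewhere the noise term is positive.\<close>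
    show "0 < x \<bullet> (S' *v x)"
    proof (cases "transpose B *v x = 0")
      case True
      then have "transpose F *v x = transpose A *v x"
        by (simp add: F transpose_distribs matrix_vector_mult_diff_rdistrib
            flip: matrix_vector_mul_assoc)
      moreover have "transpose A *v x \<noteq> 0"
        using inv x transpose_invertible invertible_iff_ker by blast
      ultimately show ?thesis
        using S True by (simp add: eq pos_def_pos)
    next
      case False
      then show ?thesis
        using S V by (simp add: eq add_nonneg_pos pos_def_nonneg pos_def_pos)
    qed
  qed
  have iS': "invertible S'"
    using pd by (rule pos_def_invertible)
  \<comment> \<open>\<open>(X y, Y y)\<close> is the minimiser of the form \<open>x \<bullet> S\<inverse> x + w \<bullet> V\<inverse> w\<close> under \<open>F x + B w = y\<close>.\<close>
  define X where "X = S ** transpose F ** matrix_inv S'"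
  define Y where "Y = V ** transpose B ** matrix_inv S'"
  define L where "L = Y - K ** X"
  have FXBY: "F *v (X *v y) + B *v (Y *v y) = y" for y
  proof -
    have "F *v (X *v y) + B *v (Y *v y) = S' *v (matrix_inv S' *v y)"
      by (simp add: X_def Y_def S'_def matrix_vector_mul_assoc matrix_distribs matrix_mul_assoc
          flip: matrix_vector_mult_add_rdistrib)
    then show ?thesis
      using iS' by simp
  qed
  \<comment> \<open>Stationarity of the minimiser with Lagrange multiplier
    \<open>matrix_inv S' *v y\<close>: mixed terms depend on the pair (a, b) only through its
    constraint value.\<close>
  have cross: "(X *v y) \<bullet> (matrix_inv S *v a) + (Y *v y) \<bullet> (matrix_inv V *v b)
      = (matrix_inv S' *v y) \<bullet> (F *v a + B *v b)" for y a b
  proof -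
    define w where "w = matrix_inv S' *v y"
    have "X *v y = S *v (transpose F *v w)" "Y *v y = V *v (transpose B *v w)"
      by (simp_all add: X_def Y_def w_def matrix_vector_mul_assoc matrix_mul_assoc)
    moreover have "(S *v z) \<bullet> (matrix_inv S *v a) = z \<bullet> a" for z
      using iS by (simp add: dot_matrix_left pos_def_sym[OF S])
    moreover have "(V *v z) \<bullet> (matrix_inv V *v b) = z \<bullet> b" for z
      using iV by (simp add: dot_matrix_left pos_def_sym[OF V])
    ultimately show ?thesis
      by (simp add: dot_matrix_left inner_add_right flip: w_def)
  qed
  have main: "x \<bullet> (matrix_inv S *v x) + w \<bullet> (matrix_inv V *v w) = y \<bullet> (matrix_inv S' *v y)
      + (x - X *v y) \<bullet> (matrix_inv S *v (x - X *v y)) + (w - Y *v y) \<bullet> (matrix_inv V *v (w - Y *v y))"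
    if y: "y = F *v x + B *v w" for x w y
  proof -
    have sym: "a \<bullet> (matrix_inv S *v b) = b \<bullet> (matrix_inv S *v a)" for a b
      using pos_def_sym[OF pos_def_matrix_inv[OF S]] by (metis dot_matrix_right inner_commute)
    have symV: "a \<bullet> (matrix_inv V *v b) = b \<bullet> (matrix_inv V *v a)" for a b
      using pos_def_sym[OF pos_def_matrix_inv[OF V]] by (metis dot_matrix_right inner_commute)
    have 1: "(X *v y) \<bullet> (matrix_inv S *v x) + (Y *v y) \<bullet> (matrix_inv V *v w) = y \<bullet> (matrix_inv S' *v y)"
      using cross[of y x w] y by (simp add: inner_commute)
    have 2: "(X *v y) \<bullet> (matrix_inv S *v (X *v y)) + (Y *v y) \<bullet> (matrix_inv V *v (Y *v y))
        = y \<bullet> (matrix_inv S' *v y)"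
      using cross[of y "X *v y" "Y *v y"] FXBY[of y] by (simp add: inner_commute)
    show ?thesis
      using 1 2 by (simp add: matrix_vector_mult_diff_distrib inner_diff_left inner_diff_right
          sym[of x "X *v y"] symV[of w "Y *v y"])
  qed
  have "q (matrix_inv A *v (y - B *v u)) u
      = y \<bullet> (matrix_inv S' *v y) + q (matrix_inv A *v (- (B *v (u - L *v y)))) (u - L *v y)" for y u
  proof -
    define x where "x = matrix_inv A *v (y - B *v u)"
    define w where "w = u + K *v x"
    have Ax: "A *v x = y - B *v u"
      using inv by (simp add: x_def)
    then have "y = F *v x + B *v w"
      by (simp add: w_def F matrix_vector_mult_diff_rdistrib matrix_vector_right_distrib
          flip: matrix_vector_mul_assoc)
    note eq = main[OF this]
    have "A *v (X *v y) = y - B *v (L *v y)"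
      using FXBY[of y] by (simp add: F L_def matrix_vector_mult_diff_rdistrib matrix_vector_mult_diff_distrib
          algebra_simps flip: matrix_vector_mul_assoc)
    then have "A *v (x - X *v y) = - (B *v (u - L *v y))"
      by (simp add: Ax matrix_vector_mult_diff_distrib)
    then have 1: "x - X *v y = matrix_inv A *v (- (B *v (u - L *v y)))"
      using inv by (metis matrix_inv_vec(2))
    have 2: "w - Y *v y = (u - L *v y) + K *v (x - X *v y)"
      by (simp add: w_def L_def matrix_vector_mult_diff_rdistrib matrix_vector_mult_diff_distrib
          flip: matrix_vector_mul_assoc)
    show ?thesis
      using eq unfolding q_def 1[symmetric] 2 by (simp add: w_def x_def)
  qed
  then show "\<exists>L. \<forall>y u. q (matrix_inv A *v (y - B *v u)) u
      = y \<bullet> (matrix_inv S' *v y) + q (matrix_inv A *v (- (B *v (u - L *v y)))) (u - L *v y)"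
    by blast
qed

text \<open>For fixed u the state x is exchanged for y = A x + B u; this needs \<open>A\<close>
  invertible, not \<open>B\<close>. After completion of the square the integral over u is a
  translate of one that is free of y.\<close>

lemma nn_integral_gaussian_propagate:
  fixes A F S :: "real^'n^'n" and B :: "real^'m^'n"
  assumes S: "pos_def S" and V: "pos_def V" and inv: "invertible A" and F: "F = A - B ** K"
  defines "S' \<equiv> F ** S ** transpose F + B ** V ** transpose B"
  assumes f: "f \<in> borel_measurable borel"
  shows "(\<integral>\<^sup>+ x. ennreal (gaussian_density 0 S x) *
      (\<integral>\<^sup>+ u. ennreal (gaussian_density (- (K *v x)) V u) * f (A *v x + B *v u) \<partial>lborel) \<partial>lborel)
    = (\<integral>\<^sup>+ y. ennreal (gaussian_density 0 S' y) * f y \<partial>lborel)"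
proof -
  let ?D = "sqrt ((2 * pi) ^ CARD('n) * det S) * sqrt ((2 * pi) ^ CARD('m) * det V)"
  let ?D' = "sqrt ((2 * pi) ^ CARD('n) * det S')"
  define q where "q x u = x \<bullet> (matrix_inv S *v x) + (u + K *v x) \<bullet> (matrix_inv V *v (u + K *v x))" for x u
  define Ai where "Ai = matrix_inv A"
  obtain L where S': "pos_def S'" and L: "\<And>y u. q (Ai *v (y - B *v u)) u
      = y \<bullet> (matrix_inv S' *v y) + q (Ai *v (- (B *v (u - L *v y)))) (u - L *v y)"
    using gaussian_completion[OF S V inv F] unfolding S'_def q_def Ai_def by blast
  have det: "det Ai \<noteq> 0"
    unfolding Ai_def using inv by (metis invertible_det_nz invertible_matrix_inv)
  have D: "0 < ?D" "0 < ?D'"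
    using det_pos_def(1)[OF S] det_pos_def(1)[OF V] det_pos_def(1)[OF S'] by simp_all
  have [measurable]: "case_prod q \<in> borel_measurable (borel \<Otimes>\<^sub>M borel)"
    unfolding q_def by measurable
  have dens: "gaussian_density 0 S x * gaussian_density (- (K *v x)) V u = 1 / ?D * exp (- q x u / 2)" for x u
    by (simp add: gaussian_density_def q_def mult_exp_exp field_simps)
  define LHS where "LHS f = (\<integral>\<^sup>+ x. ennreal (gaussian_density 0 S x) *
      (\<integral>\<^sup>+ u. ennreal (gaussian_density (- (K *v x)) V u) * f (A *v x + B *v u) \<partial>lborel) \<partial>lborel)"
    for f :: "real^'n \<Rightarrow> ennreal"
  \<comment> \<open>This constant is never evaluated, which avoids any determinant identity between
    \<open>S\<close>, \<open>V\<close> and \<open>S'\<close>.\<close>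
  define c where "c = ennreal \<bar>det Ai\<bar> * ennreal (1 / ?D)
    * (\<integral>\<^sup>+ u. ennreal (exp (- q (Ai *v (- (B *v u))) u / 2)) \<partial>lborel)"
  have LHS: "LHS f = c * (\<integral>\<^sup>+ y. ennreal (exp (- (y \<bullet> (matrix_inv S' *v y)) / 2)) * f y \<partial>lborel)"
    if [measurable]: "f \<in> borel_measurable borel" for f
  proof -
    let ?h = "\<lambda>x u. ennreal (1 / ?D) * ennreal (exp (- q x u / 2)) * f (A *v x + B *v u)"
    have "LHS f = (\<integral>\<^sup>+ x. \<integral>\<^sup>+ u. ?h x u \<partial>lborel \<partial>lborel)"
      unfolding LHS_def using S V D
      by (subst nn_integral_cmult[symmetric])
        (auto simp: dens mult.assoc[symmetric] intro!: nn_integral_cong simp flip: ennreal_mult)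
    also have "\<dots> = (\<integral>\<^sup>+ u. \<integral>\<^sup>+ x. ?h x u \<partial>lborel \<partial>lborel)"
      by (rule lborel_pair.Fubini'[symmetric]) measurable
    also have "\<dots> = (\<integral>\<^sup>+ u. ennreal \<bar>det Ai\<bar> *
        (\<integral>\<^sup>+ y. ?h (Ai *v (y - B *v u)) u \<partial>lborel) \<partial>lborel)"
    proof (intro nn_integral_cong)
      fix u
      have "(\<integral>\<^sup>+ x. ?h x u \<partial>lborel) = ennreal \<bar>det Ai\<bar> * (\<integral>\<^sup>+ y. ?h (Ai *v y) u \<partial>lborel)"
        by (rule nn_integral_linear_change[OF det]) measurable
      also have "(\<integral>\<^sup>+ y. ?h (Ai *v y) u \<partial>lborel) = (\<integral>\<^sup>+ y. ?h (Ai *v (y + - (B *v u))) u \<partial>lborel)"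
        by (rule nn_integral_translation[symmetric]) measurable
      finally show "(\<integral>\<^sup>+ x. ?h x u \<partial>lborel)
          = ennreal \<bar>det Ai\<bar> * (\<integral>\<^sup>+ y. ?h (Ai *v (y - B *v u)) u \<partial>lborel)"
        by simp
    qed
    also have "\<dots> = (\<integral>\<^sup>+ y. \<integral>\<^sup>+ u. ennreal \<bar>det Ai\<bar> * ?h (Ai *v (y - B *v u)) u \<partial>lborel \<partial>lborel)"
      by (subst lborel_pair.Fubini') (auto simp: nn_integral_cmult)
    also have "\<dots> = (\<integral>\<^sup>+ y. c * (ennreal (exp (- (y \<bullet> (matrix_inv S' *v y)) / 2)) * f y) \<partial>lborel)"
    proof (intro nn_integral_cong)
      fix y
      let ?E = "ennreal (exp (- (y \<bullet> (matrix_inv S' *v y)) / 2))"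
      have "(\<integral>\<^sup>+ u. ennreal \<bar>det Ai\<bar> * ?h (Ai *v (y - B *v u)) u \<partial>lborel)
          = (\<integral>\<^sup>+ u. (ennreal \<bar>det Ai\<bar> * ennreal (1 / ?D) * (?E * f y))
            * ennreal (exp (- q (Ai *v (- (B *v (u + - (L *v y))))) (u + - (L *v y)) / 2)) \<partial>lborel)"
      proof (intro nn_integral_cong)
        fix u
        have "exp (- q (Ai *v (y - B *v u)) u / 2) = exp (- (y \<bullet> (matrix_inv S' *v y)) / 2)
            * exp (- q (Ai *v (- (B *v (u + - (L *v y))))) (u + - (L *v y)) / 2)"
          by (simp add: L[of y u] mult_exp_exp add_divide_distrib diff_divide_distrib)
        then have 1: "ennreal (exp (- q (Ai *v (y - B *v u)) u / 2)) = ?E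
            * ennreal (exp (- q (Ai *v (- (B *v (u + - (L *v y))))) (u + - (L *v y)) / 2))"
          by (simp only: ennreal_mult'[OF exp_ge_zero])
        have 2: "A *v (Ai *v (y - B *v u)) + B *v u = y"
          using inv by (simp add: Ai_def)
        show "ennreal \<bar>det Ai\<bar> * ?h (Ai *v (y - B *v u)) u
          = (ennreal \<bar>det Ai\<bar> * ennreal (1 / ?D) * (?E * f y))
            * ennreal (exp (- q (Ai *v (- (B *v (u + - (L *v y))))) (u + - (L *v y)) / 2))"
          by (simp only: 1 2 mult_ac)
      qed
      also have "\<dots> = (ennreal \<bar>det Ai\<bar> * ennreal (1 / ?D) * (?E * f y))
          * (\<integral>\<^sup>+ u. ennreal (exp (- q (Ai *v (- (B *v (u + - (L *v y))))) (u + - (L *v y)) / 2)) \<partial>lborel)"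
        by (rule nn_integral_cmult) measurable
      also have "(\<integral>\<^sup>+ u. ennreal (exp (- q (Ai *v (- (B *v (u + - (L *v y))))) (u + - (L *v y)) / 2)) \<partial>lborel)
          = (\<integral>\<^sup>+ u. ennreal (exp (- q (Ai *v (- (B *v u))) u / 2)) \<partial>lborel)"
        by (rule nn_integral_translation) measurable
      finally show "(\<integral>\<^sup>+ u. ennreal \<bar>det Ai\<bar> * ?h (Ai *v (y - B *v u)) u \<partial>lborel) = c * (?E * f y)"
        by (simp only: c_def mult_ac)
    qed
    also have "\<dots> = c * (\<integral>\<^sup>+ y. ennreal (exp (- (y \<bullet> (matrix_inv S' *v y)) / 2)) * f y \<partial>lborel)"
      by (rule nn_integral_cmult) measurable
    finally show ?thesis .
  qed
  \<comment> \<open>Testing with the constant 1 determines \<open>c\<close>: both sides are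
    integrals of probability densities.\<close>
  have "LHS (\<lambda>_. 1) = 1"
    using nn_integral_gaussian_density[OF S] nn_integral_gaussian_density[OF V] by (simp add: LHS_def)
  moreover have "LHS (\<lambda>_. 1) = c * ennreal ?D'"
    using LHS[of "\<lambda>_. 1"] unfolding nn_integral_exp_quadratic[OF S', symmetric] by simp
  ultimately have cD: "c * ennreal ?D' = 1"
    by simp
  have c: "c = ennreal (1 / ?D')"
  proof -
    have "c = c * (ennreal ?D' * ennreal (1 / ?D'))"
      using det_pos_def(1)[OF S'] by (simp flip: ennreal_mult)
    also have "\<dots> = c * ennreal ?D' * ennreal (1 / ?D')"
      by (simp only: mult.assoc)
    finally show ?thesis
      unfolding cD by (simp only: mult_1)
  qed
  have "LHS f = (\<integral>\<^sup>+ y. ennreal (1 / ?D') * (ennreal (exp (- (y \<bullet> (matrix_inv S' *v y)) / 2)) * f y) \<partial>lborel)"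
    unfolding LHS[OF f] c using f by (intro nn_integral_cmult[symmetric]) measurable
  also have "\<dots> = (\<integral>\<^sup>+ y. ennreal (gaussian_density 0 S' y) * f y \<partial>lborel)"
    using D(2) by (intro nn_integral_cong)
      (simp add: gaussian_density_def mult.assoc[symmetric] flip: ennreal_mult)
  finally show ?thesis
    unfolding LHS_def .
qed

section \<open>The Lyapunov recursion\<close>

lemma matrix_inv_cancel:
  fixes X :: "real^'n^'n" and Y :: "real^'n^'m"
  assumes "invertible X"
  shows "Y ** X ** matrix_inv X = Y" "Y ** matrix_inv X ** X = Y"
  using assms by (simp_all add: matrix_inv_mult flip: matrix_mul_assoc)

lemmas matrix_inv_simps = matrix_inv_cancel matrix_inv_right matrix_inv_left

section \<open>Inverses under updates by B B^T\<close>

lemma woodbury: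
  fixes Q :: "real^'n^'n" and B :: "real^'m^'n"
  assumes Q: "invertible Q" and M: "invertible M"
    and M_eq: "M = mat 1 + transpose B ** matrix_inv Q ** B"
  shows "matrix_inv (Q + B ** transpose B)
    = matrix_inv Q - matrix_inv Q ** B ** matrix_inv M ** transpose B ** matrix_inv Q"
proof (rule matrix_inv_unique)
  let ?R = "matrix_inv M ** transpose B ** matrix_inv Q"
  have "transpose B ** matrix_inv Q ** B = M - mat 1"
    by (simp add: M_eq)
  then have "B ** (transpose B ** matrix_inv Q ** B) ** ?R = B ** transpose B ** matrix_inv Q - B ** ?R"
    using M by (simp add: matrix_distribs matrix_mul_assoc matrix_inv_simps)
  then show "(Q + B ** transpose B) **
      (matrix_inv Q - matrix_inv Q ** B ** matrix_inv M ** transpose B ** matrix_inv Q) = mat 1"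
    using Q by (simp add: matrix_distribs matrix_mul_assoc matrix_inv_simps)
qed

text \<open>With P' = P - C C^T this is the resolvent identity P^-1 (P - P') P'^-1 = P'^-1 - P^-1,
  framed by C^T and C.\<close>

lemma woodbury_dual:
  fixes P :: "real^'n^'n" and C :: "real^'m^'n"
  assumes P: "invertible P" and P': "invertible (P - C ** transpose C)"
  shows "(mat 1 - transpose C ** matrix_inv P ** C)
    ** (mat 1 + transpose C ** matrix_inv (P - C ** transpose C) ** C) = mat 1"
proof -
  define P' where "P' = P - C ** transpose C"
  have "C ** transpose C = P - P'"
    by (simp add: P'_def)
  then have "transpose C ** matrix_inv P ** (C ** transpose C) ** matrix_inv P' ** C
      = transpose C ** matrix_inv P' ** C - transpose C ** matrix_inv P ** C"
    using P P'[folded P'_def] by (simp add: matrix_distribs matrix_inv_simps)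
  then show ?thesis
    unfolding P'_def[symmetric] by (simp add: matrix_distribs matrix_mul_assoc)
qed

section \<open>Regularity forced by domination of the Gramian\<close>

text \<open>To be read with G the full Gramian, H the Gramian up to time k, P = Q 0, C the next
  column block, and (P - H) p = C v. No sign of \<open>P\<close> is available. Instead, w = P p
  satisfies w \<bullet> P^-1 w < w \<bullet> G^-1 w, and the right-hand side is bounded through w =
  C v + H p.\<close>

lemma gram_domination:
  fixes G H P :: "real^'n^'n" and C :: "real^'m^'n"
  assumes G: "pos_def G" and P: "invertible P" and GP: "pos_def (matrix_inv G - matrix_inv P)"
    and H: "pos_semidef H" and le: "\<And>x. x \<bullet> (H *v x) + (norm (transpose C *v x))\<^sup>2 \<le> x \<bullet> (G *v x)"
    and eq: "P *v p = C *v v + H *v p" and p: "p \<noteq> 0"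
  shows "(C *v v) \<bullet> p < v \<bullet> v"
proof -
  define w where "w = P *v p"
  define z where "z = matrix_inv G *v w"
  have "w \<noteq> 0"
    using P p by (auto simp: w_def invertible_iff_ker)
  then have "0 < w \<bullet> ((matrix_inv G - matrix_inv P) *v w)"
    using GP by (rule pos_def_pos[rotated])
  moreover have "matrix_inv P *v w = p"
    using P by (simp add: w_def)
  ultimately have "w \<bullet> p < w \<bullet> z"
    by (simp add: z_def matrix_vector_mult_diff_rdistrib inner_diff_right)
  moreover have "w \<bullet> p = (C *v v) \<bullet> p + p \<bullet> (H *v p)"
    using eq by (simp add: w_def inner_add_left inner_commute[of p])
  \<comment> \<open>Expanding one factor w in twice w \<bullet> z gives two mixed terms. By the
    arithmetic-geometric mean they are at most v \<bullet> v + p \<bullet> H p plus a form in z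
    which the Gramian bound absorbs into a single w \<bullet> z.\<close>
  moreover have "w \<bullet> z \<le> v \<bullet> v + p \<bullet> (H *v p)"
  proof -
    have "0 \<le> (z - p) \<bullet> (H *v (z - p))"
      using H by (simp add: pos_semidef_def)
    moreover have "p \<bullet> (H *v z) = z \<bullet> (H *v p)"
      using H unfolding pos_semidef_def by (metis dot_matrix_right inner_commute)
    ultimately have 1: "2 * (z \<bullet> (H *v p)) \<le> z \<bullet> (H *v z) + p \<bullet> (H *v p)"
      by (simp add: matrix_vector_mult_diff_distrib inner_diff_left inner_diff_right)
    have "0 \<le> (norm (transpose C *v z - v))\<^sup>2"
      by simp
    then have 2: "2 * ((transpose C *v z) \<bullet> v) \<le> (norm (transpose C *v z))\<^sup>2 + v \<bullet> v"
      by (simp add: power2_norm_eq_inner inner_diff_left inner_diff_right inner_commute)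
    have "G *v z = w"
      using pos_def_invertible[OF G] by (simp add: z_def)
    then have 3: "z \<bullet> (H *v z) + (norm (transpose C *v z))\<^sup>2 \<le> w \<bullet> z"
      using le[of z] by (simp add: inner_commute)
    have "w \<bullet> z = (transpose C *v z) \<bullet> v + z \<bullet> (H *v p)"
      using eq by (simp add: w_def inner_add_right dot_matrix_left inner_commute[of _ z])
    with 1 2 3 show ?thesis
      by linarith
  qed
  ultimately show ?thesis
    by linarith
qed

text \<open>Both parts come from the strict inequality: v = 0 rules out a kernel of P - H, and p =
  (P - H)^-1 C v gives the quadratic form at v. The case p = 0 is separate because strictness
  requires p nonzero.\<close>

lemma gram_regular:
  fixes G H P :: "real^'n^'n" and C :: "real^'m^'n"
  assumes G: "pos_def G" and P: "invertible P" "transpose P = P"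
    and GP: "pos_def (matrix_inv G - matrix_inv P)"
    and H: "pos_semidef H" and le: "\<And>x. x \<bullet> (H *v x) + (norm (transpose C *v x))\<^sup>2 \<le> x \<bullet> (G *v x)"
  shows "invertible (P - H)" and "pos_def (mat 1 - transpose C ** matrix_inv (P - H) ** C)"
proof -
  show inv: "invertible (P - H)"
    unfolding invertible_iff_ker
  proof (intro allI impI)
    fix x assume "(P - H) *v x = 0"
    then have "P *v x = C *v 0 + H *v x"
      by (simp add: matrix_vector_mult_diff_rdistrib)
    then show "x = 0"
      using gram_domination[OF G P(1) GP H le, of x 0] by fastforce
  qed
  have "transpose (P - H) = P - H"
    using P(2) H by (simp add: transpose_diff pos_semidef_def)
  then have sym: "transpose (matrix_inv (P - H)) = matrix_inv (P - H)"
    using inv by (rule sym_matrix_inv)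
  have "0 < v \<bullet> ((mat 1 - transpose C ** matrix_inv (P - H) ** C) *v v)" if v: "v \<noteq> 0" for v
  proof -
    define p where "p = matrix_inv (P - H) *v (C *v v)"
    have *: "v \<bullet> ((mat 1 - transpose C ** matrix_inv (P - H) ** C) *v v) = v \<bullet> v - (C *v v) \<bullet> p"
      by (simp add: p_def matrix_vector_mult_diff_rdistrib inner_diff_right dot_matrix_left
          flip: matrix_vector_mul_assoc)
    show ?thesis
    proof (cases "p = 0")
      case False
      have "(P - H) *v p = C *v v"
        using inv by (simp add: p_def)
      then have "P *v p = C *v v + H *v p"
        by (simp add: matrix_vector_mult_diff_rdistrib algebra_simps)
      then show ?thesis
        using gram_domination[OF G P(1) GP H le _ False] * by fastforce
    qed (use v * in simp)
  qed
  then show "pos_def (mat 1 - transpose C ** matrix_inv (P - H) ** C)"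
    by (simp add: pos_def_def transpose_distribs sym matrix_mul_assoc)
qed

section \<open>Transition matrices and Gramians\<close>

lemma Phi_refl [simp]: "Phi A k k = mat 1"
  by (simp add: Phi_def)

lemma Phi_0_Suc: "Phi A 0 (Suc k) = Phi A 0 k ** matrix_inv (A k)"
proof -
  \<comment> \<open>The new factor stands at the right end of the product, that is in the seed of
    \<open>foldr\<close>; hence the general seed \<open>Z\<close>.\<close>
  have *: "foldr (\<lambda>i P. matrix_inv (A i) ** P) ks Z = foldr (\<lambda>i P. matrix_inv (A i) ** P) ks (mat 1) ** Z"
    for ks Z
    by (induction ks) (simp_all add: matrix_mul_assoc)
  show ?thesis
    by (cases "k = 0") (simp_all add: Phi_def *[of _ "matrix_inv (A k)"])
qed

lemma Phi_Suc: "l \<le> k \<Longrightarrow> Phi A (Suc k) l = A k ** Phi A k l"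
  by (simp add: Phi_def)

lemma invertible_Phi_0: "\<forall>j<k. invertible (A j) \<Longrightarrow> invertible (Phi A 0 k)"
proof (induction k)
  case 0
  show ?case
    by (simp add: pos_def_invertible pos_def_mat_1)
next
  case (Suc k)
  then show ?case
    by (simp add: Phi_0_Suc invertible_mult invertible_matrix_inv)
qed

lemma Phi_via_0:
  fixes A :: "nat \<Rightarrow> real^'n^'n"
  assumes "l \<le> k" "\<forall>j<k. invertible (A j)"
  shows "Phi A k l = Phi A k 0 ** Phi A 0 l"
  using assms
proof (induction k rule: dec_induct)
  case base
  have "\<forall>j<l. invertible (A j) \<Longrightarrow> Phi A l 0 ** Phi A 0 l = mat 1"
    by (induction l) (simp_all add: Phi_Suc Phi_0_Suc matrix_mul_assoc, simp add: matrix_inv_simps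
        flip: matrix_mul_assoc)
  then show ?case
    using base by simp
next
  case (step k)
  then show ?case
    by (simp add: Phi_Suc matrix_mul_assoc)
qed

text \<open>The influence of the input at time k, transported back to time 0. In these coordinates
  the summands of the Gramian do not depend on the horizon, so the Gramian increases with
  it.\<close>

definition ctrl :: "(nat \<Rightarrow> real^'n^'n) \<Rightarrow> (nat \<Rightarrow> real^'m^'n) \<Rightarrow> nat \<Rightarrow> real^'m^'n" where
  "ctrl A B k = Phi A 0 (Suc k) ** B k"

lemma gram_c_eq: "gram_c A B k 0 = (\<Sum>j<k. ctrl A B j ** transpose (ctrl A B j))"
  by (simp add: gram_c_def ctrl_def matrix_transpose_mul matrix_mul_assoc atLeast0LessThan)

lemma gram_c_Suc: "gram_c A B (Suc k) 0 = gram_c A B k 0 + ctrl A B k ** transpose (ctrl A B k)"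
  by (simp add: gram_c_eq)

lemma quad_gram_c:
  "x \<bullet> (gram_c A B k 0 *v x) = (\<Sum>j<k. (norm (transpose (ctrl A B j) *v x))\<^sup>2)"
proof (induction k)
  case (Suc k)
  have "x \<bullet> (ctrl A B k ** transpose (ctrl A B k) *v x) = (norm (transpose (ctrl A B k) *v x))\<^sup>2"
    by (simp add: dot_matrix_right power2_norm_eq_inner flip: matrix_vector_mul_assoc)
  with Suc show ?case
    by (simp add: gram_c_Suc matrix_vector_mult_add_rdistrib inner_add_right)
qed (simp add: gram_c_eq)

lemma transpose_gram_c: "transpose (gram_c A B k 0) = gram_c A B k 0"
proof (induction k)
  case 0
  show ?case
    by (simp add: gram_c_eq transpose_def vec_eq_iff)
next
  case (Suc k)
  then show ?case
    by (simp add: gram_c_Suc transpose_distribs)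
qed

lemma pos_semidef_gram_c: "pos_semidef (gram_c A B k 0)"
  by (simp add: pos_semidef_def transpose_gram_c quad_gram_c sum_nonneg)

lemma matrix_sum_congruence:
  fixes T :: "real^'n^'k" and X :: "nat \<Rightarrow> real^'n^'n"
  shows "(\<Sum>j<N. T ** X j ** transpose T) = T ** (\<Sum>j<N. X j) ** transpose T"
  by (induction N) (simp_all add: matrix_distribs)

text \<open>The two Gramians are congruent through \<open>Phi A N 0\<close>, so a kernel vector of
  one yields a kernel vector of the other; a semidefinite matrix without kernel is definite.\<close>

lemma pos_def_gram_c:
  fixes A :: "nat \<Rightarrow> real^'n^'n"
  assumes A: "\<forall>k<N. invertible (A k)" and inv: "invertible (gram_r A B N 0)"
  shows "pos_def (gram_c A B N 0)"
proof -
  have r: "gram_r A B N 0 = Phi A N 0 ** gram_c A B N 0 ** transpose (Phi A N 0)"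
  proof -
    have "Phi A N (j + 1) ** B j ** transpose (B j) ** transpose (Phi A N (j + 1))
        = Phi A N 0 ** (ctrl A B j ** transpose (ctrl A B j)) ** transpose (Phi A N 0)" if "j < N" for j
      using that A Phi_via_0[of "Suc j" N A]
      by (simp add: ctrl_def matrix_transpose_mul matrix_mul_assoc)
    then have "gram_r A B N 0 = (\<Sum>j<N. Phi A N 0 ** (ctrl A B j ** transpose (ctrl A B j)) ** transpose (Phi A N 0))"
      by (simp add: gram_r_def atLeast0LessThan)
    also have "\<dots> = Phi A N 0 ** (\<Sum>j<N. ctrl A B j ** transpose (ctrl A B j)) ** transpose (Phi A N 0)"
      by (rule matrix_sum_congruence)
    finally show ?thesis
      by (simp add: gram_c_eq)
  qed
  have one: "Phi A N 0 ** Phi A 0 N = mat 1"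
    using Phi_via_0[of N N A] A by simp
  have "x = 0" if x: "gram_c A B N 0 *v x = 0" for x
  proof -
    have eq: "transpose (Phi A N 0) *v (transpose (Phi A 0 N) *v x) = x"
      using one by (metis matrix_left_right_inverse matrix_transpose_mul matrix_vector_mul_assoc
          matrix_vector_mul_lid transpose_mat)
    then have "gram_r A B N 0 *v (transpose (Phi A 0 N) *v x) = 0"
      using x by (simp add: r flip: matrix_vector_mul_assoc)
    then have "transpose (Phi A 0 N) *v x = 0"
      using inv invertible_iff_ker by blast
    then show ?thesis
      using eq by simp
  qed
  then have "invertible (gram_c A B N 0)"
    by (simp add: invertible_iff_ker)
  then show ?thesis
    using pos_semidef_gram_c by (rule pos_def_if_semidef_invertible[rotated])
qed

section \<open>The recursion for Q, its Riccati form and the closed-loop covariances\<close>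

text \<open>The deterministic part of the problem. The boundary covariances are absent: all that
  regularity of the recursion asks of them is the inequality \<open>GQ\<close>.\<close>

locale lyapunov =
  fixes N :: nat and A :: "nat \<Rightarrow> real^'n^'n" and B :: "nat \<Rightarrow> real^'m^'n" and Q :: "nat \<Rightarrow> real^'n^'n"
  assumes invertible_A: "k < N \<Longrightarrow> invertible (A k)"
    and G: "pos_def (gram_c A B N 0)"
    and Q0: "invertible (Q 0)" "transpose (Q 0) = Q 0"
    and GQ: "pos_def (matrix_inv (gram_c A B N 0) - matrix_inv (Q 0))"
    and Q_Suc: "k < N \<Longrightarrow> Q (Suc k) = A k ** Q k ** transpose (A k) - B k ** transpose (B k)"
begin

lemma Phi_Suc_A: "k < N \<Longrightarrow> Phi A 0 (Suc k) ** A k = Phi A 0 k"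
  by (simp add: Phi_0_Suc invertible_A matrix_inv_simps)

lemma inv_Phi: "k \<le> N \<Longrightarrow> invertible (Phi A 0 k)"
  by (intro invertible_Phi_0) (auto intro: invertible_A)

lemma Phi_Q: "k \<le> N \<Longrightarrow> Phi A 0 k ** Q k ** transpose (Phi A 0 k) = Q 0 - gram_c A B k 0"
proof (induction k)
  case 0
  show ?case
    by (simp add: gram_c_eq)
next
  case (Suc k)
  let ?T = "Phi A 0 (Suc k)"
  have "?T ** Q (Suc k) ** transpose ?T
      = (?T ** A k) ** Q k ** transpose (?T ** A k) - ctrl A B k ** transpose (ctrl A B k)"
    using Suc.prems by (simp add: Q_Suc ctrl_def matrix_distribs matrix_transpose_mul matrix_mul_assoc)
  then show ?case
    using Suc by (simp add: Phi_Suc_A gram_c_Suc)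
qed

lemma gram_le:
  assumes "k < N"
  shows "x \<bullet> (gram_c A B k 0 *v x) + (norm (transpose (ctrl A B k) *v x))\<^sup>2
    \<le> x \<bullet> (gram_c A B N 0 *v x)"
proof -
  have "(\<Sum>j<Suc k. (norm (transpose (ctrl A B j) *v x))\<^sup>2) \<le> (\<Sum>j<N. (norm (transpose (ctrl A B j) *v x))\<^sup>2)"
    using assms by (intro sum_mono2) auto
  then show ?thesis
    by (simp add: quad_gram_c)
qed

text \<open>Used with C = 0, the regularity lemma only asks that the Gramian up to time k is below
  the full one, so that k = N is covered; \<open>gram_le\<close> stops at k < N.\<close>

lemma inv_P: "k \<le> N \<Longrightarrow> invertible (Q 0 - gram_c A B k 0)"
  by (rule gram_regular(1)[OF G Q0 GQ pos_semidef_gram_c, where C = "0 :: real^'m^'n"])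
    (auto simp: quad_gram_c transpose_def zero_vec_def[symmetric] intro!: sum_mono2)

lemma sym_Q: "k \<le> N \<Longrightarrow> transpose (Q k) = Q k"
  by (induction k) (simp_all add: Q0 Q_Suc transpose_distribs matrix_mul_assoc)

lemma inv_Q:
  assumes "k \<le> N"
  shows "invertible (Q k)"
    and "transpose (Phi A 0 k) ** matrix_inv (Q 0 - gram_c A B k 0) ** Phi A 0 k = matrix_inv (Q k)"
proof -
  let ?T = "Phi A 0 k" and ?P = "Q 0 - gram_c A B k 0"
  have T: "invertible ?T" "invertible (transpose ?T)"
    using assms inv_Phi transpose_invertible by blast+
  have "?T ** (Q k ** (transpose ?T ** matrix_inv ?P ** ?T)) = ?P ** matrix_inv ?P ** ?T"
    by (simp add: Phi_Q[OF assms, symmetric] matrix_mul_assoc)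
  also have "\<dots> = ?T"
    using inv_P[OF assms] by (simp add: matrix_inv_simps)
  finally have "matrix_inv ?T ** ?T ** (Q k ** (transpose ?T ** matrix_inv ?P ** ?T)) = matrix_inv ?T ** ?T"
    by (simp flip: matrix_mul_assoc)
  then have "Q k ** (transpose ?T ** matrix_inv ?P ** ?T) = mat 1"
    using T by (simp add: matrix_inv_simps)
  then show "invertible (Q k)" "transpose ?T ** matrix_inv ?P ** ?T = matrix_inv (Q k)"
    using matrix_inv_unique by metis+
qed

text \<open>Subtracting C C^T from Q 0 - G_c(k,0) advances the time by one. The definiteness
  obtained at time k therefore concerns \<open>Q (Suc k)\<close> after inversion.\<close>

lemma pos_def_M:
  assumes "k < N"
  shows "pos_def (mat 1 + transpose (B k) ** matrix_inv (Q (Suc k)) ** B k)"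
proof -
  let ?C = "ctrl A B k" and ?P = "Q 0 - gram_c A B k 0"
  have P': "?P - ?C ** transpose ?C = Q 0 - gram_c A B (Suc k) 0"
    by (simp add: gram_c_Suc)
  have E: "pos_def (mat 1 - transpose ?C ** matrix_inv ?P ** ?C)"
    by (rule gram_regular(2)[OF G Q0 GQ pos_semidef_gram_c gram_le[OF assms]])
  have "transpose ?C ** matrix_inv (?P - ?C ** transpose ?C) ** ?C
      = transpose (B k) ** (transpose (Phi A 0 (Suc k)) ** matrix_inv (Q 0 - gram_c A B (Suc k) 0)
        ** Phi A 0 (Suc k)) ** B k"
    unfolding P' by (simp add: ctrl_def matrix_transpose_mul matrix_mul_assoc)
  also have "\<dots> = transpose (B k) ** matrix_inv (Q (Suc k)) ** B k"
    using assms inv_Q(2)[of "Suc k"] by simp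
  finally have "(mat 1 - transpose ?C ** matrix_inv ?P ** ?C)
      ** (mat 1 + transpose (B k) ** matrix_inv (Q (Suc k)) ** B k) = mat 1"
    using woodbury_dual[of ?P ?C] inv_P[of k] inv_P[of "Suc k"] assms by (simp add: P')
  then show ?thesis
    using pos_def_matrix_inv[OF E] matrix_inv_unique(2) by metis
qed

lemma pos_def_input_cov: "k < N \<Longrightarrow> pos_def (input_cov B Q k)"
  using pos_def_M by (simp add: input_cov_def pos_def_matrix_inv)

lemma matrix_inv_input_cov:
  "k < N \<Longrightarrow> matrix_inv (input_cov B Q k) = mat 1 + transpose (B k) ** matrix_inv (Q (Suc k)) ** B k"
  using pos_def_invertible[OF pos_def_M] unfolding input_cov_def
  by (intro matrix_inv_unique) (simp add: matrix_inv_left)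

text \<open>Feedback with the sign left out: the mean input at x is
  \<open>- (gain k *v x)\<close>.\<close>

definition gain :: "nat \<Rightarrow> real^'n^'m" where
  "gain k = input_cov B Q k ** transpose (B k) ** matrix_inv (Q (Suc k)) ** A k"

text \<open>The backward discrete Riccati equation for the inverses of \<open>Q k\<close>: the
  Lyapunov recursion says that Q (k+1) + B B^T equals A (Q k) A^T, and both sides are
  inverted.\<close>

lemma woodbury_Q:
  assumes k: "k < N"
  shows "transpose (matrix_inv (A k)) ** matrix_inv (Q k) ** matrix_inv (A k)
    = matrix_inv (Q (Suc k)) - matrix_inv (Q (Suc k)) ** B k ** input_cov B Q k ** transpose (B k)
      ** matrix_inv (Q (Suc k))"
proof -
  have A: "invertible (A k)" "invertible (transpose (A k))"
    using k invertible_A transpose_invertible by blast+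
  have "A k ** Q k ** transpose (A k) ** (transpose (matrix_inv (A k)) ** matrix_inv (Q k) ** matrix_inv (A k)) = mat 1"
    using A inv_Q(1)[of k] k
    by (simp add: transpose_matrix_inv[symmetric] matrix_mul_assoc matrix_inv_simps)
  then have "transpose (matrix_inv (A k)) ** matrix_inv (Q k) ** matrix_inv (A k)
      = matrix_inv (Q (Suc k) + B k ** transpose (B k))"
    using k by (simp add: Q_Suc matrix_inv_unique(2))
  also have "\<dots> = matrix_inv (Q (Suc k)) - matrix_inv (Q (Suc k)) ** B k ** input_cov B Q k ** transpose (B k)
      ** matrix_inv (Q (Suc k))"
    unfolding input_cov_def Suc_eq_plus1[symmetric] using k inv_Q(1)[of "Suc k"] pos_def_invertible[OF pos_def_M]
    by (intro woodbury) auto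
  finally show ?thesis .
qed

text \<open>Completion of the square in the soft Bellman recursion with value functions \<open>x \<bullet> (Q k)\<inverse> x / 2\<close>.\<close>

lemma bellman:
  fixes x :: "real^'n" and u :: "real^'m"
  assumes k: "k < N"
  defines "y \<equiv> A k *v x + B k *v u"
  shows "u \<bullet> u + y \<bullet> (matrix_inv (Q (Suc k)) *v y) = x \<bullet> (matrix_inv (Q k) *v x)
    + (u + gain k *v x) \<bullet> (matrix_inv (input_cov B Q k) *v (u + gain k *v x))"
proof -
  let ?P = "matrix_inv (Q (Suc k))" and ?B = "B k" and ?A = "A k"
  let ?M = "matrix_inv (input_cov B Q k)"
  define a where "a = ?A *v x"
  \<comment> \<open>Half the linear coefficient in \<open>u\<close> of the left-hand side; the
    minimiser over \<open>u\<close> is \<open>- (input_cov B Q k *v b)\<close>, which is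
    \<open>- (gain k *v x)\<close>.\<close>
  define b where "b = transpose ?B *v (?P *v a)"
  have symP: "transpose ?P = ?P"
    using k sym_Q inv_Q by (intro sym_matrix_inv) auto
  have V: "invertible (input_cov B Q k)" "transpose (input_cov B Q k) = input_cov B Q k"
    using pos_def_input_cov[OF k] by (auto intro: pos_def_invertible pos_def_sym)
  have symM: "transpose ?M = ?M"
    using V by (intro sym_matrix_inv)
  have Mg: "?M *v (gain k *v x) = b"
    using V(1) by (simp add: gain_def b_def a_def flip: matrix_vector_mul_assoc)
  have gb: "gain k *v x = input_cov B Q k *v b"
    by (simp add: gain_def b_def a_def matrix_vector_mul_assoc matrix_mul_assoc)
  have x: "x = matrix_inv ?A *v a"
    using invertible_A[OF k] by (simp add: a_def)
  have "x \<bullet> (matrix_inv (Q k) *v x)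
      = a \<bullet> ((transpose (matrix_inv ?A) ** matrix_inv (Q k) ** matrix_inv ?A) *v a)"
    unfolding x by (simp add: dot_matrix_left flip: matrix_vector_mul_assoc)
  also have "\<dots> = a \<bullet> (?P *v a) - b \<bullet> (input_cov B Q k *v b)"
    unfolding woodbury_Q[OF k]
    by (simp add: b_def matrix_vector_mult_diff_rdistrib inner_diff_right dot_matrix_left symP
        flip: matrix_vector_mul_assoc)
  finally have 1: "x \<bullet> (matrix_inv (Q k) *v x) = a \<bullet> (?P *v a) - b \<bullet> (input_cov B Q k *v b)" .
  have uM: "u \<bullet> (?M *v u) = u \<bullet> u + (?B *v u) \<bullet> (?P *v (?B *v u))"
    by (simp add: matrix_inv_input_cov[OF k] matrix_vector_mult_add_rdistrib inner_add_right
        dot_matrix_left flip: matrix_vector_mul_assoc)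
  have "(gain k *v x) \<bullet> (?M *v u) = b \<bullet> u"
    using Mg symM by (metis dot_matrix_right)
  then have 2: "(u + gain k *v x) \<bullet> (?M *v (u + gain k *v x))
      = u \<bullet> (?M *v u) + 2 * (u \<bullet> b) + b \<bullet> (input_cov B Q k *v b)"
    unfolding matrix_vector_right_distrib inner_add_left inner_add_right Mg
    by (simp add: gb inner_commute)
  have "(?B *v u) \<bullet> (?P *v a) = u \<bullet> b"
    by (simp add: b_def dot_matrix_left)
  moreover have "a \<bullet> (?P *v (?B *v u)) = (?B *v u) \<bullet> (?P *v a)"
    using symP by (metis dot_matrix_right inner_commute)
  ultimately have "y \<bullet> (?P *v y) = a \<bullet> (?P *v a) + 2 * (u \<bullet> b) + (?B *v u) \<bullet> (?P *v (?B *v u))"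
    unfolding y_def a_def[symmetric] matrix_vector_right_distrib inner_add_left inner_add_right
    by simp
  then show ?thesis
    unfolding 2 uM 1 by simp
qed

text \<open>Factoring \<open>Q (Suc k)\<close> out on the left leaves exactly the right-hand side of
  the Riccati equation. With \<open>noise_matrix\<close> this removes \<open>B\<close> from the
  covariance recursion.\<close>

lemma closed_loop_matrix:
  assumes k: "k < N"
  shows "A k - B k ** gain k = Q (Suc k) ** transpose (matrix_inv (A k)) ** matrix_inv (Q k)"
proof -
  have "A k - B k ** gain k = Q (Suc k) ** (transpose (matrix_inv (A k)) ** matrix_inv (Q k) ** matrix_inv (A k)) ** A k"
    unfolding woodbury_Q[OF k] gain_def using inv_Q(1)[of "Suc k"] k
    by (simp add: matrix_distribs matrix_mul_assoc matrix_inv_simps)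
  also have "\<dots> = Q (Suc k) ** transpose (matrix_inv (A k)) ** matrix_inv (Q k)"
    using invertible_A[OF k] by (simp add: matrix_mul_assoc matrix_inv_simps)
  finally show ?thesis .
qed

lemma noise_matrix:
  assumes k: "k < N"
  shows "B k ** input_cov B Q k ** transpose (B k) = Q (Suc k)
    - Q (Suc k) ** (transpose (matrix_inv (A k)) ** matrix_inv (Q k) ** matrix_inv (A k)) ** Q (Suc k)"
  unfolding woodbury_Q[OF k] using inv_Q(1)[of "Suc k"] k
  by (simp add: matrix_distribs matrix_mul_assoc matrix_inv_simps)

text \<open>Covariance recursion for x_k under the Gaussian policy, with initial covariance
  \<open>S\<close> and noise level \<open>e\<close>. It is introduced as plain matrix algebra;
  \<open>state_law\<close> gives it its probabilistic meaning.\<close>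

primrec cov :: "real \<Rightarrow> real^'n^'n \<Rightarrow> nat \<Rightarrow> real^'n^'n" where
  "cov e S 0 = S"
| "cov e S (Suc k) = (A k - B k ** gain k) ** cov e S k ** transpose (A k - B k ** gain k)
    + B k ** (e *\<^sub>R input_cov B Q k) ** transpose (B k)"

text \<open>Both terms of the covariance recursion carry \<open>Q (Suc k)\<close> on either side.
  Stripping these factors leaves an expression affine in the old covariance, whose constant part is
  absorbed by subtracting the inverse of \<open>Q k\<close>.\<close>

lemma cov_invariant:
  fixes S :: "real^'n^'n"
  assumes "k \<le> N" and e: "e \<noteq> 0"
  defines "W \<equiv> \<lambda>k. (1/e) *\<^sub>R (matrix_inv (Q k) ** cov e S k ** matrix_inv (Q k)) - matrix_inv (Q k)"
  shows "W k = transpose (Phi A 0 k) ** W 0 ** Phi A 0 k"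
  using assms(1)
proof (induction k)
  case (Suc k)
  then have k: "k < N"
    by simp
  let ?Ai = "matrix_inv (A k)" and ?P = "matrix_inv (Q k)" and ?Q' = "Q (Suc k)"
  have Q': "invertible ?Q'" "transpose ?Q' = ?Q'" "transpose ?P = ?P"
    using k inv_Q(1)[of "Suc k"] sym_Q[of "Suc k"] sym_matrix_inv[OF sym_Q inv_Q(1), of k] by auto
  have "cov e S (Suc k) = ?Q' ** (transpose ?Ai ** ?P ** cov e S k ** ?P ** ?Ai) ** ?Q'
      + e *\<^sub>R (?Q' - ?Q' ** (transpose ?Ai ** ?P ** ?Ai) ** ?Q')"
    unfolding noise_matrix[OF k, symmetric]
    by (simp add: closed_loop_matrix[OF k] Q' matrix_transpose_mul matrix_mul_assoc matrix_distribs)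
  then have "matrix_inv ?Q' ** cov e S (Suc k) ** matrix_inv ?Q'
      = transpose ?Ai ** ?P ** cov e S k ** ?P ** ?Ai
        + e *\<^sub>R (matrix_inv ?Q' - transpose ?Ai ** ?P ** ?Ai)"
    using Q'(1)
    by (simp add: matrix_distribs matrix_mul_assoc matrix_inv_simps scaleR_right_diff_distrib)
  then have "W (Suc k) = transpose ?Ai ** W k ** ?Ai"
    using e by (simp add: W_def matrix_distribs matrix_mul_assoc scaleR_add_right)
  then show ?case
    using Suc by (simp add: Phi_0_Suc matrix_transpose_mul matrix_mul_assoc)
qed simp

text \<open>The invariant is evaluated at k = N in time-0 coordinates, where Q N becomes P = Q 0 -
  G. The premise \<open>T\<close> is the resulting equation for the terminal covariance, multiplied
  by \<open>e\<close>.\<close>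

lemma cov_terminal:
  fixes S :: "real^'n^'n"
  assumes e: "e \<noteq> 0"
  defines "G \<equiv> gram_c A B N 0"
  defines "Y \<equiv> matrix_inv G - matrix_inv (Q 0)"
  assumes T: "G ** Y ** S ** Y ** G + e *\<^sub>R (G ** Y ** G) = Phi A 0 N ** S' ** transpose (Phi A 0 N)"
  shows "cov e S N = S'"
proof -
  let ?T = "Phi A 0 N" and ?P0 = "matrix_inv (Q 0)" and ?QN = "matrix_inv (Q N)"
  define P where "P = Q 0 - G"
  define W0 where "W0 = (1/e) *\<^sub>R (?P0 ** S ** ?P0) - ?P0"
  have G: "invertible G"
    using G pos_def_invertible unfolding G_def by blast
  have QN: "invertible (Q N)"
    using inv_Q by simp
  have TT: "invertible ?T" "invertible (transpose ?T)"
    using inv_Phi transpose_invertible by blast+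
  have "(1/e) *\<^sub>R (?QN ** cov e S N ** ?QN) - ?QN = transpose ?T ** W0 ** ?T"
    using cov_invariant[of N e S] e by (simp add: W0_def)
  then have "Q N ** ((1/e) *\<^sub>R (?QN ** cov e S N ** ?QN)) ** Q N
      = Q N ** (transpose ?T ** W0 ** ?T + ?QN) ** Q N"
    by (metis diff_add_cancel)
  then have "(1/e) *\<^sub>R cov e S N = Q N ** (transpose ?T ** W0 ** ?T) ** Q N + Q N"
    using QN by (simp add: matrix_distribs matrix_mul_assoc matrix_inv_simps)
  then have "?T ** ((1/e) *\<^sub>R cov e S N) ** transpose ?T
      = (?T ** Q N ** transpose ?T) ** W0 ** (?T ** Q N ** transpose ?T) + ?T ** Q N ** transpose ?T"
    by (simp add: matrix_distribs matrix_mul_assoc)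
  then have 1: "?T ** ((1/e) *\<^sub>R cov e S N) ** transpose ?T = P ** W0 ** P + P"
    using Phi_Q[of N] by (simp add: P_def G_def)
  \<comment> \<open>(Q 0 - G) (Q 0)^-1 = G (G^-1 - (Q 0)^-1): \<open>P\<close> is traded for the
    definite matrices \<open>G\<close> and \<open>Y\<close>.\<close>
  have PP: "P ** ?P0 = G ** Y" "?P0 ** P = Y ** G"
    using G Q0(1) by (simp_all add: P_def Y_def matrix_distribs matrix_inv_simps)
  have "P ** W0 ** P + P = (1/e) *\<^sub>R ((P ** ?P0) ** S ** (?P0 ** P)) - P ** ?P0 ** P + P"
    by (simp add: W0_def matrix_distribs matrix_mul_assoc)
  also have "\<dots> = (1/e) *\<^sub>R (G ** Y ** S ** Y ** G) + (mat 1 - G ** Y) ** P"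
    by (simp add: PP matrix_distribs matrix_mul_assoc)
  also have "mat 1 - G ** Y = G ** ?P0"
    using G by (simp add: Y_def matrix_distribs matrix_inv_simps)
  also have "G ** ?P0 ** P = G ** Y ** G"
    by (simp add: PP flip: matrix_mul_assoc)
  finally have "?T ** ((1/e) *\<^sub>R cov e S N) ** transpose ?T = (1/e) *\<^sub>R (G ** Y ** S ** Y ** G) + G ** Y ** G"
    using 1 by simp
  then have "e *\<^sub>R (?T ** ((1/e) *\<^sub>R cov e S N) ** transpose ?T) = G ** Y ** S ** Y ** G + e *\<^sub>R (G ** Y ** G)"
    using e by (simp add: scaleR_add_right)
  then have "?T ** cov e S N ** transpose ?T = ?T ** S' ** transpose ?T"
    using e T by (simp add: matrix_distribs)
  then have "matrix_inv ?T ** (?T ** cov e S N ** transpose ?T) ** matrix_inv (transpose ?T)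
      = matrix_inv ?T ** (?T ** S' ** transpose ?T) ** matrix_inv (transpose ?T)"
    by simp
  then show ?thesis
    using TT by (simp add: matrix_mul_assoc matrix_inv_simps)
qed

lemma pos_def_cov:
  assumes "pos_def S" "0 < e" "k \<le> N"
  shows "pos_def (cov e S k)"
  using assms(3)
proof (induction k)
  case (Suc k)
  then show ?case
    using gaussian_completion(1)[OF _ pos_def_scaleR[OF pos_def_input_cov assms(2)] invertible_A refl]
    by simp
qed (simp add: assms)

end

section \<open>The initial matrix that meets the terminal covariance\<close>

text \<open>With g and s the roots of \<open>G\<close> and \<open>S0\<close>, Y = g^-1 s^-1 K s^-1
  g^-1 and S = e g s^2 g. Substituted into the terminal expression, these collapse it to e g s^-1
  (K^2 + K) s^-1 g, and K was chosen so that K^2 + K = s SN s.\<close>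

lemma schrodinger_initial_data:
  fixes G S X :: "real^'n^'n"
  assumes e: "0 < e" and G: "pos_def G" and S: "pos_def S" and X: "pos_def X"
  defines "g \<equiv> msqrt G"
  defines "S0 \<equiv> (1/e) *\<^sub>R (matrix_inv g ** S ** matrix_inv g)"
    and "SN \<equiv> (1/e) *\<^sub>R (matrix_inv g ** X ** matrix_inv g)"
  assumes F: "invertible (F_map S0 SN)"
  defines "Q0 \<equiv> g ** msqrt S0 ** matrix_inv (F_map S0 SN) ** msqrt S0 ** g"
  defines "Y \<equiv> matrix_inv G - matrix_inv Q0"
  shows "invertible Q0" "transpose Q0 = Q0" "pos_def Y"
    and "G ** Y ** S ** Y ** G + e *\<^sub>R (G ** Y ** G) = X"
proof -
  define s where "s = msqrt S0"
  have g: "pos_def g" "g ** g = G" "invertible g" "transpose g = g"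
    unfolding g_def using pos_def_msqrt[OF G] msqrt_square[OF pos_def_imp_semidef[OF G]]
    by (auto intro: pos_def_invertible pos_def_sym)
  have gi: "pos_def (matrix_inv g)" "transpose (matrix_inv g) = matrix_inv g" "invertible (matrix_inv g)"
    using g(1) pos_def_matrix_inv pos_def_sym pos_def_invertible by blast+
  have S0: "pos_def S0"
    unfolding S0_def using pos_def_congruence[OF S gi(3)] e by (intro pos_def_scaleR) (auto simp: gi)
  have SN: "pos_def SN"
    unfolding SN_def using pos_def_congruence[OF X gi(3)] e by (intro pos_def_scaleR) (auto simp: gi)
  have s: "pos_def s" "s ** s = S0" "invertible s" "transpose s = s"
    unfolding s_def using pos_def_msqrt[OF S0] msqrt_square[OF pos_def_imp_semidef[OF S0]]
    by (auto intro: pos_def_invertible pos_def_sym)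
  have si: "transpose (matrix_inv s) = matrix_inv s" "invertible (matrix_inv s)"
    using s(1) pos_def_matrix_inv pos_def_sym pos_def_invertible by blast+
  have sSNs: "pos_def (s ** SN ** s)"
    using pos_def_congruence[OF SN s(3)] by (simp add: s)
  define K where "K = msqrt (s ** SN ** s + (1/4) *\<^sub>R mat 1) - (1/2) *\<^sub>R mat 1"
  have K: "pos_def K" "K ** K + K = s ** SN ** s"
    unfolding K_def by (rule pos_def_msqrt_shift[OF sSNs])+
  have F_eq: "F_map S0 SN = s ** s - K"
    by (simp add: F_map_def K_def s flip: s_def)
  define P where "P = matrix_inv g ** matrix_inv s ** F_map S0 SN ** matrix_inv s ** matrix_inv g"
  have "Q0 ** P = mat 1"
    using F g(3) s(3) unfolding Q0_def P_def s_def[symmetric]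
    by (simp add: matrix_mul_assoc matrix_inv_simps)
  then have Q0: "invertible Q0" "matrix_inv Q0 = P"
    by (auto intro: matrix_inv_unique)
  then show "invertible Q0"
    by simp
  have "transpose (F_map S0 SN) = F_map S0 SN"
    using pos_def_sym[OF K(1)] pos_def_sym[OF S0] by (simp add: F_eq s transpose_diff)
  then have "transpose P = P"
    by (simp add: P_def matrix_transpose_mul si gi matrix_mul_assoc)
  moreover have "P ** Q0 = mat 1"
    using \<open>Q0 ** P = mat 1\<close> by (simp add: matrix_left_right_inverse)
  ultimately show "transpose Q0 = Q0"
    using matrix_inv_unique[of P Q0] sym_matrix_inv[of P] by simp
  have Gi: "matrix_inv G = matrix_inv g ** matrix_inv g"
    unfolding g(2)[symmetric] using g(3)
    by (intro matrix_inv_unique) (simp add: matrix_mul_assoc matrix_inv_simps)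
  \<comment> \<open>In the inverse of \<open>Q0\<close> the part s s of \<open>F_map S0 SN\<close>
    contributes g^-1 g^-1 = G^-1, which cancels.\<close>
  have Y: "Y = matrix_inv g ** (matrix_inv s ** K ** matrix_inv s) ** matrix_inv g"
    unfolding Y_def Q0(2) P_def F_eq Gi using s(3) by (simp add: matrix_distribs matrix_mul_assoc matrix_inv_simps)
  show "pos_def Y"
    unfolding Y using pos_def_congruence[OF pos_def_congruence[OF K(1) si(2)] gi(3)] by (simp add: gi si)
  have S_eq: "S = e *\<^sub>R (g ** s ** s ** g)"
    unfolding matrix_mul_assoc[symmetric] s(2) using e g(3)
    by (simp add: S0_def matrix_distribs) (simp add: matrix_mul_assoc matrix_inv_simps)
  have "G ** Y ** S ** Y ** G + e *\<^sub>R (G ** Y ** G) = e *\<^sub>R (g ** matrix_inv s ** (K ** K + K) ** matrix_inv s ** g)"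
    unfolding Y S_eq g(2)[symmetric] using g(3) s(3)
    by (simp add: matrix_distribs matrix_mul_assoc matrix_inv_simps scaleR_add_right)
  also have "\<dots> = e *\<^sub>R (g ** SN ** g)"
    unfolding K(2) using s(3) by (simp add: matrix_mul_assoc matrix_inv_simps)
  also have "\<dots> = X"
    using e g(3) by (simp add: SN_def matrix_distribs) (simp add: matrix_mul_assoc matrix_inv_simps)
  finally show "G ** Y ** S ** Y ** G + e *\<^sub>R (G ** Y ** G) = X" .
qed

section \<open>The closed-loop law\<close>

abbreviation inputs :: "nat \<Rightarrow> (nat \<Rightarrow> real^'m) measure" where
  "inputs k \<equiv> \<Pi>\<^sub>M i\<in>{..<k}. lborel"

lemma sigma_finite_inputs: "sigma_finite_measure (inputs k :: (nat \<Rightarrow> real^'m) measure)"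
proof -
  interpret product_sigma_finite "\<lambda>_::nat. lborel :: (real^'m) measure" ..
  show ?thesis
    by (rule sigma_finite) simp
qed

text \<open>Causality: the state at time k sees only earlier inputs, so \<open>h N\<close> can be
  integrated out without touching states up to time \<open>N\<close>.\<close>

lemma state_upd: "k \<le> N \<Longrightarrow> state A B (x, h(N := u)) k = state A B (x, h) k"
  by (induction k) simp_all

lemma state_restrict: "k \<le> N \<Longrightarrow> state A B (x, restrict h {..<N}) k = state A B (x, h) k"
  by (induction k) simp_all

lemma measurable_state [measurable]:
  fixes f :: "'a \<Rightarrow> real^'n" and h :: "'a \<Rightarrow> nat \<Rightarrow> real^'m"
  assumes "f \<in> borel_measurable M" "\<And>i. i < k \<Longrightarrow> (\<lambda>x. h x i) \<in> borel_measurable M"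
  shows "(\<lambda>x. state A B (f x, h x) k) \<in> borel_measurable M"
  using assms by (induction k) simp_all

lemma measurable_input:
  "i < k \<Longrightarrow> (\<lambda>\<omega>. snd \<omega> i) \<in> borel_measurable (lborel \<Otimes>\<^sub>M inputs k)"
  using measurable_compose[OF measurable_snd measurable_component_singleton[of i "{..<k}" "\<lambda>_. lborel"]]
  by simp

lemma measurable_state':
  "k \<le> N \<Longrightarrow> (\<lambda>\<omega>. state A B \<omega> k) \<in> borel_measurable (lborel \<Otimes>\<^sub>M inputs N)"
  using measurable_state[where f = fst and h = snd and M = "lborel \<Otimes>\<^sub>M inputs N" and k = k and A = A and B = B]
  by (auto intro: measurable_input)

lemma is_policyD:
  assumes "is_policy N \<pi>" "k < N"
  shows policy_measurable: "(\<lambda>(x, u). \<pi> k x u) \<in> borel_measurable (borel \<Otimes>\<^sub>M borel)"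
    and policy_nonneg: "0 \<le> \<pi> k x u"
    and policy_total: "(\<integral>\<^sup>+ u. ennreal (\<pi> k x u) \<partial>lborel) = 1"
  using assms by (auto simp: is_policy_def)

lemma is_policy_mono: "is_policy N \<pi> \<Longrightarrow> k \<le> N \<Longrightarrow> is_policy k \<pi>"
  by (auto simp: is_policy_def)

lemma measurable_policy:
  assumes "is_policy N \<pi>" "k < N" "f \<in> borel_measurable M" "g \<in> borel_measurable M"
  shows "(\<lambda>x. \<pi> k (f x) (g x)) \<in> borel_measurable M"
  using measurable_compose[OF measurable_Pair[OF assms(3,4)] policy_measurable[OF assms(1,2)]] by simp

lemma sets_closed_loop [measurable_cong, simp]:
  "sets (closed_loop N A B S \<pi>) = sets (lborel \<Otimes>\<^sub>M inputs N)"
  by (simp add: closed_loop_def)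

lemma nn_integral_closed_loop:
  assumes \<pi>: "is_policy N \<pi>" and F: "F \<in> borel_measurable (lborel \<Otimes>\<^sub>M inputs N)"
  shows "(\<integral>\<^sup>+ \<omega>. F \<omega> \<partial>closed_loop N A B S \<pi>) = (\<integral>\<^sup>+ \<omega>. ennreal (gaussian_density 0 S (fst \<omega>) *
        (\<Prod>k<N. \<pi> k (state A B \<omega> k) (snd \<omega> k))) * F \<omega> \<partial>(lborel \<Otimes>\<^sub>M inputs N))"
proof -
  have [measurable]: "(\<lambda>\<omega>. \<pi> k (state A B \<omega> k) (snd \<omega> k)) \<in> borel_measurable (lborel \<Otimes>\<^sub>M inputs N)"
    if "k < N" for k
    using that by (intro measurable_policy[OF \<pi> that] measurable_state' measurable_input) auto
  have [measurable]: "(\<lambda>\<omega>. \<Prod>k<N. \<pi> k (state A B \<omega> k) (snd \<omega> k)) \<in> borel_measurable (lborel \<Otimes>\<^sub>M inputs N)"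
    by (intro borel_measurable_prod) auto
  show ?thesis
    unfolding closed_loop_def by (rule nn_integral_density[OF _ F]) measurable
qed

text \<open>Turns the joint density back into a conditional law: Fubini splits off the last
  coordinate, and by causality only the last factor of the density contains it.\<close>

lemma nn_integral_closed_loop_Suc:
  fixes A :: "nat \<Rightarrow> real^'n^'n" and B :: "nat \<Rightarrow> real^'m^'n"
  assumes \<pi>: "is_policy (Suc N) \<pi>" and S: "pos_def S"
    and F [measurable]: "F \<in> borel_measurable (lborel \<Otimes>\<^sub>M inputs (Suc N))"
  shows "(\<integral>\<^sup>+ \<omega>. F \<omega> \<partial>closed_loop (Suc N) A B S \<pi>)
    = (\<integral>\<^sup>+ \<omega>. \<integral>\<^sup>+ u. ennreal (\<pi> N (state A B \<omega> N) u) * F (fst \<omega>, (snd \<omega>)(N := u)) \<partial>lborel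
        \<partial>closed_loop N A B S \<pi>)"
proof -
  interpret P: product_sigma_finite "\<lambda>_::nat. lborel :: (real^'m) measure" ..
  interpret I: sigma_finite_measure "inputs k :: (nat \<Rightarrow> real^'m) measure" for k
    by (rule sigma_finite_inputs)
  define w where "w k \<omega> = gaussian_density 0 S (fst \<omega>) * (\<Prod>j<k. \<pi> j (state A B \<omega> j) (snd \<omega> j))"
    for k and \<omega> :: "(real^'n) \<times> (nat \<Rightarrow> real^'m)"
  have wm [measurable]: "w k \<in> borel_measurable (lborel \<Otimes>\<^sub>M inputs k)" if "k \<le> Suc N" for k
  proof -
    have [measurable]: "(\<lambda>\<omega>. \<Prod>j<k. \<pi> j (state A B \<omega> j) (snd \<omega> j)) \<in> borel_measurable (lborel \<Otimes>\<^sub>M inputs k)"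
      using that
      by (intro borel_measurable_prod measurable_policy[OF \<pi>] measurable_state' measurable_input) auto
    show ?thesis
      unfolding w_def by measurable
  qed
  have w0: "0 \<le> w k \<omega>" if "k \<le> Suc N" for k \<omega>
    using that S unfolding w_def
    by (intro mult_nonneg_nonneg prod_nonneg) (auto intro: policy_nonneg[OF \<pi>])
  have wSuc: "w (Suc N) (x, h(N := u)) = w N (x, h) * \<pi> N (state A B (x, h) N) u" for x h u
  proof -
    have "(\<Prod>j<N. \<pi> j (state A B (x, h(N := u)) j) ((h(N := u)) j)) = (\<Prod>j<N. \<pi> j (state A B (x, h) j) (h j))"
      by (intro prod.cong) (simp_all add: state_upd)
    then show ?thesis
      by (simp add: w_def state_upd mult.assoc)
  qed
  have [measurable]: "(\<lambda>\<omega>. state A B \<omega> N) \<in> borel_measurable (lborel \<Otimes>\<^sub>M inputs N)"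
    by (rule measurable_state') simp
  have upd [measurable]: "(\<lambda>(\<omega>, u). (fst \<omega>, (snd \<omega>)(N := u)))
      \<in> measurable ((lborel \<Otimes>\<^sub>M inputs N) \<Otimes>\<^sub>M lborel) (lborel \<Otimes>\<^sub>M inputs (Suc N))"
  proof -
    have [measurable]: "(\<lambda>x. (snd (fst x))(N := snd x)) \<in> measurable ((lborel \<Otimes>\<^sub>M inputs N) \<Otimes>\<^sub>M lborel) (inputs (Suc N))"
      by (rule measurable_fun_upd[where J = "{..<N}"]) (auto simp: lessThan_Suc)
    show ?thesis
      unfolding split_beta' by (intro measurable_Pair) measurable
  qed
  have pol [measurable]: "(\<lambda>(\<omega>, u). \<pi> N (state A B \<omega> N) u)
      \<in> borel_measurable ((lborel \<Otimes>\<^sub>M inputs N) \<Otimes>\<^sub>M lborel)"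
    unfolding split_beta' by (rule measurable_policy[OF \<pi>]) auto
  have Fm [measurable]: "(\<lambda>(\<omega>, u). F (fst \<omega>, (snd \<omega>)(N := u))) \<in> borel_measurable ((lborel \<Otimes>\<^sub>M inputs N) \<Otimes>\<^sub>M lborel)"
    using measurable_compose[OF upd F] by (simp add: split_beta')
  let ?R = "\<lambda>\<omega>. \<integral>\<^sup>+ u. ennreal (\<pi> N (state A B \<omega> N) u) * F (fst \<omega>, (snd \<omega>)(N := u)) \<partial>lborel"
  have Rm: "?R \<in> borel_measurable (lborel \<Otimes>\<^sub>M inputs N)"
    by measurable
  have "(\<integral>\<^sup>+ \<omega>. F \<omega> \<partial>closed_loop (Suc N) A B S \<pi>)
      = (\<integral>\<^sup>+ \<omega>. ennreal (w (Suc N) \<omega>) * F \<omega> \<partial>(lborel \<Otimes>\<^sub>M inputs (Suc N)))"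
    unfolding w_def by (rule nn_integral_closed_loop[OF \<pi> F])
  also have "\<dots> = (\<integral>\<^sup>+ x. \<integral>\<^sup>+ h. ennreal (w (Suc N) (x, h)) * F (x, h) \<partial>inputs (Suc N) \<partial>lborel)"
    by (rule I.nn_integral_fst[symmetric]) measurable
  also have "\<dots> = (\<integral>\<^sup>+ x. \<integral>\<^sup>+ h. \<integral>\<^sup>+ u. ennreal (w (Suc N) (x, h(N := u))) * F (x, h(N := u))
      \<partial>lborel \<partial>inputs N \<partial>lborel)"
  proof (rule nn_integral_cong)
    fix x :: "real^'n"
    have "(\<lambda>h. ennreal (w (Suc N) (x, h)) * F (x, h)) \<in> borel_measurable (inputs (Suc N))"
      by measurable
    then show "(\<integral>\<^sup>+ h. ennreal (w (Suc N) (x, h)) * F (x, h) \<partial>inputs (Suc N))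
      = (\<integral>\<^sup>+ h. \<integral>\<^sup>+ u. ennreal (w (Suc N) (x, h(N := u))) * F (x, h(N := u)) \<partial>lborel \<partial>inputs N)"
      using P.product_nn_integral_insert[of "{..<N}" N "\<lambda>h. ennreal (w (Suc N) (x, h)) * F (x, h)"]
      by (simp add: lessThan_Suc)
  qed
  also have "\<dots> = (\<integral>\<^sup>+ x. \<integral>\<^sup>+ h. ennreal (w N (x, h)) * ?R (x, h) \<partial>inputs N \<partial>lborel)"
  proof (intro nn_integral_cong)
    fix x :: "real^'n" and h :: "nat \<Rightarrow> real^'m" assume "h \<in> space (inputs N)"
    then have xh: "(x, h) \<in> space (lborel \<Otimes>\<^sub>M inputs N)"
      by (simp add: space_pair_measure)
    have "(\<lambda>u. ennreal (\<pi> N (state A B (x, h) N) u) * F (x, h(N := u))) \<in> borel_measurable lborel"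
      using measurable_Pair2[OF pol xh] measurable_Pair2[OF Fm xh] by simp
    then have "(\<integral>\<^sup>+ u. ennreal (w N (x, h)) * (ennreal (\<pi> N (state A B (x, h) N) u) * F (x, h(N := u))) \<partial>lborel)
        = ennreal (w N (x, h)) * ?R (x, h)"
      by (simp add: nn_integral_cmult)
    then show "(\<integral>\<^sup>+ u. ennreal (w (Suc N) (x, h(N := u))) * F (x, h(N := u)) \<partial>lborel)
        = ennreal (w N (x, h)) * ?R (x, h)"
      using w0[of N "(x, h)"] by (simp add: wSuc ennreal_mult' mult.assoc)
  qed
  also have "\<dots> = (\<integral>\<^sup>+ \<omega>. ennreal (w N \<omega>) * ?R \<omega> \<partial>(lborel \<Otimes>\<^sub>M inputs N))"
    by (rule I.nn_integral_fst) measurable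
  also have "\<dots> = (\<integral>\<^sup>+ \<omega>. ?R \<omega> \<partial>closed_loop N A B S \<pi>)"
    unfolding w_def by (rule nn_integral_closed_loop[OF is_policy_mono[OF \<pi>] Rm, symmetric]) simp
  finally show ?thesis .
qed

text \<open>Later inputs integrate to 1, one at a time. \<open>restrict\<close> is needed because
  elements of the product space over \<open>{..<k}\<close> are undefined outside that set.\<close>

lemma nn_integral_closed_loop_restrict:
  fixes A :: "nat \<Rightarrow> real^'n^'n" and B :: "nat \<Rightarrow> real^'m^'n"
  assumes \<pi>: "is_policy N \<pi>" and S: "pos_def S" and k: "k \<le> N"
    and F [measurable]: "F \<in> borel_measurable (lborel \<Otimes>\<^sub>M inputs k)"
  shows "(\<integral>\<^sup>+ \<omega>. F (fst \<omega>, restrict (snd \<omega>) {..<k}) \<partial>closed_loop N A B S \<pi>)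
    = (\<integral>\<^sup>+ \<omega>. F \<omega> \<partial>closed_loop k A B S \<pi>)"
  using k \<pi>
proof (induction N rule: dec_induct)
  case base
  have "(fst \<omega>, restrict (snd \<omega>) {..<k}) = \<omega>" if "\<omega> \<in> space (closed_loop k A B S \<pi>)" for \<omega>
    using that by (cases \<omega>) (simp add: closed_loop_def space_pair_measure space_PiM PiE_iff extensional_restrict)
  then show ?case
    by (intro nn_integral_cong arg_cong[where f = F])
next
  case (step n)
  have rm [measurable]: "(\<lambda>\<omega>. (fst \<omega>, restrict (snd \<omega>) {..<k}))
      \<in> measurable (lborel \<Otimes>\<^sub>M inputs j) (lborel \<Otimes>\<^sub>M (inputs k :: (nat \<Rightarrow> real^'m) measure))" if "k \<le> j" for j
    using that by (intro measurable_Pair measurable_fst measurable_compose[OF measurable_snd]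
        measurable_restrict_subset) auto
  have m: "(\<lambda>\<omega>. F (fst \<omega>, restrict (snd \<omega>) {..<k})) \<in> borel_measurable (lborel \<Otimes>\<^sub>M inputs j)" if "k \<le> j" for j
    using measurable_compose[OF rm[OF that] F] by simp
  have "(\<integral>\<^sup>+ \<omega>. F (fst \<omega>, restrict (snd \<omega>) {..<k}) \<partial>closed_loop (Suc n) A B S \<pi>)
      = (\<integral>\<^sup>+ \<omega>. \<integral>\<^sup>+ u. ennreal (\<pi> n (state A B \<omega> n) u)
          * F (fst \<omega>, restrict ((snd \<omega>)(n := u)) {..<k}) \<partial>lborel \<partial>closed_loop n A B S \<pi>)"
    using nn_integral_closed_loop_Suc[OF step.prems S m[of "Suc n"]] step.hyps by simp
  also have "\<dots> = (\<integral>\<^sup>+ \<omega>. F (fst \<omega>, restrict (snd \<omega>) {..<k}) \<partial>closed_loop n A B S \<pi>)"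
  proof (rule nn_integral_cong)
    fix \<omega> :: "(real^'n) \<times> (nat \<Rightarrow> real^'m)"
    have "restrict ((snd \<omega>)(n := u)) {..<k} = restrict (snd \<omega>) {..<k}" for u
      using step.hyps by (auto simp: restrict_def)
    moreover have "(\<lambda>u. ennreal (\<pi> n (state A B \<omega> n) u)) \<in> borel_measurable lborel"
      using measurable_policy[OF step.prems, of n "\<lambda>_. state A B \<omega> n" lborel "\<lambda>u. u"] by simp
    ultimately show "(\<integral>\<^sup>+ u. ennreal (\<pi> n (state A B \<omega> n) u)
        * F (fst \<omega>, restrict ((snd \<omega>)(n := u)) {..<k}) \<partial>lborel) = F (fst \<omega>, restrict (snd \<omega>) {..<k})"
      by (simp add: nn_integral_multc policy_total[OF step.prems])
  qed
  also have "\<dots> = (\<integral>\<^sup>+ \<omega>. F \<omega> \<partial>closed_loop k A B S \<pi>)"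
    by (rule step.IH) (rule is_policy_mono[OF step.prems], simp)
  finally show ?case .
qed

lemma nn_integral_closed_loop_0:
  fixes B :: "nat \<Rightarrow> real^'m^'n" and f :: "real^'n \<Rightarrow> ennreal"
  assumes "f \<in> borel_measurable borel"
  shows "(\<integral>\<^sup>+ \<omega>. f (fst \<omega>) \<partial>closed_loop 0 A B S \<pi>)
    = (\<integral>\<^sup>+ x. ennreal (gaussian_density 0 S x) * f x \<partial>lborel)"
proof -
  interpret P: product_sigma_finite "\<lambda>_::nat. lborel :: (real^'m) measure" ..
  interpret I: sigma_finite_measure "inputs 0 :: (nat \<Rightarrow> real^'m) measure"
    by (rule sigma_finite_inputs)
  note [measurable] = assms
  have "(\<integral>\<^sup>+ \<omega>. f (fst \<omega>) \<partial>closed_loop 0 A B S \<pi>)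
      = (\<integral>\<^sup>+ \<omega>. ennreal (gaussian_density 0 S (fst \<omega>)) * f (fst \<omega>) \<partial>(lborel \<Otimes>\<^sub>M (inputs 0 :: (nat \<Rightarrow> real^'m) measure)))"
    by (subst nn_integral_closed_loop) (auto simp: is_policy_def)
  also have "\<dots> = (\<integral>\<^sup>+ x. \<integral>\<^sup>+ h. ennreal (gaussian_density 0 S x) * f x \<partial>(inputs 0 :: (nat \<Rightarrow> real^'m) measure) \<partial>lborel)"
    by (subst I.nn_integral_fst[symmetric]) auto
  also have "\<dots> = (\<integral>\<^sup>+ x. ennreal (gaussian_density 0 S x) * f x \<partial>lborel)"
    by (simp add: PiM_empty)
  finally show ?thesis .
qed

lemma closed_loop_fst:
  fixes f :: "real^'n \<Rightarrow> ennreal"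
  assumes \<pi>: "is_policy N \<pi>" and S: "pos_def S" and [measurable]: "f \<in> borel_measurable borel"
  shows "(\<integral>\<^sup>+ \<omega>. f (fst \<omega>) \<partial>closed_loop N A B S \<pi>)
    = (\<integral>\<^sup>+ x. ennreal (gaussian_density 0 S x) * f x \<partial>lborel)"
  using nn_integral_closed_loop_restrict[OF \<pi> S, of 0 "\<lambda>\<omega>. f (fst \<omega>)" A B]
  by (simp add: nn_integral_closed_loop_0)

lemma prob_space_closed_loop:
  assumes \<pi>: "is_policy N \<pi>" and S: "pos_def S"
  shows "prob_space (closed_loop N A B S \<pi>)"
proof
  have "emeasure (closed_loop N A B S \<pi>) (space (closed_loop N A B S \<pi>))
      = (\<integral>\<^sup>+ \<omega>. 1 \<partial>closed_loop N A B S \<pi>)"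
    by simp
  also have "\<dots> = 1"
    using closed_loop_fst[OF \<pi> S, of "\<lambda>_. 1" A B] nn_integral_gaussian_density[OF S] by simp
  finally show "emeasure (closed_loop N A B S \<pi>) (space (closed_loop N A B S \<pi>)) = 1" .
qed

text \<open>The horizon is cut to k + 1, which makes u_k the last input; after it is replaced by its
  conditional integral, a function of x_k remains, and the horizon is extended again from k.\<close>

lemma closed_loop_disintegration:
  fixes A :: "nat \<Rightarrow> real^'n^'n" and B :: "nat \<Rightarrow> real^'m^'n"
  assumes \<pi>: "is_policy N \<pi>" and S: "pos_def S" and k: "k < N"
    and f [measurable]: "case_prod f \<in> borel_measurable (borel \<Otimes>\<^sub>M borel)"
  shows "(\<integral>\<^sup>+ \<omega>. f (state A B \<omega> k) (snd \<omega> k) \<partial>closed_loop N A B S \<pi>)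
    = (\<integral>\<^sup>+ \<omega>. \<integral>\<^sup>+ u. ennreal (\<pi> k (state A B \<omega> k) u) * f (state A B \<omega> k) u \<partial>lborel
        \<partial>closed_loop N A B S \<pi>)"
proof -
  have \<pi>k: "is_policy (Suc k) \<pi>"
    using is_policy_mono[OF \<pi>] k by simp
  have fm: "(\<lambda>\<omega>. f (g \<omega>) (h \<omega>)) \<in> borel_measurable M"
    if "g \<in> borel_measurable M" "h \<in> borel_measurable M" for g h and M :: "'c measure"
    using measurable_compose[OF measurable_Pair[OF that] f] by simp
  have m1: "(\<lambda>\<omega>. f (state A B \<omega> k) (snd \<omega> k)) \<in> borel_measurable (lborel \<Otimes>\<^sub>M inputs (Suc k))"
    by (intro fm measurable_state' measurable_input) auto
  define g where "g x = (\<integral>\<^sup>+ u. ennreal (\<pi> k x u) * f x u \<partial>lborel)" for x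
  have pm [measurable]: "(\<lambda>(x, u). \<pi> k x u) \<in> borel_measurable (borel \<Otimes>\<^sub>M borel)"
    by (rule policy_measurable[OF \<pi> k])
  have gm [measurable]: "g \<in> borel_measurable borel"
    unfolding g_def by measurable
  have m2: "(\<lambda>\<omega>. g (state A B \<omega> k)) \<in> borel_measurable (lborel \<Otimes>\<^sub>M inputs k)"
    by (rule measurable_compose[OF measurable_state' gm]) simp
  have st: "state A B (fst \<omega>, restrict (snd \<omega>) {..<j}) k = state A B \<omega> k" if "k \<le> j" for j \<omega>
    using state_restrict[OF that, of A B "fst \<omega>" "snd \<omega>"] by simp
  have "(\<integral>\<^sup>+ \<omega>. f (state A B \<omega> k) (snd \<omega> k) \<partial>closed_loop N A B S \<pi>)
      = (\<integral>\<^sup>+ \<omega>. f (state A B \<omega> k) (snd \<omega> k) \<partial>closed_loop (Suc k) A B S \<pi>)"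
    using nn_integral_closed_loop_restrict[OF \<pi> S _ m1] k by (simp add: st)
  also have "\<dots> = (\<integral>\<^sup>+ \<omega>. g (state A B \<omega> k) \<partial>closed_loop k A B S \<pi>)"
    unfolding g_def by (subst nn_integral_closed_loop_Suc[OF \<pi>k S m1]) (simp add: state_upd)
  also have "\<dots> = (\<integral>\<^sup>+ \<omega>. g (state A B \<omega> k) \<partial>closed_loop N A B S \<pi>)"
    using nn_integral_closed_loop_restrict[OF \<pi> S _ m2, where A = A and B = B] k by (simp add: st)
  finally show ?thesis
    unfolding g_def .
qed

lemma closed_loop_state_Suc:
  fixes A :: "nat \<Rightarrow> real^'n^'n" and B :: "nat \<Rightarrow> real^'m^'n"
  assumes \<pi>: "is_policy N \<pi>" and S: "pos_def S" and k: "k < N"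
    and [measurable]: "f \<in> borel_measurable borel"
  shows "(\<integral>\<^sup>+ \<omega>. f (state A B \<omega> (Suc k)) \<partial>closed_loop N A B S \<pi>)
    = (\<integral>\<^sup>+ \<omega>. \<integral>\<^sup>+ u. ennreal (\<pi> k (state A B \<omega> k) u) * f (A k *v state A B \<omega> k + B k *v u) \<partial>lborel
        \<partial>closed_loop N A B S \<pi>)"
  using closed_loop_disintegration[OF \<pi> S k, of "\<lambda>x u. f (A k *v x + B k *v u)" A B] by simp

section \<open>Entropy and relative entropy\<close>

lemma ext_integral_cong_AE: "AE x in M. f x = g x \<Longrightarrow> ext_integral M f = ext_integral M g"
  unfolding ext_integral_def
  by (intro arg_cong2[where f = "(-)"] arg_cong[where f = enn2ereal] nn_integral_cong_AE) auto

text \<open>An integrable summand cannot create infinity minus infinity: the negative part of the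
  sum is below that of \<open>f\<close>, hence has finite integral, while \<open>g\<close> may have
  infinite integral.\<close>

lemma ext_integral_add:
  assumes f: "integrable M f" and g [measurable]: "g \<in> borel_measurable M"
  shows "ext_integral M (\<lambda>x. ereal (f x) + enn2ereal (g x))
    = ereal (\<integral>x. f x \<partial>M) + enn2ereal (\<integral>\<^sup>+ x. g x \<partial>M)"
proof -
  have [measurable]: "f \<in> borel_measurable M"
    using f by auto
  let ?h = "\<lambda>x. ereal (f x) + enn2ereal (g x)"
  let ?p = "\<integral>\<^sup>+ x. e2ennreal (?h x) \<partial>M" and ?n = "\<integral>\<^sup>+ x. e2ennreal (- ?h x) \<partial>M"
  let ?fp = "\<integral>\<^sup>+ x. ennreal (f x) \<partial>M" and ?fn = "\<integral>\<^sup>+ x. ennreal (- f x) \<partial>M"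
  \<comment> \<open>The relation h = f + g between positive and negative parts, rearranged without
    subtraction so that nonnegative integrals can be added.\<close>
  have split: "e2ennreal (?h x) + ennreal (- f x) = e2ennreal (- ?h x) + (ennreal (f x) + g x)" for x
  proof (cases "g x")
    case (real r)
    have "ennreal (f x + r) + ennreal (- f x) = ennreal (- (f x + r)) + (ennreal (f x) + ennreal r)"
      using real(1)
      by (cases "0 \<le> f x"; cases "0 \<le> f x + r") (simp_all add: ennreal_neg flip: ennreal_plus)
    with real show ?thesis
      by (simp flip: ennreal.abs_eq)
  qed simp
  have le: "e2ennreal (- ?h x) \<le> ennreal (- f x)" for x
  proof -
    have "- ?h x \<le> ereal (- f x)"
      by (cases "enn2ereal (g x)") (use enn2ereal_nonneg[of "g x"] in auto)
    then show ?thesis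
      by (metis e2ennreal_ereal e2ennreal_mono)
  qed
  have fin: "?fp \<noteq> \<infinity>" "?fn \<noteq> \<infinity>"
    using f by (auto simp: real_integrable_def)
  then have "?n \<noteq> \<infinity>"
    using nn_integral_mono[of M "\<lambda>x. e2ennreal (- ?h x)" "\<lambda>x. ennreal (- f x)"] le
    by (auto simp: top_unique)
  with fin obtain a b c where abc: "?fp = ennreal a" "?fn = ennreal b" "?n = ennreal c" "0 \<le> a" "0 \<le> b" "0 \<le> c"
    by (cases ?fp; cases ?fn; cases ?n) auto
  have "?p + ?fn = ?n + (?fp + (\<integral>\<^sup>+ x. g x \<partial>M))"
    by (simp add: nn_integral_add[symmetric] split)
  then have eq: "?p + ennreal b = ennreal c + (ennreal a + (\<integral>\<^sup>+ x. g x \<partial>M))"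
    by (simp add: abc)
  have int: "(\<integral>x. f x \<partial>M) = a - b"
    using abc by (simp add: real_lebesgue_integral_def[OF f])
  have "enn2ereal ?p - ereal c = ereal (a - b) + enn2ereal (\<integral>\<^sup>+ x. g x \<partial>M)"
  proof (cases "\<integral>\<^sup>+ x. g x \<partial>M")
    case (real r)
    then have "?p + ennreal b = ennreal (c + (a + r))"
      using eq abc by simp
    then obtain p where p: "?p = ennreal p" "0 \<le> p"
      using ennreal_add_eq_top by (cases ?p) auto
    then have "p + b = c + (a + r)"
      using \<open>?p + ennreal b = ennreal (c + (a + r))\<close> abc real by (simp flip: ennreal_plus)
    then show ?thesis
      using p real by (simp add: enn2ereal_ennreal)
  next
    case top
    then have "?p = top"
      using eq by (simp add: ennreal_add_eq_top)
    then show ?thesis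
      by (simp add: top)
  qed
  then show ?thesis
    using abc int by (simp add: ext_integral_def enn2ereal_ennreal)
qed

text \<open>Integrand of relative entropy with b - a added. The correction has integral 0 for two
  probability densities and makes the integrand nonnegative pointwise, so the integral always
  exists.\<close>

definition kl_term :: "real \<Rightarrow> real \<Rightarrow> real" where
  "kl_term a b = a * ln (a / b) - a + b"

lemma measurable_kl_term [measurable (raw)]:
  assumes [measurable]: "f \<in> borel_measurable M" "g \<in> borel_measurable M"
  shows "(\<lambda>x. kl_term (f x) (g x)) \<in> borel_measurable M"
  unfolding kl_term_def by measurable

lemma kl_term_nonneg:
  assumes "0 \<le> a" "0 < b"
  shows "0 \<le> kl_term a b" and "kl_term a b = 0 \<Longrightarrow> a = b"
proof -
  have "0 \<le> kl_term a b \<and> (kl_term a b = 0 \<longrightarrow> a = b)"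
  proof (cases "a = 0")
    case False
    then have a: "0 < a"
      using assms by simp
    have eq: "kl_term a b = a * ((b / a - 1) - ln (b / a))"
      using a assms by (simp add: kl_term_def ln_div field_simps)
    have "ln (b / a) \<le> b / a - 1"
      using a assms by (intro ln_le_minus_one) simp
    moreover have "b / a = 1" if "ln (b / a) = b / a - 1"
      using a assms that by (intro ln_eq_minus_one) simp_all
    ultimately show ?thesis
      using a unfolding eq by (auto simp: zero_le_mult_iff)
  qed (use assms in \<open>simp add: kl_term_def\<close>)
  then show "0 \<le> kl_term a b" "kl_term a b = 0 \<Longrightarrow> a = b"
    by auto
qed

definition relative_entropy :: "(real^'m \<Rightarrow> real) \<Rightarrow> (real^'m \<Rightarrow> real) \<Rightarrow> ennreal" where
  "relative_entropy p q = (\<integral>\<^sup>+ u. ennreal (kl_term (p u) (q u)) \<partial>lborel)"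

text \<open>Here q plays the Gaussian with log-density c - s. Finiteness of the mean of s under p
  bounds the entropy of p from above; an entropy of -infinity corresponds to infinite relative
  entropy and is allowed.\<close>

lemma diff_entropy_eq:
  fixes p q s :: "real^'m \<Rightarrow> real"
  assumes p: "p \<in> borel_measurable borel" "\<And>u. 0 \<le> p u" "(\<integral>\<^sup>+ u. ennreal (p u) \<partial>lborel) = 1"
    and q: "q \<in> borel_measurable borel" "\<And>u. 0 < q u" "(\<integral>\<^sup>+ u. ennreal (q u) \<partial>lborel) = 1"
    and s: "s \<in> borel_measurable borel" "\<And>u. 0 \<le> s u" "\<And>u. ln (q u) = c - s u"
    and fin: "(\<integral>\<^sup>+ u. ennreal (p u) * ennreal (s u) \<partial>lborel) \<noteq> \<infinity>"
  shows "diff_entropy p = - (ereal (c - enn2real (\<integral>\<^sup>+ u. ennreal (p u) * ennreal (s u) \<partial>lborel))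
    + enn2ereal (relative_entropy p q))"
proof -
  note [measurable] = p(1) q(1) s(1)
  have prob: "integrable lborel f" "(\<integral>u. f u \<partial>lborel) = 1"
    if "f \<in> borel_measurable borel" "\<And>u. 0 \<le> f u" "(\<integral>\<^sup>+ u. ennreal (f u) \<partial>lborel) = 1" for f :: "real^'m \<Rightarrow> real"
    using that by (auto intro!: integrableI_nonneg simp: integral_eq_nn_integral)
  have ip: "integrable lborel p" "(\<integral>u. p u \<partial>lborel) = 1"
    using prob[of p] p by auto
  have iq: "integrable lborel q" "(\<integral>u. q u \<partial>lborel) = 1"
    using prob[of q] q by (auto intro: less_imp_le)
  have ps: "(\<integral>\<^sup>+ u. ennreal (p u) * ennreal (s u) \<partial>lborel) = (\<integral>\<^sup>+ u. ennreal (p u * s u) \<partial>lborel)"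
    using p(2) s(2) by (simp add: ennreal_mult)
  have ips: "integrable lborel (\<lambda>u. p u * s u)"
    using fin p(2) s(2) unfolding ps by (intro integrableI_nonneg) (auto simp: less_top)
  have ips2: "(\<integral>u. p u * s u \<partial>lborel) = enn2real (\<integral>\<^sup>+ u. ennreal (p u) * ennreal (s u) \<partial>lborel)"
    unfolding ps using p(2) s(2) by (intro integral_eq_nn_integral) auto
  \<comment> \<open>The integrable remainder of p ln p after \<open>kl_term\<close> is taken out; p
    - q compensates the correction in \<open>kl_term\<close>.\<close>
  define f where "f u = p u - q u + (c * p u - p u * s u)" for u
  have f: "integrable lborel f"
    unfolding f_def using ip iq ips by auto
  have fint: "(\<integral>u. f u \<partial>lborel) = c - enn2real (\<integral>\<^sup>+ u. ennreal (p u) * ennreal (s u) \<partial>lborel)"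
    unfolding f_def using ip iq ips by (simp flip: ips2)
  have "p u * ln (p u) = f u + kl_term (p u) (q u)" for u
  proof (cases "p u = 0")
    case False
    then have "ln (p u / q u) = ln (p u) - (c - s u)"
      using p(2)[of u] q(2)[of u] by (simp add: ln_div flip: s(3))
    then show ?thesis
      unfolding f_def kl_term_def by (simp only:) (simp add: algebra_simps)
  qed (simp add: f_def kl_term_def)
  then have "ereal (p u * ln (p u)) = ereal (f u) + enn2ereal (ennreal (kl_term (p u) (q u)))" for u
    using kl_term_nonneg(1)[of "p u" "q u"] p(2) q(2) by (simp add: enn2ereal_ennreal)
  then have "ext_integral lborel (\<lambda>u. ereal (p u * ln (p u)))
      = ereal (\<integral>u. f u \<partial>lborel) + enn2ereal (relative_entropy p q)"
    unfolding relative_entropy_def by (simp only:) (rule ext_integral_add[OF f], measurable)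
  then show ?thesis
    by (simp only: diff_entropy_def fint)
qed

lemma relative_entropy_refl: "(\<And>u. 0 < q u) \<Longrightarrow> relative_entropy q q = 0"
  by (simp add: relative_entropy_def kl_term_def less_imp_neq[THEN not_sym])

lemma relative_entropy_eq_0:
  assumes "relative_entropy p q = 0" "p \<in> borel_measurable borel" "q \<in> borel_measurable borel"
    "\<And>u. 0 \<le> p u" "\<And>u. 0 < q u"
  shows "AE u in lborel. p u = q u"
proof -
  note [measurable] = assms(2,3)
  have "AE u in lborel. ennreal (kl_term (p u) (q u)) = 0"
    using assms(1) unfolding relative_entropy_def by (subst (asm) nn_integral_0_iff_AE) auto
  then show ?thesis
  proof eventually_elim
    case (elim u)
    then show ?case
      using kl_term_nonneg[OF assms(4)[of u] assms(5)[of u]] by (auto simp: ennreal_eq_0_iff)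
  qed
qed

lemma distr_eq_density:
  fixes g :: "real^'n \<Rightarrow> ennreal"
  assumes T: "T \<in> borel_measurable M" and g: "g \<in> borel_measurable borel"
    and eq: "\<And>f. f \<in> borel_measurable borel \<Longrightarrow> (\<integral>\<^sup>+ x. f (T x) \<partial>M) = (\<integral>\<^sup>+ x. g x * f x \<partial>lborel)"
  shows "distr M lborel T = density lborel g"
proof (rule measure_eqI)
  fix X assume "X \<in> sets (distr M lborel T)"
  then have X: "X \<in> sets borel"
    by simp
  have T': "T \<in> measurable M lborel"
    using T by simp
  have "emeasure (distr M lborel T) X = (\<integral>\<^sup>+ x. indicator X x \<partial>distr M lborel T)"
    using X by simp
  also have "\<dots> = (\<integral>\<^sup>+ x. indicator X (T x) \<partial>M)"
    using X T' by (intro nn_integral_distr) auto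
  also have "\<dots> = (\<integral>\<^sup>+ x. g x * indicator X x \<partial>lborel)"
    using X by (intro eq) auto
  also have "\<dots> = emeasure (density lborel g) X"
    using X g by (simp add: emeasure_density)
  finally show "emeasure (distr M lborel T) X = emeasure (density lborel g) X" .
qed simp

lemma norm_matrix_vector_le: "norm (M *v x) \<le> onorm ((*v) M) * norm x" for M :: "real^'n^'m"
  by (rule onorm) simp

section \<open>The cost of a feasible policy\<close>

text \<open>Adds the boundary covariances. The terminal constraint enters as the matrix equation
  \<open>cov_N\<close>, so everything below is independent of how \<open>Q 0\<close> was
  found.\<close>

locale density_control = lyapunov N A B Q
  for N and A :: "nat \<Rightarrow> real^'n^'n" and B :: "nat \<Rightarrow> real^'m^'n" and Q +
  fixes e :: real and S S' :: "real^'n^'n"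
  assumes e: "0 < e" and S: "pos_def S" and S': "pos_def S'" and cov_N: "cov e S N = S'"
begin

abbreviation law :: "('n, 'm) policy \<Rightarrow> ((real^'n) \<times> (nat \<Rightarrow> real^'m)) measure" where
  "law \<equiv> closed_loop N A B S"

abbreviation opt :: "('n, 'm) policy" where
  "opt \<equiv> gaussian_policy e A B Q"

abbreviation V :: "nat \<Rightarrow> real^'m^'m" where
  "V k \<equiv> e *\<^sub>R input_cov B Q k"

definition log_norm :: "nat \<Rightarrow> real" where
  "log_norm k = - ln (sqrt ((2 * pi) ^ CARD('m) * det (V k)))"

text \<open>Negative log-density of the Gaussian policy up to the constant
  \<open>log_norm\<close>.\<close>

definition surprise :: "nat \<Rightarrow> real^'n \<Rightarrow> real^'m \<Rightarrow> real" where
  "surprise k x u = (u + gain k *v x) \<bullet> (matrix_inv (V k) *v (u + gain k *v x)) / 2"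

text \<open>Value function of the soft Bellman recursion without its additive constants, which are
  collected in the sum of \<open>log_norm\<close>.\<close>

definition potential :: "nat \<Rightarrow> real^'n \<Rightarrow> real" where
  "potential k x = x \<bullet> (matrix_inv (Q k) *v x) / 2"

lemma pos_def_V: "k < N \<Longrightarrow> pos_def (V k)"
  using pos_def_input_cov e by (rule pos_def_scaleR)

lemma opt_eq: "opt k x = gaussian_density (- (gain k *v x)) (V k)"
  by (simp add: gaussian_policy_def gain_def fun_eq_iff)

lemma opt_pos: "k < N \<Longrightarrow> 0 < opt k x u"
  by (simp add: opt_eq gaussian_density_pos pos_def_V)

lemma ln_opt: "k < N \<Longrightarrow> ln (opt k x u) = log_norm k - surprise k x u"
  using det_pos_def(1)[OF pos_def_V[of k]]
  by (simp add: opt_eq gaussian_density_def log_norm_def surprise_def ln_div)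

lemma surprise_nonneg: "k < N \<Longrightarrow> 0 \<le> surprise k x u"
  by (simp add: surprise_def pos_def_nonneg pos_def_matrix_inv pos_def_V)

lemma measurable_surprise [measurable (raw)]:
  assumes [measurable]: "f \<in> borel_measurable M" "g \<in> borel_measurable M"
  shows "(\<lambda>x. surprise k (f x) (g x)) \<in> borel_measurable M"
  unfolding surprise_def by measurable

lemma measurable_potential [measurable (raw)]:
  assumes [measurable]: "f \<in> borel_measurable M"
  shows "(\<lambda>x. potential k (f x)) \<in> borel_measurable M"
  unfolding potential_def by measurable

lemma measurable_opt [measurable (raw)]:
  assumes [measurable]: "f \<in> borel_measurable M" "g \<in> borel_measurable M"
  shows "(\<lambda>x. opt k (f x) (g x)) \<in> borel_measurable M"
  unfolding opt_eq gaussian_density_def by measurable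

lemma is_policy_opt: "is_policy N opt"
  unfolding is_policy_def
proof (intro allI impI conjI)
  fix k assume k: "k < N"
  show "(\<lambda>(x, u). opt k x u) \<in> borel_measurable (borel \<Otimes>\<^sub>M borel)"
    by measurable
  show "0 \<le> opt k x u" for x u
    using opt_pos[OF k] by (rule less_imp_le)
  show "(\<integral>\<^sup>+ u. ennreal (opt k x u) \<partial>lborel) = 1" for x
    unfolding opt_eq by (rule nn_integral_gaussian_density[OF pos_def_V[OF k]])
qed

lemma stage_cost:
  assumes k: "k < N"
  shows "(norm u)\<^sup>2 / 2 - e * surprise k x u = potential k x - potential (Suc k) (A k *v x + B k *v u)"
proof -
  have "e * surprise k x u = (u + gain k *v x) \<bullet> (matrix_inv (input_cov B Q k) *v (u + gain k *v x)) / 2"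
    using e pos_def_invertible[OF pos_def_input_cov[OF k]]
    by (simp add: surprise_def matrix_inv_scaleR flip: scaleR_matrix_vector_assoc)
  then show ?thesis
    using bellman[OF k, of u x] by (simp add: potential_def power2_norm_eq_inner field_simps)
qed

lemma measurable_law_state [measurable]:
  "k \<le> N \<Longrightarrow> (\<lambda>\<omega>. state A B \<omega> k) \<in> borel_measurable (law \<pi>)"
  using measurable_state'[of k N A B] by (simp cong: measurable_cong_sets)

lemma measurable_law_input [measurable]:
  "k < N \<Longrightarrow> (\<lambda>\<omega>. snd \<omega> k) \<in> borel_measurable (law \<pi>)"
  using measurable_input[of k N] by (simp cong: measurable_cong_sets)

text \<open>Agreement with the Gaussian policy is required only almost everywhere and only before
  time k, so that the lemma also serves an arbitrary optimal policy. Null sets of states do no harm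
  because the law of each state reached so far has a Lebesgue density.\<close>

lemma state_law:
  assumes \<pi>: "is_policy N \<pi>" and k: "k \<le> N"
    and eq: "\<And>j. j < k \<Longrightarrow> AE x in lborel. AE u in lborel. \<pi> j x u = opt j x u"
    and f: "f \<in> borel_measurable borel"
  shows "(\<integral>\<^sup>+ \<omega>. f (state A B \<omega> k) \<partial>law \<pi>)
    = (\<integral>\<^sup>+ x. ennreal (gaussian_density 0 (cov e S k) x) * f x \<partial>lborel)"
  using k eq f
proof (induction k arbitrary: f)
  case 0
  then show ?case
    using closed_loop_fst[OF \<pi> S] by simp
next
  case (Suc k)
  note [measurable] = \<open>f \<in> borel_measurable borel\<close>
  have k: "k < N"
    using Suc.prems by simp
  have [measurable]: "(\<lambda>(x, u). \<pi> k x u) \<in> borel_measurable (borel \<Otimes>\<^sub>M borel)"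
    by (rule policy_measurable[OF \<pi> k])
  have "(\<integral>\<^sup>+ \<omega>. f (state A B \<omega> (Suc k)) \<partial>law \<pi>)
      = (\<integral>\<^sup>+ \<omega>. \<integral>\<^sup>+ u. ennreal (\<pi> k (state A B \<omega> k) u) * f (A k *v state A B \<omega> k + B k *v u) \<partial>lborel \<partial>law \<pi>)"
    by (rule closed_loop_state_Suc[OF \<pi> S k]) measurable
  also have "\<dots> = (\<integral>\<^sup>+ x. ennreal (gaussian_density 0 (cov e S k) x) *
      (\<integral>\<^sup>+ u. ennreal (\<pi> k x u) * f (A k *v x + B k *v u) \<partial>lborel) \<partial>lborel)"
    using Suc.prems by (intro Suc.IH) auto
  also have "\<dots> = (\<integral>\<^sup>+ x. ennreal (gaussian_density 0 (cov e S k) x) *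
      (\<integral>\<^sup>+ u. ennreal (opt k x u) * f (A k *v x + B k *v u) \<partial>lborel) \<partial>lborel)"
  proof (rule nn_integral_cong_AE)
    show "AE x in lborel. ennreal (gaussian_density 0 (cov e S k) x) *
        (\<integral>\<^sup>+ u. ennreal (\<pi> k x u) * f (A k *v x + B k *v u) \<partial>lborel)
      = ennreal (gaussian_density 0 (cov e S k) x) *
        (\<integral>\<^sup>+ u. ennreal (opt k x u) * f (A k *v x + B k *v u) \<partial>lborel)"
      using Suc.prems(2)[of k]
      by (auto elim!: eventually_mono intro!: arg_cong2[where f = "(*)"] nn_integral_cong_AE)
  qed
  also have "\<dots> = (\<integral>\<^sup>+ x. ennreal (gaussian_density 0 (cov e S (Suc k)) x) * f x \<partial>lborel)"
    unfolding opt_eq cov.simps using k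
    by (intro nn_integral_gaussian_propagate[OF pos_def_cov[OF S e] pos_def_V[OF k] invertible_A[OF k] refl]) auto
  finally show ?case .
qed

context
  fixes \<pi> :: "('n, 'm) policy"
  assumes \<pi>: "is_policy N \<pi>"
    and energy: "(\<integral>\<^sup>+ \<omega>. ennreal (\<Sum>k<N. (norm (snd \<omega> k))\<^sup>2 / 2) \<partial>law \<pi>) \<noteq> \<infinity>"
begin

interpretation law: prob_space "law \<pi>"
  by (rule prob_space_closed_loop[OF \<pi> S])

lemma input_square_integrable:
  assumes k: "k < N"
  shows "integrable (law \<pi>) (\<lambda>\<omega>. (norm (snd \<omega> k))\<^sup>2)"
proof (rule integrableI_nonneg)
  have "(\<integral>\<^sup>+ \<omega>. ennreal ((norm (snd \<omega> k))\<^sup>2 / 2) \<partial>law \<pi>)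
      \<le> (\<integral>\<^sup>+ \<omega>. ennreal (\<Sum>k<N. (norm (snd \<omega> k))\<^sup>2 / 2) \<partial>law \<pi>)"
    using k by (intro nn_integral_mono ennreal_leI member_le_sum[of k _ "\<lambda>k. (norm (snd _ k))\<^sup>2 / 2"]) auto
  then have fin: "(\<integral>\<^sup>+ \<omega>. ennreal ((norm (snd \<omega> k))\<^sup>2 / 2) \<partial>law \<pi>) < \<infinity>"
    using energy by (auto simp: less_top top_unique)
  have "(\<integral>\<^sup>+ \<omega>. ennreal ((norm (snd \<omega> k))\<^sup>2) \<partial>law \<pi>)
      = (\<integral>\<^sup>+ \<omega>. ennreal 2 * ennreal ((norm (snd \<omega> k))\<^sup>2 / 2) \<partial>law \<pi>)"
    by (intro nn_integral_cong) (subst ennreal_mult[symmetric], auto)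
  also have "\<dots> = ennreal 2 * (\<integral>\<^sup>+ \<omega>. ennreal ((norm (snd \<omega> k))\<^sup>2 / 2) \<partial>law \<pi>)"
    using k by (intro nn_integral_cmult) measurable
  also have "\<dots> < \<infinity>"
    using fin by (simp add: ennreal_mult_less_top)
  finally show "(\<integral>\<^sup>+ \<omega>. ennreal ((norm (snd \<omega> k))\<^sup>2) \<partial>law \<pi>) < \<infinity>" .
qed (use k in auto)

lemma state_square_integrable: "k \<le> N \<Longrightarrow> integrable (law \<pi>) (\<lambda>\<omega>. (norm (state A B \<omega> k))\<^sup>2)"
proof (induction k)
  case 0
  have "(\<integral>\<^sup>+ \<omega>. ennreal ((norm (fst \<omega>))\<^sup>2) \<partial>law \<pi>)
      = (\<integral>\<^sup>+ x. ennreal (gaussian_density 0 S x) * ennreal ((norm x)\<^sup>2) \<partial>lborel)"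
    by (rule closed_loop_fst[OF \<pi> S]) measurable
  also have "\<dots> < \<infinity>"
    using gaussian_second_moment_finite[OF S] S by (simp add: ennreal_mult)
  finally show ?case
    using measurable_law_state[of 0] by (intro integrableI_nonneg) auto
next
  case (Suc k)
  then have k: "k < N"
    by simp
  let ?a = "onorm ((*v) (A k))" and ?b = "onorm ((*v) (B k))"
  let ?x = "\<lambda>\<omega>. norm (state A B \<omega> k)" and ?u = "\<lambda>\<omega>. norm (snd \<omega> k)"
  have "integrable (law \<pi>) (\<lambda>\<omega>. 2 * ?a\<^sup>2 * (?x \<omega>)\<^sup>2 + 2 * ?b\<^sup>2 * (?u \<omega>)\<^sup>2)"
    using Suc input_square_integrable[OF k] by auto
  then show ?case
  proof (rule Bochner_Integration.integrable_bound)
    show "(\<lambda>\<omega>. (norm (state A B \<omega> (Suc k)))\<^sup>2) \<in> borel_measurable (law \<pi>)"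
      using measurable_law_state[OF Suc.prems] by measurable
    have "norm ((norm (state A B \<omega> (Suc k)))\<^sup>2) \<le> norm (2 * ?a\<^sup>2 * (?x \<omega>)\<^sup>2 + 2 * ?b\<^sup>2 * (?u \<omega>)\<^sup>2)" for \<omega>
    proof -
      have "norm (state A B \<omega> (Suc k)) \<le> ?a * ?x \<omega> + ?b * ?u \<omega>"
        using norm_triangle_ineq[of "A k *v state A B \<omega> k" "B k *v snd \<omega> k"]
          norm_matrix_vector_le[of "A k" "state A B \<omega> k"] norm_matrix_vector_le[of "B k" "snd \<omega> k"]
        by simp
      then have "(norm (state A B \<omega> (Suc k)))\<^sup>2 \<le> (?a * ?x \<omega> + ?b * ?u \<omega>)\<^sup>2"
        by (intro power_mono) auto
      also have "\<dots> \<le> 2 * ?a\<^sup>2 * (?x \<omega>)\<^sup>2 + 2 * ?b\<^sup>2 * (?u \<omega>)\<^sup>2"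
        using sum_squares_bound[of "?a * ?x \<omega>" "?b * ?u \<omega>"] by (simp add: power2_sum power_mult_distrib)
      finally show ?thesis
        by simp
    qed
    then show "AE \<omega> in law \<pi>. norm ((norm (state A B \<omega> (Suc k)))\<^sup>2)
        \<le> norm (2 * ?a\<^sup>2 * (?x \<omega>)\<^sup>2 + 2 * ?b\<^sup>2 * (?u \<omega>)\<^sup>2)"
      by simp
  qed
qed

lemma potential_integrable:
  assumes k: "k \<le> N"
  shows "integrable (law \<pi>) (\<lambda>\<omega>. potential j (state A B \<omega> k))"
proof (rule Bochner_Integration.integrable_bound)
  let ?c = "onorm ((*v) (matrix_inv (Q j)))"
  show "integrable (law \<pi>) (\<lambda>\<omega>. ?c * (norm (state A B \<omega> k))\<^sup>2)"
    using state_square_integrable[OF k] by auto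
  show "(\<lambda>\<omega>. potential j (state A B \<omega> k)) \<in> borel_measurable (law \<pi>)"
    using measurable_law_state[OF k] by measurable
  have "norm (potential j x) \<le> norm (?c * (norm x)\<^sup>2)" for x
  proof -
    have "\<bar>x \<bullet> (matrix_inv (Q j) *v x)\<bar> \<le> norm x * norm (matrix_inv (Q j) *v x)"
      by (rule Cauchy_Schwarz_ineq2)
    also have "\<dots> \<le> norm x * (?c * norm x)"
      by (intro mult_left_mono norm_matrix_vector_le) auto
    finally have "\<bar>x \<bullet> (matrix_inv (Q j) *v x)\<bar> \<le> ?c * (norm x)\<^sup>2"
      by (simp add: power2_eq_square mult_ac)
    moreover have "0 \<le> ?c * (norm x)\<^sup>2"
      by (intro mult_nonneg_nonneg onorm_pos_le) auto
    ultimately show ?thesis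
      by (simp add: potential_def)
  qed
  then show "AE \<omega> in law \<pi>. norm (potential j (state A B \<omega> k)) \<le> norm (?c * (norm (state A B \<omega> k))\<^sup>2)"
    by simp
qed

text \<open>\<open>stage_cost\<close>, solved for the surprise, expresses it by the energy and two
  potentials, all integrable.\<close>

lemma surprise_integrable:
  assumes k: "k < N"
  shows "integrable (law \<pi>) (\<lambda>\<omega>. surprise k (state A B \<omega> k) (snd \<omega> k))"
proof -
  have "integrable (law \<pi>) (\<lambda>\<omega>. ((norm (snd \<omega> k))\<^sup>2 / 2 - potential k (state A B \<omega> k)
      + potential (Suc k) (state A B \<omega> (Suc k))) / e)"
    using k input_square_integrable potential_integrable[of k k] potential_integrable[of "Suc k" "Suc k"] by auto
  moreover have "((norm (snd \<omega> k))\<^sup>2 / 2 - potential k (state A B \<omega> k)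
      + potential (Suc k) (state A B \<omega> (Suc k))) / e = surprise k (state A B \<omega> k) (snd \<omega> k)" for \<omega>
    using stage_cost[OF k, of "snd \<omega> k" "state A B \<omega> k"] e by (simp add: field_simps)
  ultimately show ?thesis
    by simp
qed

text \<open>Conditional expectation of the surprise given the state. It takes extended values
  because finite energy makes it finite only for almost every state.\<close>

definition mean_surprise :: "nat \<Rightarrow> real^'n \<Rightarrow> ennreal" where
  "mean_surprise k x = (\<integral>\<^sup>+ u. ennreal (\<pi> k x u) * ennreal (surprise k x u) \<partial>lborel)"

lemma mean_surprise:
  assumes k: "k < N"
  defines "r \<equiv> \<lambda>\<omega>. mean_surprise k (state A B \<omega> k)"
  shows "AE \<omega> in law \<pi>. r \<omega> \<noteq> \<infinity>"
    and "integrable (law \<pi>) (\<lambda>\<omega>. enn2real (r \<omega>))"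
    and "(\<integral>\<omega>. enn2real (r \<omega>) \<partial>law \<pi>) = (\<integral>\<omega>. surprise k (state A B \<omega> k) (snd \<omega> k) \<partial>law \<pi>)"
proof -
  have [measurable]: "(\<lambda>(x, u). \<pi> k x u) \<in> borel_measurable (borel \<Otimes>\<^sub>M borel)"
    by (rule policy_measurable[OF \<pi> k])
  have [measurable]: "(\<lambda>\<omega>. state A B \<omega> k) \<in> borel_measurable (law \<pi>)" "(\<lambda>\<omega>. snd \<omega> k) \<in> borel_measurable (law \<pi>)"
    using k by auto
  have "mean_surprise k \<in> borel_measurable borel"
    unfolding mean_surprise_def by measurable
  from measurable_compose[OF measurable_law_state this, of k]
  have [measurable]: "r \<in> borel_measurable (law \<pi>)"
    using k by (simp add: r_def)
  have eq: "(\<integral>\<^sup>+ \<omega>. r \<omega> \<partial>law \<pi>) = (\<integral>\<^sup>+ \<omega>. ennreal (surprise k (state A B \<omega> k) (snd \<omega> k)) \<partial>law \<pi>)"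
    unfolding r_def mean_surprise_def
    by (rule closed_loop_disintegration[OF \<pi> S k, symmetric]) measurable
  also have "\<dots> = ennreal (\<integral>\<omega>. surprise k (state A B \<omega> k) (snd \<omega> k) \<partial>law \<pi>)"
    using surprise_integrable[OF k] surprise_nonneg[OF k] by (intro nn_integral_eq_integral) auto
  finally have eq: "(\<integral>\<^sup>+ \<omega>. r \<omega> \<partial>law \<pi>) = ennreal (\<integral>\<omega>. surprise k (state A B \<omega> k) (snd \<omega> k) \<partial>law \<pi>)" .
  then show fin: "AE \<omega> in law \<pi>. r \<omega> \<noteq> \<infinity>"
    by (intro nn_integral_PInf_AE) auto
  have eq2: "(\<integral>\<^sup>+ \<omega>. ennreal (enn2real (r \<omega>)) \<partial>law \<pi>) = (\<integral>\<^sup>+ \<omega>. r \<omega> \<partial>law \<pi>)"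
    using fin by (intro nn_integral_cong_AE) (auto simp: less_top elim: eventually_mono)
  show "integrable (law \<pi>) (\<lambda>\<omega>. enn2real (r \<omega>))"
    by (rule integrableI_nonneg) (auto simp: eq eq2)
  show "(\<integral>\<omega>. enn2real (r \<omega>) \<partial>law \<pi>) = (\<integral>\<omega>. surprise k (state A B \<omega> k) (snd \<omega> k) \<partial>law \<pi>)"
    using surprise_nonneg[OF k]
    by (subst integral_eq_nn_integral) (auto simp: eq eq2 intro!: integral_nonneg)
qed

text \<open>Almost surely each stage is an integrable \<open>f k\<close> plus a nonnegative
  \<open>g k\<close>, which carries the relative entropy. In expectation the mean surprise may be
  replaced by the surprise, and then the potentials telescope.\<close>

lemma cost_decomposition:
  "cost N e A B S \<pi> = ereal ((\<integral>\<omega>. potential 0 (fst \<omega>) \<partial>law \<pi>)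
      - (\<integral>\<omega>. potential N (state A B \<omega> N) \<partial>law \<pi>) + e * (\<Sum>k<N. log_norm k))
    + enn2ereal (\<integral>\<^sup>+ \<omega>. (\<Sum>k<N. ennreal e * relative_entropy (\<pi> k (state A B \<omega> k)) (opt k (state A B \<omega> k))) \<partial>law \<pi>)"
proof -
  let ?x = "\<lambda>\<omega> k. state A B \<omega> k" and ?u = "\<lambda>\<omega> k. snd \<omega> k"
  define f where "f k \<omega> = (norm (?u \<omega> k))\<^sup>2 / 2 + e * (log_norm k - enn2real (mean_surprise k (?x \<omega> k)))" for k \<omega>
  define g where "g k = (\<lambda>\<omega>. ennreal e * relative_entropy (\<pi> k (?x \<omega> k)) (opt k (?x \<omega> k)))" for k
  have gm [measurable]: "g k \<in> borel_measurable (law \<pi>)" if k: "k < N" for k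
  proof -
    have [measurable]: "(\<lambda>(x, u). \<pi> k x u) \<in> borel_measurable (borel \<Otimes>\<^sub>M borel)"
      by (rule policy_measurable[OF \<pi> k])
    have "(\<lambda>x. ennreal e * relative_entropy (\<pi> k x) (opt k x)) \<in> borel_measurable borel"
      unfolding relative_entropy_def by measurable
    from measurable_compose[OF measurable_law_state this, of k] show ?thesis
      using k by (simp add: g_def)
  qed
  have fi: "integrable (law \<pi>) (f k)" if k: "k < N" for k
    unfolding f_def using input_square_integrable[OF k] mean_surprise(2)[OF k] by auto
  have stage: "AE \<omega> in law \<pi>. ereal ((norm (?u \<omega> k))\<^sup>2 / 2) - ereal e * diff_entropy (\<pi> k (?x \<omega> k))
      = ereal (f k \<omega>) + enn2ereal (g k \<omega>)" if k: "k < N" for k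
    using mean_surprise(1)[OF k]
  proof eventually_elim
    case (elim \<omega>)
    have "(\<lambda>u. \<pi> k x u) \<in> borel_measurable borel" for x
      using measurable_policy[OF \<pi> k, of "\<lambda>_. x" borel "\<lambda>u. u"] by simp
    then have "diff_entropy (\<pi> k (?x \<omega> k)) = - (ereal (log_norm k - enn2real (mean_surprise k (?x \<omega> k)))
        + enn2ereal (relative_entropy (\<pi> k (?x \<omega> k)) (opt k (?x \<omega> k))))"
      unfolding mean_surprise_def using elim k
      by (intro diff_entropy_eq)
        (auto simp: policy_nonneg[OF \<pi> k] policy_total[OF \<pi> k] policy_total[OF is_policy_opt k] opt_pos ln_opt
          surprise_nonneg mean_surprise_def)
    then show ?case
      \<comment> \<open>Infinite relative entropy is a case of its own: the entropy is then
        -infinity and both sides are infinite.\<close>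
      using e by (cases "relative_entropy (\<pi> k (?x \<omega> k)) (opt k (?x \<omega> k))")
        (auto simp: f_def g_def enn2ereal_ennreal ennreal_mult_top algebra_simps simp flip: ennreal_mult)
  qed
  have "AE \<omega> in law \<pi>. \<forall>k<N. ereal ((norm (?u \<omega> k))\<^sup>2 / 2) - ereal e * diff_entropy (\<pi> k (?x \<omega> k))
      = ereal (f k \<omega>) + enn2ereal (g k \<omega>)"
    using stage by (simp add: AE_all_countable AE_impI)
  then have "AE \<omega> in law \<pi>. (\<Sum>k<N. ereal ((norm (?u \<omega> k))\<^sup>2 / 2) - ereal e * diff_entropy (\<pi> k (?x \<omega> k)))
      = ereal (\<Sum>k<N. f k \<omega>) + enn2ereal (\<Sum>k<N. g k \<omega>)"
  proof eventually_elim
    case (elim \<omega>)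
    then have "(\<Sum>k<N. ereal ((norm (?u \<omega> k))\<^sup>2 / 2) - ereal e * diff_entropy (\<pi> k (?x \<omega> k)))
        = (\<Sum>k<N. ereal (f k \<omega>) + enn2ereal (g k \<omega>))"
      by (intro sum.cong) auto
    then show ?case
      by (simp only: sum.distrib sum_ereal sum_enn2ereal zero_le)
  qed
  then have "cost N e A B S \<pi> = ext_integral (law \<pi>) (\<lambda>\<omega>. ereal (\<Sum>k<N. f k \<omega>) + enn2ereal (\<Sum>k<N. g k \<omega>))"
    unfolding cost_def using energy by (simp add: ext_integral_cong_AE)
  also have "\<dots> = ereal (\<integral>\<omega>. (\<Sum>k<N. f k \<omega>) \<partial>law \<pi>) + enn2ereal (\<integral>\<^sup>+ \<omega>. (\<Sum>k<N. g k \<omega>) \<partial>law \<pi>)"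
    using fi gm by (intro ext_integral_add) auto
  also have "(\<integral>\<omega>. (\<Sum>k<N. f k \<omega>) \<partial>law \<pi>) = (\<Sum>k<N. \<integral>\<omega>. f k \<omega> \<partial>law \<pi>)"
    using fi by (intro Bochner_Integration.integral_sum) auto
  also have "\<dots> = (\<Sum>k<N. (\<integral>\<omega>. potential k (?x \<omega> k) \<partial>law \<pi>)
      - (\<integral>\<omega>. potential (Suc k) (?x \<omega> (Suc k)) \<partial>law \<pi>) + e * log_norm k)"
  proof (intro sum.cong refl)
    fix k assume "k \<in> {..<N}"
    then have k: "k < N"
      by simp
    have "(\<integral>\<omega>. f k \<omega> \<partial>law \<pi>) = (\<integral>\<omega>. (norm (?u \<omega> k))\<^sup>2 / 2 \<partial>law \<pi>)
        + e * (log_norm k - (\<integral>\<omega>. surprise k (?x \<omega> k) (?u \<omega> k) \<partial>law \<pi>))"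
      unfolding f_def using input_square_integrable[OF k] mean_surprise(2,3)[OF k]
      by (simp add: law.prob_space)
    also have "\<dots> = (\<integral>\<omega>. (norm (?u \<omega> k))\<^sup>2 / 2 - e * surprise k (?x \<omega> k) (?u \<omega> k) \<partial>law \<pi>) + e * log_norm k"
      using input_square_integrable[OF k] surprise_integrable[OF k] by (simp add: right_diff_distrib)
    also have "\<dots> = (\<integral>\<omega>. potential k (?x \<omega> k) - potential (Suc k) (?x \<omega> (Suc k)) \<partial>law \<pi>) + e * log_norm k"
      by (simp add: stage_cost[OF k])
    also have "\<dots> = (\<integral>\<omega>. potential k (?x \<omega> k) \<partial>law \<pi>)
      - (\<integral>\<omega>. potential (Suc k) (?x \<omega> (Suc k)) \<partial>law \<pi>) + e * log_norm k"
      using potential_integrable[of k k] potential_integrable[of "Suc k" "Suc k"] k by simp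
    finally show "(\<integral>\<omega>. f k \<omega> \<partial>law \<pi>) = (\<integral>\<omega>. potential k (?x \<omega> k) \<partial>law \<pi>)
      - (\<integral>\<omega>. potential (Suc k) (?x \<omega> (Suc k)) \<partial>law \<pi>) + e * log_norm k" .
  qed
  also have "\<dots> = (\<integral>\<omega>. potential 0 (fst \<omega>) \<partial>law \<pi>)
      - (\<integral>\<omega>. potential N (?x \<omega> N) \<partial>law \<pi>) + e * (\<Sum>k<N. log_norm k)"
    using sum_lessThan_telescope'[of "\<lambda>k. \<integral>\<omega>. potential k (?x \<omega> k) \<partial>law \<pi>" N]
    by (simp add: sum.distrib sum_distrib_left)
  finally show ?thesis
    unfolding g_def .
qed

end

text \<open>Written with the two prescribed Gaussian laws instead of a policy, so that it is visibly
  the same number for all feasible policies.\<close>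

definition opt_value :: real where
  "opt_value = (\<integral>x. potential 0 x \<partial>density lborel (\<lambda>x. ennreal (gaussian_density 0 S x)))
    - (\<integral>x. potential N x \<partial>density lborel (\<lambda>x. ennreal (gaussian_density 0 S' x)))
    + e * (\<Sum>k<N. log_norm k)"

lemma cost_feasible:
  assumes feas: "feasible N A B S S' \<pi>"
    and energy: "(\<integral>\<^sup>+ \<omega>. ennreal (\<Sum>k<N. (norm (snd \<omega> k))\<^sup>2 / 2) \<partial>law \<pi>) \<noteq> \<infinity>"
  shows "cost N e A B S \<pi> = ereal opt_value + enn2ereal (\<integral>\<^sup>+ \<omega>. (\<Sum>k<N. ennreal e
    * relative_entropy (\<pi> k (state A B \<omega> k)) (opt k (state A B \<omega> k))) \<partial>law \<pi>)"
proof -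
  have \<pi>: "is_policy N \<pi>" and xN: "distr (law \<pi>) lborel (\<lambda>\<omega>. state A B \<omega> N)
      = density lborel (\<lambda>x. ennreal (gaussian_density 0 S' x))"
    using feas by (auto simp: feasible_def distributed_def)
  have fst: "fst \<in> measurable (law \<pi>) lborel"
    using measurable_law_state[of 0] by simp
  have x0: "distr (law \<pi>) lborel fst = density lborel (\<lambda>x. ennreal (gaussian_density 0 S x))"
    using fst closed_loop_fst[OF \<pi> S] by (intro distr_eq_density) auto
  have "(\<integral>\<omega>. potential 0 (fst \<omega>) \<partial>law \<pi>) = (\<integral>x. potential 0 x \<partial>distr (law \<pi>) lborel fst)"
    by (rule integral_distr[symmetric, OF fst]) measurable
  moreover have "(\<integral>\<omega>. potential N (state A B \<omega> N) \<partial>law \<pi>)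
      = (\<integral>x. potential N x \<partial>distr (law \<pi>) lborel (\<lambda>\<omega>. state A B \<omega> N))"
    by (rule integral_distr[symmetric]) (use measurable_law_state[of N] in auto)
  ultimately show ?thesis
    unfolding cost_decomposition[OF \<pi> energy] opt_value_def x0 xN by simp
qed

text \<open>By convention the cost is infinite if the energy is, so this has to be settled before
  the decomposition applies to the Gaussian policy. Given x, the input is a centred Gaussian around
  \<open>- (gain k *v x)\<close>, and x itself is Gaussian with finite second moment.\<close>

lemma energy_opt:
  "(\<integral>\<^sup>+ \<omega>. ennreal (\<Sum>k<N. (norm (snd \<omega> k))\<^sup>2 / 2) \<partial>law opt) \<noteq> \<infinity>"
proof -
  have fin: "(\<integral>\<^sup>+ \<omega>. ennreal ((norm (snd \<omega> k))\<^sup>2 / 2) \<partial>law opt) < \<infinity>" if k: "k < N" for k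
  proof -
    define C where "C = (\<integral>\<^sup>+ v. ennreal (gaussian_density 0 (V k) v * (norm v)\<^sup>2) \<partial>lborel)"
    have C: "C < \<infinity>"
      unfolding C_def by (rule gaussian_second_moment_finite[OF pos_def_V[OF k]])
    let ?g = "onorm ((*v) (gain k))"
    have inner: "(\<integral>\<^sup>+ u. ennreal (opt k x u) * ennreal ((norm u)\<^sup>2 / 2) \<partial>lborel)
        \<le> C + ennreal (?g\<^sup>2) * ennreal ((norm x)\<^sup>2)" for x
    proof -
      have le: "(norm u)\<^sup>2 / 2 \<le> (norm (u + gain k *v x))\<^sup>2 + ?g\<^sup>2 * (norm x)\<^sup>2" for u
      proof -
        have "norm u \<le> norm (u + gain k *v x) + ?g * norm x"
          using norm_triangle_ineq4[of "u + gain k *v x" "gain k *v x"] norm_matrix_vector_le[of "gain k" x]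
          by simp
        then have "(norm u)\<^sup>2 \<le> (norm (u + gain k *v x) + ?g * norm x)\<^sup>2"
          by (intro power_mono) auto
        also have "\<dots> \<le> 2 * (norm (u + gain k *v x))\<^sup>2 + 2 * (?g * norm x)\<^sup>2"
          using sum_squares_bound[of "norm (u + gain k *v x)" "?g * norm x"] by (simp add: power2_sum)
        finally show ?thesis
          by (simp add: power_mult_distrib)
      qed
      have "(\<integral>\<^sup>+ u. ennreal (opt k x u) * ennreal ((norm u)\<^sup>2 / 2) \<partial>lborel)
          \<le> (\<integral>\<^sup>+ u. ennreal (gaussian_density 0 (V k) (u + gain k *v x) * (norm (u + gain k *v x))\<^sup>2)
            + ennreal (?g\<^sup>2 * (norm x)\<^sup>2) * ennreal (opt k x u) \<partial>lborel)"
      proof (rule nn_integral_mono)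
        fix u
        have "opt k x u * ((norm u)\<^sup>2 / 2) \<le> opt k x u * ((norm (u + gain k *v x))\<^sup>2 + ?g\<^sup>2 * (norm x)\<^sup>2)"
          using le[of u] opt_pos[OF k, of x u] by (intro mult_left_mono) auto
        then show "ennreal (opt k x u) * ennreal ((norm u)\<^sup>2 / 2)
          \<le> ennreal (gaussian_density 0 (V k) (u + gain k *v x) * (norm (u + gain k *v x))\<^sup>2)
            + ennreal (?g\<^sup>2 * (norm x)\<^sup>2) * ennreal (opt k x u)"
          using opt_pos[OF k, of x u]
          by (simp add: opt_eq gaussian_density_translate[of "- _"] distrib_left mult_ac
              flip: ennreal_mult ennreal_plus)
      qed
      also have "\<dots> = (\<integral>\<^sup>+ u. ennreal (gaussian_density 0 (V k) (u + gain k *v x) * (norm (u + gain k *v x))\<^sup>2) \<partial>lborel)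
          + ennreal (?g\<^sup>2 * (norm x)\<^sup>2) * (\<integral>\<^sup>+ u. ennreal (opt k x u) \<partial>lborel)"
        by (simp add: nn_integral_add nn_integral_cmult)
      also have "(\<integral>\<^sup>+ u. ennreal (gaussian_density 0 (V k) (u + gain k *v x) * (norm (u + gain k *v x))\<^sup>2) \<partial>lborel) = C"
        unfolding C_def by (rule nn_integral_translation) measurable
      finally show ?thesis
        by (simp add: policy_total[OF is_policy_opt k] ennreal_mult)
    qed
    have "(\<integral>\<^sup>+ \<omega>. ennreal ((norm (snd \<omega> k))\<^sup>2 / 2) \<partial>law opt)
        = (\<integral>\<^sup>+ \<omega>. \<integral>\<^sup>+ u. ennreal (opt k (state A B \<omega> k) u) * ennreal ((norm u)\<^sup>2 / 2) \<partial>lborel \<partial>law opt)"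
      by (rule closed_loop_disintegration[OF is_policy_opt S k]) measurable
    also have "\<dots> \<le> (\<integral>\<^sup>+ \<omega>. C + ennreal (?g\<^sup>2) * ennreal ((norm (state A B \<omega> k))\<^sup>2) \<partial>law opt)"
      by (intro nn_integral_mono inner)
    also have "\<dots> = (\<integral>\<^sup>+ x. ennreal (gaussian_density 0 (cov e S k) x) * (C + ennreal (?g\<^sup>2) * ennreal ((norm x)\<^sup>2)) \<partial>lborel)"
      using k by (intro state_law[OF is_policy_opt]) auto
    also have "\<dots> = (\<integral>\<^sup>+ x. C * ennreal (gaussian_density 0 (cov e S k) x)
        + ennreal (?g\<^sup>2) * ennreal (gaussian_density 0 (cov e S k) x * (norm x)\<^sup>2) \<partial>lborel)"
      using pos_def_cov[OF S e, of k] k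
      by (intro nn_integral_cong) (simp add: distrib_left ennreal_mult mult_ac)
    also have "\<dots> = C * (\<integral>\<^sup>+ x. ennreal (gaussian_density 0 (cov e S k) x) \<partial>lborel)
        + ennreal (?g\<^sup>2) * (\<integral>\<^sup>+ x. ennreal (gaussian_density 0 (cov e S k) x * (norm x)\<^sup>2) \<partial>lborel)"
      by (simp add: nn_integral_add nn_integral_cmult)
    also have "\<dots> < \<infinity>"
      using C k gaussian_second_moment_finite[OF pos_def_cov[OF S e, of k]]
      by (simp add: nn_integral_gaussian_density pos_def_cov[OF S e] ennreal_mult_less_top)
    finally show ?thesis .
  qed
  have "(\<integral>\<^sup>+ \<omega>. ennreal (\<Sum>k<N. (norm (snd \<omega> k))\<^sup>2 / 2) \<partial>law opt)
      = (\<integral>\<^sup>+ \<omega>. (\<Sum>k<N. ennreal ((norm (snd \<omega> k))\<^sup>2 / 2)) \<partial>law opt)"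
    by (intro nn_integral_cong) (simp add: sum_ennreal)
  also have "\<dots> = (\<Sum>k<N. \<integral>\<^sup>+ \<omega>. ennreal ((norm (snd \<omega> k))\<^sup>2 / 2) \<partial>law opt)"
    by (rule nn_integral_sum) measurable
  also have "\<dots> \<noteq> \<infinity>"
    using fin by (simp add: less_top)
  finally show ?thesis .
qed

lemma feasible_opt: "feasible N A B S S' opt"
proof -
  have "distr (law opt) lborel (\<lambda>\<omega>. state A B \<omega> N) = density lborel (\<lambda>x. ennreal (gaussian_density 0 S' x))"
    using state_law[OF is_policy_opt, of N] by (intro distr_eq_density) (auto simp: cov_N)
  then show ?thesis
    using measurable_law_state[of N opt] by (simp add: feasible_def is_policy_opt distributed_def)
qed

lemma cost_opt: "cost N e A B S opt = ereal opt_value"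
proof -
  have "(\<integral>\<^sup>+ \<omega>. (\<Sum>k<N. ennreal e * relative_entropy (opt k (state A B \<omega> k)) (opt k (state A B \<omega> k))) \<partial>law opt)
      = (\<integral>\<^sup>+ \<omega>. 0 \<partial>law opt)"
    by (intro nn_integral_cong sum.neutral) (auto simp: relative_entropy_refl opt_pos)
  then show ?thesis
    by (simp add: cost_feasible[OF feasible_opt energy_opt] zero_ennreal.rep_eq)
qed

text \<open>Competitors of infinite energy have infinite cost by definition; for all others the
  excess over \<open>opt_value\<close> is an expected relative entropy.\<close>

lemma optimal_opt: "optimal_policy N e A B S S' opt"
  unfolding optimal_policy_def
proof (intro conjI allI impI)
  show "feasible N A B S S' opt"
    by (rule feasible_opt)
  fix \<rho> assume \<rho>: "feasible N A B S S' \<rho>"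
  show "cost N e A B S opt \<le> cost N e A B S \<rho>"
  proof (cases "(\<integral>\<^sup>+ \<omega>. ennreal (\<Sum>k<N. (norm (snd \<omega> k))\<^sup>2 / 2) \<partial>law \<rho>) = \<infinity>")
    case False
    show ?thesis
      unfolding cost_opt cost_feasible[OF \<rho> False] by (simp add: add_increasing2)
  qed (simp add: cost_def)
qed

text \<open>Vanishing excess only gives equality along the law of x_k under the competitor, which is
  unknown at the outset. Strong induction on k supplies it: agreement at earlier times makes that
  law the nondegenerate Gaussian.\<close>

lemma optimal_unique:
  assumes "optimal_policy N e A B S S' \<pi>" and k: "k < N"
  shows "AE x in lborel. AE u in lborel. \<pi> k x u = opt k x u"
proof -
  have feas: "feasible N A B S S' \<pi>" and le: "cost N e A B S \<pi> \<le> ereal opt_value"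
    using assms feasible_opt cost_opt by (auto simp: optimal_policy_def)
  then have \<pi>: "is_policy N \<pi>"
    by (simp add: feasible_def)
  have energy: "(\<integral>\<^sup>+ \<omega>. ennreal (\<Sum>k<N. (norm (snd \<omega> k))\<^sup>2 / 2) \<partial>law \<pi>) \<noteq> \<infinity>"
    using le by (auto simp: cost_def)
  define D where "D = (\<integral>\<^sup>+ \<omega>. (\<Sum>k<N. ennreal e
    * relative_entropy (\<pi> k (state A B \<omega> k)) (opt k (state A B \<omega> k))) \<partial>law \<pi>)"
  have "ereal opt_value + enn2ereal D \<le> ereal opt_value"
    using le unfolding cost_feasible[OF feas energy] D_def .
  then have D: "D = 0"
    by (cases D) (auto simp: enn2ereal_ennreal)
  show ?thesis
    using k
  proof (induction k rule: less_induct)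
    case (less k)
    have pm [measurable]: "(\<lambda>(x, u). \<pi> k x u) \<in> borel_measurable (borel \<Otimes>\<^sub>M borel)"
      by (rule policy_measurable[OF \<pi> less.prems])
    have rm [measurable]: "(\<lambda>x. relative_entropy (\<pi> k x) (opt k x)) \<in> borel_measurable borel"
      unfolding relative_entropy_def by measurable
    have "(\<integral>\<^sup>+ \<omega>. ennreal e * relative_entropy (\<pi> k (state A B \<omega> k)) (opt k (state A B \<omega> k)) \<partial>law \<pi>) \<le> D"
      unfolding D_def using less.prems
      by (intro nn_integral_mono member_le_sum[of k _ "\<lambda>k. ennreal e
        * relative_entropy (\<pi> k (state A B _ k)) (opt k (state A B _ k))"]) auto
    then have "(\<integral>\<^sup>+ \<omega>. ennreal e * relative_entropy (\<pi> k (state A B \<omega> k)) (opt k (state A B \<omega> k)) \<partial>law \<pi>) = 0"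
      using D by simp
    \<comment> \<open>The induction hypothesis enters here, as the premise of
      \<open>state_law\<close> on all times before k.\<close>
    moreover have "(\<integral>\<^sup>+ \<omega>. ennreal e * relative_entropy (\<pi> k (state A B \<omega> k)) (opt k (state A B \<omega> k)) \<partial>law \<pi>)
        = (\<integral>\<^sup>+ x. ennreal (gaussian_density 0 (cov e S k) x) * (ennreal e * relative_entropy (\<pi> k x) (opt k x)) \<partial>lborel)"
      by (rule state_law[OF \<pi>]) (use less in auto)
    ultimately have "(\<integral>\<^sup>+ x. ennreal (gaussian_density 0 (cov e S k) x)
        * (ennreal e * relative_entropy (\<pi> k x) (opt k x)) \<partial>lborel) = 0"
      by simp
    then have "AE x in lborel. ennreal (gaussian_density 0 (cov e S k) x)
        * (ennreal e * relative_entropy (\<pi> k x) (opt k x)) = 0"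
      by (subst (asm) nn_integral_0_iff_AE) auto
    then have "AE x in lborel. relative_entropy (\<pi> k x) (opt k x) = 0"
    \<comment> \<open>A strictly positive density and \<open>e > 0\<close> can be divided out, which
      passes from the law of x_k to Lebesgue measure.\<close>
    proof eventually_elim
      case (elim x)
      then show ?case
        using e gaussian_density_pos[OF pos_def_cov[OF S e, of k], of 0 x] less.prems
        by (auto simp: ennreal_eq_0_iff)
    qed
    then show ?case
    proof eventually_elim
      case (elim x)
      show ?case
        using elim
      proof (rule relative_entropy_eq_0)
        show "\<pi> k x \<in> borel_measurable borel"
          using measurable_policy[OF \<pi> less.prems, of "\<lambda>_. x" borel "\<lambda>u. u"] by simp
      qed (auto simp: policy_nonneg[OF \<pi> less.prems] opt_pos[OF less.prems])
    qed
  qed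
qed

end

text \<open>The first conjunct certifies that the inverses and the Gaussian densities in the policy
  are genuine, since \<open>matrix_inv\<close> and \<open>gaussian_density\<close> also return
  values at unsuitable matrices. Uniqueness is almost everywhere because changing a conditional
  density on a null set does not change the closed loop.\<close>

theorem theorem1:
  fixes N :: nat and \<epsilon> :: real
    and A :: "nat \<Rightarrow> real^'n^'n" and B :: "nat \<Rightarrow> real^'m^'n"
    and \<Sigma>0 \<Sigma>N S0 SN :: "real^'n^'n" and Q :: "nat \<Rightarrow> real^'n^'n"
  assumes "N > 0" and "\<epsilon> > 0"
    and "pos_def \<Sigma>0" and "pos_def \<Sigma>N"
    and "\<forall>k<N. invertible (A k)"
    and "\<exists>kr\<in>{1..N}. (\<forall>k\<in>{kr..N}. invertible (gram_r A B k 0)) \<and>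
                      (\<forall>k\<in>{0..<kr}. invertible (gram_r A B N k))"
    and "S0 = (1/\<epsilon>) *\<^sub>R (matrix_inv (msqrt (gram_c A B N 0)) ** \<Sigma>0
                         ** matrix_inv (msqrt (gram_c A B N 0)))"
    and "SN = (1/\<epsilon>) *\<^sub>R (matrix_inv (msqrt (gram_c A B N 0))
                         ** Phi A 0 N ** \<Sigma>N ** transpose (Phi A 0 N)
                         ** matrix_inv (msqrt (gram_c A B N 0)))"
    and "invertible (F_map S0 SN)" and "invertible (B_map S0 SN)"
    and "Q 0 = msqrt (gram_c A B N 0) ** msqrt S0 ** matrix_inv (F_map S0 SN)
               ** msqrt S0 ** msqrt (gram_c A B N 0)"
    and "\<forall>k<N. Q (k+1) = A k ** Q k ** transpose (A k) - B k ** transpose (B k)"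
  shows "(\<forall>k<N. invertible (Q (k+1)) \<and>
                pos_def (mat 1 + transpose (B k) ** matrix_inv (Q (k+1)) ** B k)) \<and>
         optimal_policy N \<epsilon> A B \<Sigma>0 \<Sigma>N (gaussian_policy \<epsilon> A B Q) \<and>
         (\<forall>\<pi>. optimal_policy N \<epsilon> A B \<Sigma>0 \<Sigma>N \<pi> \<longrightarrow>
            (\<forall>k<N. AE x in lborel. AE u in lborel. \<pi> k x u = gaussian_policy \<epsilon> A B Q k x u))"
proof -
  define X where "X = Phi A 0 N ** \<Sigma>N ** transpose (Phi A 0 N)"
  \<comment> \<open>The case k = N of the first family, available because
    \<open>kr \<le> N\<close>.\<close>
  have "invertible (gram_r A B N 0)"
    using assms(6) by auto
  then have G: "pos_def (gram_c A B N 0)"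
    using assms(5) by (intro pos_def_gram_c)
  have "invertible (transpose (Phi A 0 N))"
    using assms(5) by (intro transpose_invertible invertible_Phi_0)
  from pos_def_congruence[OF assms(4) this] have X: "pos_def X"
    by (simp add: X_def)
  have SN: "SN = (1/\<epsilon>) *\<^sub>R (matrix_inv (msqrt (gram_c A B N 0)) ** X ** matrix_inv (msqrt (gram_c A B N 0)))"
    by (simp add: assms(8) X_def matrix_mul_assoc)
  note data = schrodinger_initial_data[OF assms(2) G assms(3) X, folded assms(7) SN, OF assms(9), folded assms(11)]
  interpret L: lyapunov N A B Q
    using assms(5,12) G data by unfold_locales auto
  \<comment> \<open>\<open>data(4)\<close> is the terminal equation in time-0 coordinates, with
    \<open>X\<close> the terminal covariance transported back.\<close>
  have "L.cov \<epsilon> \<Sigma>0 N = \<Sigma>N"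
    using assms(2) data(4) by (intro L.cov_terminal) (auto simp: X_def)
  then interpret D: density_control N A B Q \<epsilon> \<Sigma>0 \<Sigma>N
    using assms(2-4) by unfold_locales auto
  show ?thesis
    using L.inv_Q(1) L.pos_def_M D.optimal_opt D.optimal_unique by (auto simp: Suc_le_eq)
qed

end
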